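(* Let $\{\tilde Z^{(r)}\}_{r\in(0,1)}$ be the family of $J$-dimensional SRBMs with regulator processes $\tilde Y^{(r)}$, initial states $\tilde Z^{(r)}(0)$, drift vectors $\theta^{(r)}$, covariance matrix $\Gamma$ and reflection matrix $R$ described in the context. Suppose: (i) for all $r\in(0,1)$, $\theta^{(r)}=-R\delta^{(r)}$ with $\delta^{(r)}=[\gamma_1(r),\dots,\gamma_J(r)]'$; (ii) there is an $\mathbb R_+^J$-valued random vector $\tilde\xi$ with mutually independent components such that $\big(\gamma_1(r)\tilde Z_1^{(r)}(0),\dots,\gamma_J(r)\tilde Z_J^{(r)}(0)\big)\Longrightarrow\tilde\xi$ as $r\to0$, and for all $j=2,\dots,J$, $\gamma_{j-1}(r)\tilde Z_j^{(r)}(0)\to\infty$ in probability as $r\to0$. Then, as $r\to0$, $$\big\{\gamma_k(r)\tilde Z_k^{(r)}(t/\gamma_k^2(r));\ t\ge0\big\}\Longrightarrow\tilde Z_k^*\quad\text{for each }1\le k\le J,$$ where $\tilde Z_k^*$ is a one-dimensional SRBM with initial state $\tilde\xi_k$, drift $\tilde\theta_k=-(1-w_{kk})$ and variance $\tilde\sigma_k^2=(u^{(k)})'\Gamma u^{(k)}$, while $$\big\{\gamma_k(r)\tilde Z_i^{(r)}(t/\gamma_k^2(r));\ t\ge0\big\}\Longrightarrow0\quad\text{for every }1\le i<k\le J,$$ $$\big\{\gamma_k(r)\tilde Y_j^{(r)}(t/\gamma_k^2(r));\ t\ge0\big\}\Longrightarrow0\quad\text{for every }1\le k<j\le J.$$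
   Context: $J\ge1$, $\mathcal J=\{1,\dots,J\}$. For a matrix $M$ and index sets $A,B$, $M_{A,B}$ is the submatrix with rows in $A$ and columns in $B$; $[\ell:k]=\{\ell,\dots,k\}$; $M_{A,k}=M_{A,\{k\}}$, $M_{k,B}=M_{\{k\},B}$, $M_k=M_{[1:k],[1:k]}$; terms with empty index sets are absent. Prime denotes transpose. For $i\le j$ in $\mathcal J$, $w_{ij}$ is defined by $(w_{1j},\dots,w_{j-1,j})=-R_{j,[1:j-1]}R_{j-1}^{-1}$ and $w_{jj}=1-R_{jj}+R_{j,[1:j-1]}R_{j-1}^{-1}R_{[1:j-1],j}$, and $u^{(j)}=(w_{1j},\dots,w_{j-1,j},1,0,\dots,0)'$. Scale functions. $\gamma_1,\dots,\gamma_J:(0,1)\to(0,\infty)$ are strictly increasing, $\lim_{r\to0}\gamma_j(r)=0$, $\lim_{r\to0}\gamma_j(r)/\gamma_i(r)=0$ for $i<j$, and, for a fixed $\varepsilon\in(0,1)$, $\lim_{r\to0}\gamma_1(r)^{(2-\varepsilon)/(2+\varepsilon)}\sqrt{\log\log(1/\gamma_1(r))}\,\log\log(1/\gamma_J(r))=0$. Skorokhod map. A matrix $R$ is an $\mathcal M$-matrix if $R=sI-B$ with $s>0$, $B\ge0$ entrywise and spectral radius of $B$ less than $s$. For an $\mathcal M$-matrix $R\in\mathbb R^{d\times d}$ and a càdlàg path $x$ in $\mathbb R^d$ with $x(0)\in\mathbb R_+^d$, there is a unique pair $(z,y)=(\Phi(x;R),\Psi(x;R))$ of càdlàg $\mathbb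 R_+^d$-valued paths with $z=x+Ry$, each $y_j$ nondecreasing with $y_j(0)=0$, and $\int_0^\infty z_j\,dy_j=0$. When $d=1$, $z=\Phi(x)$ does not depend on the positive scalar $R$. SRBM family. $\Gamma$ is a positive definite $J\times J$ matrix with Cholesky decomposition $\Gamma=LL'$, $R$ is a $J\times J$ $\mathcal M$-matrix, $W$ is a $J$-dimensional standard Brownian motion; $\Gamma,R,W$ do not depend on $r$. For each $r\in(0,1)$, $\tilde Z^{(r)}(0)$ is an $\mathbb R_+^J$-valued random vector independent of $W$, $\tilde X^{(r)}(t)=\tilde Z^{(r)}(0)+\theta^{(r)}t+LW(t)$, $\tilde Y^{(r)}=\Psi(\tilde X^{(r)};R)$ and $\tilde Z^{(r)}=\Phi(\tilde X^{(r)};R)=\tilde X^{(r)}+R\tilde Y^{(r)}$. A one-dimensional SRBM with initial state $x$, drift $\theta$, variance $\sigma^2$ is $\Phi(X)$ with $X(t)=x+\theta t+\sigma W_0(t)$, $W_0$ a standard one-dimensional Brownian motion independent of $x$. $\Longrightarrow$ denotes weak convergence, for processes in the path space with the topology of uniform convergence on compact time intervals. *)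

theory Defs
  imports
    "HOL-Probability.Probability"
    "Jordan_Normal_Form.Spectral_Radius"
    "Jordan_Normal_Form.DL_Submatrix"
    "Jordan_Normal_Form.Gauss_Jordan_Elimination"
begin

unbundle no vec_syntax

text \<open>
  Coordinates are numbered from 0: coordinate \<open>j < J\<close> here is the coordinate with
  one-based number \<open>j + 1\<close>, so that the one-based blocks \<open>[1:j]\<close> become \<open>{..<j}\<close>.
  A path in \<open>d\<close> dimensions is a function \<open>x :: nat \<Rightarrow> real \<Rightarrow> real\<close>, where \<open>x j t\<close> is
  coordinate \<open>j\<close> at time \<open>t\<close>; only \<open>j < d\<close> and \<open>t \<ge> 0\<close> are meaningful.
\<close>

subsection \<open>Matrices\<close>

definition pos_def_mat :: "nat \<Rightarrow> real mat \<Rightarrow> bool" where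
  "pos_def_mat d A \<longleftrightarrow> A \<in> carrier_mat d d \<and> transpose_mat A = A \<and>
     (\<forall>v \<in> carrier_vec d. v \<noteq> 0\<^sub>v d \<longrightarrow> scalar_prod v (A *\<^sub>v v) > 0)"

definition cholesky :: "nat \<Rightarrow> real mat \<Rightarrow> real mat \<Rightarrow> bool" where
  "cholesky d A L \<longleftrightarrow> L \<in> carrier_mat d d \<and> upper_triangular (transpose_mat L) \<and>
     (\<forall>j<d. L $$ (j, j) > 0) \<and> A = L * transpose_mat L"

definition M_matrix :: "nat \<Rightarrow> real mat \<Rightarrow> bool" where
  "M_matrix d R \<longleftrightarrow> (\<exists>s B. s > 0 \<and> B \<in> carrier_mat d d \<and>
     (\<forall>i<d. \<forall>j<d. B $$ (i, j) \<ge> 0) \<and>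
     spectral_radius (map_mat complex_of_real B) < s \<and>
     R = s \<cdot>\<^sub>m 1\<^sub>m d - B)"

text \<open>\<open>mat_inverse\<close> returns \<open>None\<close> on singular matrices; it is only applied to
  leading principal submatrices of \<open>M\<close>-matrices, which are invertible.\<close>

definition block_inverse :: "real mat \<Rightarrow> nat \<Rightarrow> real mat" where
  "block_inverse R j = the (mat_inverse (submatrix R {..<j} {..<j}))"

definition w_coeff :: "real mat \<Rightarrow> nat \<Rightarrow> nat \<Rightarrow> real" where
  "w_coeff R i j =
     (if i < j then (- (submatrix R {j} {..<j} * block_inverse R j)) $$ (0, i)
      else if i = j then
        1 - R $$ (j, j) +
        (submatrix R {j} {..<j} * block_inverse R j * submatrix R {..<j} {j}) $$ (0, 0)
      else undefined)"

definition u_vec :: "nat \<Rightarrow> real mat \<Rightarrow> nat \<Rightarrow> real Matrix.vec" where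
  "u_vec J R k = Matrix.vec J (\<lambda>i. if i < k then w_coeff R i k else if i = k then 1 else 0)"

definition limit_drift :: "real mat \<Rightarrow> nat \<Rightarrow> real" where
  "limit_drift R k = - (1 - w_coeff R k k)"

definition limit_variance :: "nat \<Rightarrow> real mat \<Rightarrow> real mat \<Rightarrow> nat \<Rightarrow> real" where
  "limit_variance J \<Gamma> R k = scalar_prod (u_vec J R k) (\<Gamma> *\<^sub>v u_vec J R k)"

subsection \<open>The Skorokhod map\<close>

definition cadlag :: "(real \<Rightarrow> real) \<Rightarrow> bool" where
  "cadlag x \<longleftrightarrow> (\<forall>t\<ge>0. continuous (at_right t) x) \<and> (\<forall>t>0. \<exists>l. (x \<longlongrightarrow> l) (at_left t))"

text \<open>The Stieltjes measure \<open>dy\<^sub>j\<close> is the library's \<open>interval_measure\<close>, which expects a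
  distribution function on the whole line; \<open>y\<^sub>j\<close> is extended by \<open>y\<^sub>j 0 = 0\<close> to negative times.\<close>

definition skorokhod_pair ::
    "nat \<Rightarrow> real mat \<Rightarrow> (nat \<Rightarrow> real \<Rightarrow> real) \<Rightarrow> (nat \<Rightarrow> real \<Rightarrow> real) \<Rightarrow> (nat \<Rightarrow> real \<Rightarrow> real) \<Rightarrow> bool" where
  "skorokhod_pair d R x z y \<longleftrightarrow> (\<forall>j<d.
     cadlag (z j) \<and> cadlag (y j) \<and>
     (\<forall>t\<ge>0. z j t \<ge> 0 \<and> y j t \<ge> 0) \<and>
     (\<forall>t\<ge>0. z j t = x j t + (\<Sum>k<d. R $$ (j, k) * y k t)) \<and>
     mono_on {0..} (y j) \<and> y j 0 = 0 \<and>
     (\<integral>\<^sup>+ t \<in> {0..}. ennreal (z j t) \<partial>interval_measure (\<lambda>t. y j (max 0 t))) = 0)"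

text \<open>The pair is unique on coordinates \<open>j < d\<close> and times \<open>t \<ge> 0\<close>; the choice operator only
  chooses the meaningless values outside this range.\<close>

definition skorokhod_map ::
    "nat \<Rightarrow> real mat \<Rightarrow> (nat \<Rightarrow> real \<Rightarrow> real) \<Rightarrow> (nat \<Rightarrow> real \<Rightarrow> real) \<times> (nat \<Rightarrow> real \<Rightarrow> real)" where
  "skorokhod_map d R x = (SOME p. skorokhod_pair d R x (fst p) (snd p))"

definition Phi :: "nat \<Rightarrow> real mat \<Rightarrow> (nat \<Rightarrow> real \<Rightarrow> real) \<Rightarrow> (nat \<Rightarrow> real \<Rightarrow> real)" where
  "Phi d R x = fst (skorokhod_map d R x)"

definition Psi :: "nat \<Rightarrow> real mat \<Rightarrow> (nat \<Rightarrow> real \<Rightarrow> real) \<Rightarrow> (nat \<Rightarrow> real \<Rightarrow> real)" where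
  "Psi d R x = snd (skorokhod_map d R x)"

definition Phi1 :: "(real \<Rightarrow> real) \<Rightarrow> (real \<Rightarrow> real)" where
  "Phi1 x = Phi 1 (1\<^sub>m 1) (\<lambda>_. x) 0"

subsection \<open>Brownian motion and semimartingale reflecting Brownian motion\<close>

definition std_brownian_motion :: "'a measure \<Rightarrow> nat \<Rightarrow> (nat \<Rightarrow> real \<Rightarrow> 'a \<Rightarrow> real) \<Rightarrow> bool" where
  "std_brownian_motion M d W \<longleftrightarrow> prob_space M \<and>
     (\<forall>j<d. \<forall>t\<ge>0. W j t \<in> borel_measurable M) \<and>
     (\<forall>j<d. \<forall>\<omega>\<in>space M. W j 0 \<omega> = 0 \<and> continuous_on {0..} (\<lambda>t. W j t \<omega>)) \<and>
     (\<forall>j<d. \<forall>s t. 0 \<le> s \<and> s < t \<longrightarrow>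
        distributed M lborel (\<lambda>\<omega>. W j t \<omega> - W j s \<omega>) (normal_density 0 (sqrt (t - s)))) \<and>
     (\<forall>n t. 0 \<le> t 0 \<and> (\<forall>i<n. t i \<le> t (Suc i)) \<longrightarrow>
        prob_space.indep_vars M (\<lambda>_. borel)
          (\<lambda>(j, i) \<omega>. W j (t (Suc i)) \<omega> - W j (t i) \<omega>) ({..<d} \<times> {..<n::nat}))"

text \<open>The library's \<open>indep_var\<close> forces both random elements to have values in the same type; this
  is the same notion for two value types.\<close>

definition indep_elements ::
    "'a measure \<Rightarrow> 's measure \<Rightarrow> ('a \<Rightarrow> 's) \<Rightarrow> 't measure \<Rightarrow> ('a \<Rightarrow> 't) \<Rightarrow> bool" where
  "indep_elements M S X T Y \<longleftrightarrow> X \<in> measurable M S \<and> Y \<in> measurable M T \<and>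
     prob_space.indep_set M {X -` A \<inter> space M | A. A \<in> sets S} {Y -` B \<inter> space M | B. B \<in> sets T}"

text \<open>The whole process as one random element of the product space, so that independence of
  the process can be expressed.\<close>

definition process_element :: "nat \<Rightarrow> (nat \<Rightarrow> real \<Rightarrow> 'a \<Rightarrow> real) \<Rightarrow> 'a \<Rightarrow> (nat \<times> real \<Rightarrow> real)" where
  "process_element d W \<omega> = (\<lambda>(j, t) \<in> {..<d} \<times> {0..}. W j t \<omega>)"

abbreviation process_space :: "nat \<Rightarrow> (nat \<times> real \<Rightarrow> real) measure" where
  "process_space d \<equiv> Pi\<^sub>M ({..<d} \<times> {0..}) (\<lambda>_. borel)"

definition srbm_input ::
    "nat \<Rightarrow> real mat \<Rightarrow> real Matrix.vec \<Rightarrow> (nat \<Rightarrow> 'a \<Rightarrow> real) \<Rightarrow> (nat \<Rightarrow> real \<Rightarrow> 'a \<Rightarrow> real) \<Rightarrow>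
     'a \<Rightarrow> nat \<Rightarrow> real \<Rightarrow> real" where
  "srbm_input J L \<theta> z0 W \<omega> j t = z0 j \<omega> + \<theta> $ j * t + (\<Sum>k<J. L $$ (j, k) * W k t \<omega>)"

definition one_dim_srbm ::
    "'a measure \<Rightarrow> ('a \<Rightarrow> real) \<Rightarrow> real \<Rightarrow> real \<Rightarrow> ('a \<Rightarrow> real \<Rightarrow> real) \<Rightarrow> bool" where
  "one_dim_srbm N x \<theta> \<sigma>2 Z \<longleftrightarrow> prob_space N \<and> x \<in> borel_measurable N \<and> (\<forall>\<omega>\<in>space N. x \<omega> \<ge> 0) \<and>
     (\<exists>W. std_brownian_motion N 1 W \<and>
        indep_elements N borel x (process_space 1) (process_element 1 W) \<and>
        (\<forall>\<omega>\<in>space N. Z \<omega> = Phi1 (\<lambda>t. x \<omega> + \<theta> * t + sqrt \<sigma>2 * W 0 t \<omega>)))"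

subsection \<open>Weak convergence\<close>

definition borel_of_topology :: "'x topology \<Rightarrow> 'x measure" where
  "borel_of_topology T = sigma (topspace T) {U. openin T U}"

text \<open>Weak convergence, along the filter \<open>F\<close>, of random elements \<open>X r\<close> on \<open>M\<close> to a random
  element \<open>Y\<close> on \<open>N\<close>, with values in the topological space \<open>T\<close>. Borel measurability is part of
  the definition, so that the integrals are never those of non-measurable functions.\<close>

definition converges_in_law ::
    "'x topology \<Rightarrow> 'i filter \<Rightarrow> 'a measure \<Rightarrow> ('i \<Rightarrow> 'a \<Rightarrow> 'x) \<Rightarrow> 'b measure \<Rightarrow> ('b \<Rightarrow> 'x) \<Rightarrow> bool" where
  "converges_in_law T F M X N Y \<longleftrightarrow>
     (\<forall>\<^sub>F r in F. X r \<in> measurable M (borel_of_topology T)) \<and>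
     Y \<in> measurable N (borel_of_topology T) \<and>
     (\<forall>f. continuous_map T euclideanreal f \<and> bounded (f ` topspace T) \<longrightarrow>
        ((\<lambda>r. \<integral>\<omega>. f (X r \<omega>) \<partial>M) \<longlongrightarrow> (\<integral>\<omega>. f (Y \<omega>) \<partial>N)) F)"

definition tends_to_infinity_in_probability ::
    "'i filter \<Rightarrow> 'a measure \<Rightarrow> ('i \<Rightarrow> 'a \<Rightarrow> real) \<Rightarrow> bool" where
  "tends_to_infinity_in_probability F M X \<longleftrightarrow>
     (\<forall>K. ((\<lambda>r. measure M {\<omega> \<in> space M. X r \<omega> > K}) \<longlongrightarrow> 1) F)"

text \<open>Cadlag paths on \<open>[0, \<infinity>)\<close> with uniform convergence on compact time intervals. Paths that
  differ only at negative times are topologically indistinguishable, so continuous functionals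
  and Borel sets do not see these values.\<close>

definition path_topology :: "(real \<Rightarrow> real) topology" where
  "path_topology = topology (\<lambda>U. U \<subseteq> Collect cadlag \<and>
     (\<forall>x\<in>U. \<exists>T e. e > 0 \<and> {y. cadlag y \<and> (\<forall>t\<in>{0..T}. \<bar>y t - x t\<bar> < e)} \<subseteq> U))"

lemma openin_path_topology:
  "openin path_topology U \<longleftrightarrow> U \<subseteq> Collect cadlag \<and>
     (\<forall>x\<in>U. \<exists>T e. e > 0 \<and> {y. cadlag y \<and> (\<forall>t\<in>{0..T}. \<bar>y t - x t\<bar> < e)} \<subseteq> U)"
proof -
  let ?N = "\<lambda>x T e. {y. cadlag y \<and> (\<forall>t\<in>{0..T}. \<bar>y t - x t\<bar> < e)}"
  let ?P = "\<lambda>U. U \<subseteq> Collect cadlag \<and> (\<forall>x\<in>U. \<exists>T e. e > 0 \<and> ?N x T e \<subseteq> U)"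
  have "istopology ?P"
    unfolding istopology_def
  proof (intro conjI allI impI)
    fix A B assume A: "?P A" and B: "?P B"
    show "A \<inter> B \<subseteq> Collect cadlag" using A by blast
    show "\<forall>x\<in>A \<inter> B. \<exists>T e. e > 0 \<and> ?N x T e \<subseteq> A \<inter> B"
    proof
      fix x assume x: "x \<in> A \<inter> B"
      have "\<exists>T e. e > 0 \<and> ?N x T e \<subseteq> A" using A x by simp
      then obtain T1 e1 where 1: "e1 > 0" "?N x T1 e1 \<subseteq> A" by (elim exE conjE)
      have "\<exists>T e. e > 0 \<and> ?N x T e \<subseteq> B" using B x by simp
      then obtain T2 e2 where 2: "e2 > 0" "?N x T2 e2 \<subseteq> B" by (elim exE conjE)
      have "?N x (max T1 T2) (min e1 e2) \<subseteq> ?N x T1 e1"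
        "?N x (max T1 T2) (min e1 e2) \<subseteq> ?N x T2 e2" by auto
      with 1(2) 2(2) have "?N x (max T1 T2) (min e1 e2) \<subseteq> A \<inter> B"
        by (meson Int_greatest subset_trans)
      moreover have "min e1 e2 > 0" using 1(1) 2(1) by simp
      ultimately show "\<exists>T e. e > 0 \<and> ?N x T e \<subseteq> A \<inter> B" by (intro exI conjI)
    qed
  next
    fix \<K> assume K: "\<forall>K\<in>\<K>. ?P K"
    then show "\<Union>\<K> \<subseteq> Collect cadlag" by (intro Union_least) simp
    show "\<forall>x\<in>\<Union>\<K>. \<exists>T e. e > 0 \<and> ?N x T e \<subseteq> \<Union>\<K>"
    proof
      fix x assume "x \<in> \<Union>\<K>"
      then obtain K' where K': "K' \<in> \<K>" "x \<in> K'" by blast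
      then have "\<exists>T e. e > 0 \<and> ?N x T e \<subseteq> K'" using K by simp
      then obtain T e where Te: "e > 0" "?N x T e \<subseteq> K'" by (elim exE conjE)
      have "?N x T e \<subseteq> \<Union>\<K>" using Te(2) Union_upper[OF K'(1)] by (rule subset_trans)
      with Te(1) show "\<exists>T e. e > 0 \<and> ?N x T e \<subseteq> \<Union>\<K>" by (intro exI conjI)
    qed
  qed
  then show ?thesis
    unfolding path_topology_def by (simp only: topology_inverse')
qed

lemma topspace_path_topology: "topspace path_topology = Collect cadlag"
proof -
  have "openin path_topology (Collect cadlag)"
    unfolding openin_path_topology
    by (intro conjI ballI subset_refl exI[of _ 0] exI[of _ "1::real"]) auto
  then show ?thesis
    using openin_path_topology[of "topspace path_topology"] openin_subset[of path_topology]
    by (intro subset_antisym) auto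
qed

end

theory Submission
  imports Defs "HOL-Complex_Analysis.Great_Picard"
begin

text \<open>
  Fix \<open>k\<close> and look at the network on the time scale \<open>1 / \<gamma>\<^sub>k\<^sup>2\<close>. Put \<open>c\<^sub>i = \<gamma>\<^sub>i / \<gamma>\<^sub>k\<close> and centre the
  scaled regulators, \<open>V\<^sub>i t = Y\<^sub>i t - c\<^sub>i t\<close>. Since the drift is \<open>- R \<delta>\<close>, the scaled network satisfies
  \<open>Z = z + B + R V\<close>, where \<open>z\<close> is the scaled initial state and \<open>B\<close> is \<open>L\<close> applied to a standard
  Brownian motion whose law does not depend on \<open>r\<close>. The coordinates before \<open>k\<close> have
  \<open>c\<^sub>i \<rightarrow> \<infinity>\<close> and start near 0; those after \<open>k\<close> have \<open>c\<^sub>i \<rightarrow> 0\<close> and start near infinity.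
  Three pathwise estimates use nothing about \<open>B\<close> but a bound and a modulus of continuity.

  \<^item> A coordinate \<open>j > k\<close> does not reach 0 in bounded time (\<open>slow_coordinates_free\<close>). The regulator is the least
    nondecreasing path that keeps the network nonnegative (\<open>reflected_minimal\<close>), and a competitor
    is \<open>c\<^sub>i t + \<beta> a\<^sub>i\<close> for \<open>i \<le> k\<close> and 0 for \<open>i > k\<close>, where \<open>a \<ge> 0\<close> solves \<open>R a = 1\<close> on the
    coordinates up to \<open>k\<close>.
  \<^item> A coordinate \<open>i < k\<close> stays near 0 (\<open>fast_coordinate_small\<close>). The row vector \<open>(u\<^sup>(\<^sup>i\<^sup>))' R\<close>
    vanishes before \<open>i\<close>, equals \<open>1 - w\<^sub>i\<^sub>i > 0\<close> at \<open>i\<close> and is nonpositive after \<open>i\<close>. Multiplication of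
    the network by \<open>u\<^sup>(\<^sup>i\<^sup>)\<close> thus eliminates the faster regulators; while \<open>Y\<^sub>i\<close> is at rest, \<open>Z\<^sub>i\<close> has a
    downward drift of order \<open>c\<^sub>i\<close>, which beats the noise as soon as a time of the order of the
    modulus of continuity has passed. Induction on \<open>i\<close> treats the faster coordinates as small errors.
  \<^item> The same elimination with \<open>i = k\<close> shows that \<open>Z\<^sub>k\<close> is the one-dimensional reflection of
    \<open>z\<^sub>k + (u\<^sup>(\<^sup>k\<^sup>))' B - (1 - w\<^sub>k\<^sub>k) t\<close> up to a small uniform error (\<open>active_coordinate_close\<close>).

  As the law of the scaled noise is the same for all \<open>r\<close>, with probability close to 1 its bound
  and modulus are uniform in \<open>r\<close> (\<open>noise_tight\<close>). This proves the two convergences to 0. For the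
  convergence to an SRBM, the exact reflected Brownian motion with initial state \<open>z\<^sub>k\<close> has mean
  value \<open>E (h z\<^sub>k)\<close> for a test functional \<open>f\<close>, where the bounded continuous function \<open>h\<close> does not
  depend on \<open>r\<close> (\<open>srbm_expectation\<close>); so weak convergence of \<open>z\<^sub>k\<close> suffices. The error between \<open>Z\<^sub>k\<close> and
  this process is harmless because \<open>f\<close> is uniformly continuous near compact sets of paths, and by
  the Arzela-Ascoli theorem uniform moduli of continuity provide such sets
  (\<open>path_functional_uniform\<close>).

  All this presupposes that the chosen Skorokhod pair is the unique one and that it is a continuous and
  measurable function of its input; this is proved by Picard iteration (\<open>Phi_Psi_reflected\<close>,
  \<open>Phi_Psi_measurable\<close>).
\<close>

section \<open>Nonsingular M-matrices and elimination vectors\<close>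

text \<open>
  The property of an \<open>M\<close>-matrix that the proofs use. Unlike the spectral radius it is
  obviously inherited by leading blocks, and it is exactly what a comparison of two regulators
  needs: the vector of their largest differences is nonnegative and is mapped to a nonpositive
  vector.
\<close>
definition nonsingular_M :: "nat \<Rightarrow> (nat \<Rightarrow> nat \<Rightarrow> real) \<Rightarrow> bool" where
  "nonsingular_M d R \<longleftrightarrow> (\<forall>i<d. \<forall>j<d. i \<noteq> j \<longrightarrow> R i j \<le> 0) \<and>
     (\<forall>u. (\<forall>i<d. u i \<ge> 0) \<longrightarrow> (\<forall>i<d. (\<Sum>j<d. R i j * u j) \<le> 0) \<longrightarrow> (\<forall>i<d. u i = 0))"

lemma spectral_radius_smult_less:
  fixes A :: "complex mat"
  assumes A: "A \<in> carrier_mat n n" and n: "n > 0" and c: "c > 0" and "spectral_radius A < c"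
  shows "spectral_radius (complex_of_real (1 / c) \<cdot>\<^sub>m A) < 1"
proof -
  let ?C = "complex_of_real (1 / c) \<cdot>\<^sub>m A"
  have C: "?C \<in> carrier_mat n n" using A by simp
  obtain l where l: "l \<in> spectrum ?C" "spectral_radius ?C = norm l"
    using spectral_radius_mem_max(1)[OF C n] by auto
  then obtain v where v: "eigenvector ?C v l"
    unfolding spectrum_def eigenvalue_def by auto
  then have vc: "v \<in> carrier_vec n" "v \<noteq> 0\<^sub>v n" and ev: "?C *\<^sub>v v = l \<cdot>\<^sub>v v"
    unfolding eigenvector_def using A by auto
  have "A *\<^sub>v v = complex_of_real c \<cdot>\<^sub>v (?C *\<^sub>v v)"
    using A vc c by (intro eq_vecI) (auto simp: scalar_prod_def sum_distrib_left)
  also have "\<dots> = (complex_of_real c * l) \<cdot>\<^sub>v v" unfolding ev by (simp add: smult_smult_assoc)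
  finally have "eigenvector A v (complex_of_real c * l)"
    unfolding eigenvector_def using A vc by auto
  then have "complex_of_real c * l \<in> spectrum A"
    unfolding spectrum_def eigenvalue_def by auto
  then have "norm (complex_of_real c * l) \<le> spectral_radius A"
    using spectral_radius_mem_max(2)[OF A n] by blast
  then have "c * norm l \<le> spectral_radius A" using c by (simp add: norm_mult)
  then have "c * norm l < c * 1" using assms(4) by linarith
  then show ?thesis using c l(2) by (simp only: mult_less_cancel_left_pos)
qed

text \<open>
  Write \<open>R = s I - B\<close>. A nonnegative \<open>u\<close> with \<open>R u \<le> 0\<close>
  satisfies \<open>s u \<le> B u\<close>, hence \<open>s\<^sup>n u \<le> B\<^sup>n u\<close>. For
  \<open>c\<close> strictly between the spectral radius and \<open>s\<close> the powers of
  \<open>B / c\<close> are bounded, whereas \<open>(s / c)\<^sup>n\<close> is not; so \<open>u =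
  0\<close>.
\<close>
lemma nonsingular_M_of_M_matrix:
  assumes M: "M_matrix d R" and d: "d \<ge> 1"
  shows "nonsingular_M d (\<lambda>i j. R $$ (i, j))" and "R \<in> carrier_mat d d"
proof -
  obtain s B where s: "s > 0" and B: "B \<in> carrier_mat d d"
    and Bn: "\<And>i j. i < d \<Longrightarrow> j < d \<Longrightarrow> B $$ (i, j) \<ge> 0"
    and sr: "spectral_radius (map_mat complex_of_real B) < s"
    and R: "R = s \<cdot>\<^sub>m 1\<^sub>m d - B"
    using M unfolding M_matrix_def by blast
  show "R \<in> carrier_mat d d" using R B by auto
  have Rij: "R $$ (i, j) = (if i = j then s else 0) - B $$ (i, j)" if "i < d" "j < d" for i j
    using R B that by auto
  let ?Bc = "map_mat complex_of_real B"
  have Bc: "?Bc \<in> carrier_mat d d" using B by simp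
  have sr0: "spectral_radius ?Bc \<ge> 0"
    using spectral_radius_mem_max(1)[OF Bc] d by auto
  \<comment> \<open>any number strictly between the spectral radius and s\<close>
  define c where "c = (spectral_radius ?Bc + s) / 2"
  have c: "c > 0" "c < s" "spectral_radius ?Bc < c" using sr sr0 s by (auto simp: c_def)
  define N where "N = (1 / c) \<cdot>\<^sub>m B"
  have N: "N \<in> carrier_mat d d" using B by (simp add: N_def)
  have Nn: "N $$ (i, j) \<ge> 0" if "i < d" "j < d" for i j using B Bn that c by (simp add: N_def)
  have NC: "map_mat complex_of_real N = complex_of_real (1 / c) \<cdot>\<^sub>m ?Bc"
    using B by (intro eq_matI) (auto simp: N_def)
  have "spectral_radius (map_mat complex_of_real N) < 1"
    unfolding NC using spectral_radius_smult_less[OF Bc] d c by simp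
  then obtain b where b: "\<And>k. norm_bound (map_mat complex_of_real N ^\<^sub>m k) b"
    using spectral_radius_jnf_norm_bound_less_1_upper_triangular[of "map_mat complex_of_real N" d] N
    by auto
  have Npow: "N ^\<^sub>m k \<in> carrier_mat d d" for k using N by simp
  have bnd: "\<bar>(N ^\<^sub>m k) $$ (i, j)\<bar> \<le> b" if "i < d" "j < d" for i j k
  proof -
    have "map_mat complex_of_real (N ^\<^sub>m k) = map_mat complex_of_real N ^\<^sub>m k"
      using N by (rule of_real_hom.mat_hom_pow)
    then have "norm (map_mat complex_of_real (N ^\<^sub>m k) $$ (i, j)) \<le> b"
      using b[of k] that N unfolding norm_bound_def by simp
    moreover have "map_mat complex_of_real (N ^\<^sub>m k) $$ (i, j) = complex_of_real ((N ^\<^sub>m k) $$ (i, j))"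
      using that Npow[of k] by (intro index_map_mat) auto
    ultimately show ?thesis by (metis norm_of_real)
  qed
  have sum_pow: "(N ^\<^sub>m Suc k) $$ (i, j) = (\<Sum>l<d. (N ^\<^sub>m k) $$ (i, l) * N $$ (l, j))"
    if "i < d" "j < d" for i j k
    using that Npow[of k] N by (simp add: scalar_prod_def lessThan_atLeast0)
  have pow_nonneg: "(N ^\<^sub>m k) $$ (i, j) \<ge> 0" if "i < d" "j < d" for i j k
    using that
  proof (induction k arbitrary: i j)
    case 0 then show ?case using N by simp
  next
    case (Suc k) then show ?case
      unfolding sum_pow[OF Suc.prems] using Nn by (intro sum_nonneg mult_nonneg_nonneg) auto
  qed
  show "nonsingular_M d (\<lambda>i j. R $$ (i, j))"
    unfolding nonsingular_M_def
  proof (intro conjI allI impI)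
    fix i j assume "i < d" "j < d" "i \<noteq> j"
    then show "R $$ (i, j) \<le> 0" using Rij Bn by simp
  next
    fix u :: "nat \<Rightarrow> real" and i
    assume u: "\<forall>i<d. u i \<ge> 0" and Ru: "\<forall>i<d. (\<Sum>j<d. R $$ (i, j) * u j) \<le> 0" and i: "i < d"
    define q where "q = s / c"
    have q: "q > 1" using c by (simp add: q_def)
    have step: "q * u j \<le> (\<Sum>l<d. N $$ (j, l) * u l)" if j: "j < d" for j
    proof -
      have "(\<Sum>l<d. R $$ (j, l) * u l) = (\<Sum>l<d. (if j = l then s * u l else 0) - B $$ (j, l) * u l)"
        using j by (intro sum.cong) (auto simp: Rij algebra_simps)
      also have "\<dots> = s * u j - (\<Sum>l<d. B $$ (j, l) * u l)"
        using j by (simp add: sum_subtractf)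
      finally have "s * u j \<le> (\<Sum>l<d. B $$ (j, l) * u l)"
        using Ru[rule_format, OF j] by linarith
      moreover have "(\<Sum>l<d. N $$ (j, l) * u l) = (\<Sum>l<d. B $$ (j, l) * u l) / c"
        unfolding sum_divide_distrib using B j by (intro sum.cong) (auto simp: N_def)
      ultimately show ?thesis using c by (simp add: q_def field_simps)
    qed
    have iter: "q ^ k * u j \<le> (\<Sum>l<d. (N ^\<^sub>m k) $$ (j, l) * u l)" if "j < d" for j k
      using that
    proof (induction k)
      case 0
      have "(\<Sum>l<d. (N ^\<^sub>m 0) $$ (j, l) * u l) = (\<Sum>l<d. if j = l then u l else 0)"
        using N 0 by (intro sum.cong) auto
      then show ?case using 0 by simp
    next
      case (Suc k)
      have "q ^ Suc k * u j \<le> q * (\<Sum>l<d. (N ^\<^sub>m k) $$ (j, l) * u l)"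
        using Suc q by (simp add: mult.assoc mult_left_mono)
      also have "\<dots> = (\<Sum>l<d. (N ^\<^sub>m k) $$ (j, l) * (q * u l))"
        by (simp add: sum_distrib_left algebra_simps)
      also have "\<dots> \<le> (\<Sum>l<d. (N ^\<^sub>m k) $$ (j, l) * (\<Sum>m<d. N $$ (l, m) * u m))"
        using Suc.prems pow_nonneg step by (intro sum_mono mult_left_mono) auto
      also have "\<dots> = (\<Sum>m<d. \<Sum>l<d. (N ^\<^sub>m k) $$ (j, l) * N $$ (l, m) * u m)"
        by (subst sum.swap) (simp add: sum_distrib_left mult.assoc)
      also have "\<dots> = (\<Sum>m<d. (N ^\<^sub>m Suc k) $$ (j, m) * u m)"
        unfolding sum_distrib_right[symmetric]
        using Suc.prems sum_pow by (intro sum.cong) auto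
      finally show ?case .
    qed
    define S where "S = (\<Sum>l<d. b * u l)"
    have up: "q ^ k * u i \<le> S" for k
      unfolding S_def
      using iter[OF i, of k] bnd[OF i, of _ k] u
      by (intro order_trans[OF iter[OF i, of k]] sum_mono mult_right_mono)
        (auto intro: order_trans[OF abs_ge_self])
    show "u i = 0"
    proof (rule ccontr)
      assume "u i \<noteq> 0"
      then have ui: "u i > 0" using u i by (simp add: order_less_le)
      obtain k where "q ^ k > S / u i" using real_arch_pow[OF q] by blast
      then show False using up[of k] ui by (simp add: field_simps)
    qed
  qed
qed

text \<open>
  A vector on the block is extended by 0. The rows outside the block see only off-diagonal entries
  and stay nonpositive automatically.
\<close>
lemma nonsingular_M_block:
  assumes "nonsingular_M d R" "m \<le> d"
  shows "nonsingular_M m R"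
  unfolding nonsingular_M_def
proof (intro conjI allI impI)
  show "R i j \<le> 0" if "i < m" "j < m" "i \<noteq> j" for i j
    using assms that unfolding nonsingular_M_def by auto
  fix u :: "nat \<Rightarrow> real" and i
  assume u: "\<forall>i<m. u i \<ge> 0" and Ru: "\<forall>i<m. (\<Sum>j<m. R i j * u j) \<le> 0" and i: "i < m"
  define u' where "u' = (\<lambda>i. if i < m then u i else 0)"
  have sum_eq: "(\<Sum>j<d. R i j * u' j) = (\<Sum>j<m. R i j * u j)" for i
    using assms(2) by (intro sum.mono_neutral_cong_right) (auto simp: u'_def)
  have "(\<Sum>j<d. R i j * u' j) \<le> 0" if "i < d" for i
  proof (cases "i < m")
    case True then show ?thesis using Ru sum_eq by simp
  next
    case False
    then have "(\<Sum>j<m. R i j * u j) \<le> (\<Sum>j<m. 0)"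
      using u assms that unfolding nonsingular_M_def
      by (intro sum_mono mult_nonpos_nonneg) auto
    then show ?thesis using sum_eq by simp
  qed
  moreover have "\<forall>i<d. u' i \<ge> 0" using u by (simp add: u'_def)
  ultimately have "\<forall>i<d. u' i = 0" using assms(1) unfolding nonsingular_M_def by blast
  then show "u i = 0" using i assms(2) by (auto simp: u'_def split: if_splits)
qed

text \<open>
  The negative part of \<open>v\<close> is mapped to a nonpositive vector, so it vanishes.
\<close>
lemma nonsingular_M_inverse_nonneg:
  assumes M: "nonsingular_M d R" and Rv: "\<And>i. i < d \<Longrightarrow> (\<Sum>j<d. R i j * v j) \<ge> 0" and i: "i < d"
  shows "v i \<ge> 0"
proof -
  define u where "u = (\<lambda>j. max 0 (- v j))"
  have "(\<Sum>j<d. R l j * u j) \<le> 0" if l: "l < d" for l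
  proof (cases "v l < 0")
    case True
    have "(\<Sum>j<d. R l j * u j) \<le> (\<Sum>j<d. R l j * (- v j))"
    proof (intro sum_mono)
      fix j assume j: "j \<in> {..<d}"
      show "R l j * u j \<le> R l j * (- v j)"
      proof (cases "j = l")
        case True then show ?thesis using \<open>v l < 0\<close> by (simp add: u_def)
      next
        case False
        then have "R l j \<le> 0" using M l j unfolding nonsingular_M_def by auto
        then show ?thesis by (intro mult_left_mono_neg) (auto simp: u_def)
      qed
    qed
    also have "\<dots> = - (\<Sum>j<d. R l j * v j)" by (simp add: sum_negf)
    finally show ?thesis using Rv[OF l] by simp
  next
    case False
    have "(\<Sum>j<d. R l j * u j) \<le> (\<Sum>j<d. 0)"
    proof (intro sum_mono)
      fix j assume j: "j \<in> {..<d}"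
      show "R l j * u j \<le> 0"
      proof (cases "j = l")
        case True then show ?thesis using False by (simp add: u_def)
      next
        case False
        then have "R l j \<le> 0" using M l j unfolding nonsingular_M_def by auto
        then show ?thesis by (intro mult_nonpos_nonneg) (auto simp: u_def)
      qed
    qed
    then show ?thesis by simp
  qed
  moreover have "\<forall>j<d. u j \<ge> 0" by (simp add: u_def)
  ultimately have "u i = 0" using M i unfolding nonsingular_M_def by blast
  then show ?thesis by (simp add: u_def max_def split: if_splits)
qed

lemma nonsingular_M_diag_pos:
  assumes M: "nonsingular_M d R" and j: "j < d"
  shows "R j j > 0"
proof (rule ccontr)
  assume neg: "\<not> R j j > 0"
  define u where "u = (\<lambda>i. if i = j then 1 else (0::real))"
  have "(\<Sum>i<d. R l i * u i) = R l j" for l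
    using j by (simp add: u_def if_distrib cong: if_cong)
  moreover have "R l j \<le> 0" if "l < d" for l
    using M neg j that unfolding nonsingular_M_def by (cases "l = j") auto
  moreover have "\<forall>i<d. u i \<ge> 0" by (simp add: u_def)
  ultimately have "u j = 0" using M j unfolding nonsingular_M_def by metis
  then show False by (simp add: u_def)
qed

lemma nonsingular_M_one: "nonsingular_M 1 (\<lambda>i j. 1\<^sub>m 1 $$ (i, j))"
  by (auto simp: nonsingular_M_def lessThan_Suc)

lemma submatrix_lead:
  assumes "R \<in> carrier_mat d d" "m \<le> d"
  shows "submatrix R {..<m} {..<m} = mat m m (\<lambda>(i, j). R $$ (i, j))"
proof -
  have *: "{i. i < d \<and> i \<in> {..<m}} = {..<m}" using assms(2) by auto
  have c: "{a \<in> {..<m}. a < i} = {..<i}" if "i < m" for i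
    using that by auto
  show ?thesis
  proof (rule eq_matI)
    fix i j assume "i < dim_row (mat m m (\<lambda>(i, j). R $$ (i, j)))" "j < dim_col (mat m m (\<lambda>(i, j). R $$ (i, j)))"
    then have ij: "i < m" "j < m" by auto
    show "submatrix R {..<m} {..<m} $$ (i, j) = mat m m (\<lambda>(i, j). R $$ (i, j)) $$ (i, j)"
      using submatrix_index_card[of i R j "{..<m}" "{..<m}"] assms ij unfolding c[OF ij(1)] c[OF ij(2)] by simp
  qed (use assms * in \<open>auto simp: dim_submatrix\<close>)
qed

lemma submatrix_row:
  assumes "R \<in> carrier_mat d d" "m < d"
  shows "submatrix R {m} {..<m} = mat 1 m (\<lambda>(i, j). R $$ (m, j))"
proof -
  have *: "{i. i < d \<and> i < m} = {..<m}" "{i. i < d \<and> i = m} = {m}" using assms(2) by auto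
  have c: "{a \<in> {..<m}. a < i} = {..<i}" if "i < m" for i
    using that by auto
  have c2: "{a \<in> {m}. a < m} = {}" by auto
  show ?thesis
  proof (rule eq_matI)
    fix i j assume "i < dim_row (mat 1 m (\<lambda>(i, j). R $$ (m, j)))" "j < dim_col (mat 1 m (\<lambda>(i, j). R $$ (m, j)))"
    then have ij: "i = 0" "j < m" by auto
    show "submatrix R {m} {..<m} $$ (i, j) = mat 1 m (\<lambda>(i, j). R $$ (m, j)) $$ (i, j)"
      using submatrix_index_card[of m R j "{m}" "{..<m}"] assms ij unfolding c2 c[OF ij(2)] by simp
  qed (use assms * in \<open>auto simp: dim_submatrix\<close>)
qed

lemma submatrix_col:
  assumes "R \<in> carrier_mat d d" "m < d"
  shows "submatrix R {..<m} {m} = mat m 1 (\<lambda>(i, j). R $$ (i, m))"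
proof -
  have *: "{i. i < d \<and> i < m} = {..<m}" "{i. i < d \<and> i = m} = {m}" using assms(2) by auto
  have c: "{a \<in> {..<m}. a < i} = {..<i}" if "i < m" for i
    using that by auto
  have c2: "{a \<in> {m}. a < m} = {}" by auto
  show ?thesis
  proof (rule eq_matI)
    fix i j assume "i < dim_row (mat m 1 (\<lambda>(i, j). R $$ (i, m)))" "j < dim_col (mat m 1 (\<lambda>(i, j). R $$ (i, m)))"
    then have ij: "i < m" "j = 0" by auto
    show "submatrix R {..<m} {m} $$ (i, j) = mat m 1 (\<lambda>(i, j). R $$ (i, m)) $$ (i, j)"
      using submatrix_index_card[of i R m "{..<m}" "{m}"] assms ij unfolding c2 c[OF ij(1)] by simp
  qed (use assms * in \<open>auto simp: dim_submatrix\<close>)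
qed

lemma block_inverse_spec:
  assumes M: "nonsingular_M d (\<lambda>i j. R $$ (i, j))" and R: "R \<in> carrier_mat d d" and m: "m \<le> d"
  shows "block_inverse R m \<in> carrier_mat m m"
    and "\<And>i j. i < m \<Longrightarrow> j < m \<Longrightarrow>
      (\<Sum>l<m. R $$ (i, l) * block_inverse R m $$ (l, j)) = (if i = j then 1 else 0)"
    and "\<And>i j. i < m \<Longrightarrow> j < m \<Longrightarrow>
      (\<Sum>l<m. block_inverse R m $$ (i, l) * R $$ (l, j)) = (if i = j then 1 else 0)"
    and "\<And>i j. i < m \<Longrightarrow> j < m \<Longrightarrow> block_inverse R m $$ (i, j) \<ge> 0"
proof -
  let ?A = "mat m m (\<lambda>(i, j). R $$ (i, j))"
  have Mm: "nonsingular_M m (\<lambda>i j. R $$ (i, j))" using nonsingular_M_block[OF M m] .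
  have A: "?A \<in> carrier_mat m m" by simp
  have "det ?A \<noteq> 0"
  proof
    assume "det ?A = 0"
    then obtain v where v: "v \<in> carrier_vec m" "v \<noteq> 0\<^sub>v m" "?A *\<^sub>v v = 0\<^sub>v m"
      using det_0_iff_vec_prod_zero_field[OF A] by auto
    have z: "(\<Sum>l<m. R $$ (i, l) * v $ l) = 0" if "i < m" for i
    proof -
      have "(?A *\<^sub>v v) $ i = 0" using v(3) that by simp
      then show ?thesis using that v(1) by (simp add: scalar_prod_def lessThan_atLeast0)
    qed
    have "v $ i \<ge> 0" if "i < m" for i
      by (rule nonsingular_M_inverse_nonneg[OF Mm _ that]) (simp add: z)
    moreover have "- v $ i \<ge> 0" if "i < m" for i
      by (rule nonsingular_M_inverse_nonneg[OF Mm _ that]) (simp add: z sum_negf)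
    ultimately have "v = 0\<^sub>v m" using v(1) by (intro eq_vecI) (auto simp: order_antisym)
    then show False using v(2) by simp
  qed
  then have "?A \<in> Units (ring_mat TYPE(real) m ())"
    by (rule det_non_zero_imp_unit[OF A])
  then obtain B where B: "mat_inverse ?A = Some B"
    using mat_inverse(1)[OF A, where b = "()"] by (cases "mat_inverse ?A") auto
  then have BB: "block_inverse R m = B"
    unfolding block_inverse_def submatrix_lead[OF R m] by simp
  have inv: "?A * B = 1\<^sub>m m" "B * ?A = 1\<^sub>m m" "B \<in> carrier_mat m m"
    using mat_inverse(2)[OF A B] by auto
  show "block_inverse R m \<in> carrier_mat m m" using BB inv by simp
  show e1: "(\<Sum>l<m. R $$ (i, l) * block_inverse R m $$ (l, j)) = (if i = j then 1 else 0)"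
    if ij: "i < m" "j < m" for i j
  proof -
    have "(?A * B) $$ (i, j) = (if i = j then 1 else 0)" using inv(1) ij by simp
    then show ?thesis using ij inv(3) by (simp add: BB scalar_prod_def lessThan_atLeast0)
  qed
  show "(\<Sum>l<m. block_inverse R m $$ (i, l) * R $$ (l, j)) = (if i = j then 1 else 0)"
    if ij: "i < m" "j < m" for i j
  proof -
    have "(B * ?A) $$ (i, j) = (if i = j then 1 else 0)" using inv(2) ij by simp
    then show ?thesis using ij inv(3) by (simp add: BB scalar_prod_def lessThan_atLeast0)
  qed
  show "block_inverse R m $$ (i, j) \<ge> 0" if ij: "i < m" "j < m" for i j
    by (rule nonsingular_M_inverse_nonneg[OF Mm _ ij(1)]) (simp add: e1 ij)
qed

text \<open>
  The vector \<open>a\<close> is the weight of the norm in which Picard iteration contracts, and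
  it converts a bound on the noise into an upper bound on the regulators.
\<close>
lemma unit_potential:
  assumes M: "nonsingular_M d (\<lambda>i j. R $$ (i, j))" and R: "R \<in> carrier_mat d d" and m: "m \<le> d"
  obtains a where "\<And>i. a i \<ge> 0" "\<And>i. i \<ge> m \<Longrightarrow> a i = 0"
    "\<And>i. i < m \<Longrightarrow> (\<Sum>j<m. R $$ (i, j) * a j) = 1"
proof -
  define a where "a = (\<lambda>i. if i < m then \<Sum>j<m. block_inverse R m $$ (i, j) else 0)"
  have "(\<Sum>j<m. R $$ (i, j) * a j) = 1" if i: "i < m" for i
  proof -
    have "(\<Sum>j<m. R $$ (i, j) * a j) = (\<Sum>j<m. \<Sum>l<m. R $$ (i, j) * block_inverse R m $$ (j, l))"
      by (simp add: a_def sum_distrib_left)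
    also have "\<dots> = (\<Sum>l<m. \<Sum>j<m. R $$ (i, j) * block_inverse R m $$ (j, l))"
      by (rule sum.swap)
    also have "\<dots> = (\<Sum>l<m. if i = l then 1 else 0)"
      using i by (intro sum.cong) (auto simp: block_inverse_spec(2)[OF M R m])
    finally show ?thesis using i by simp
  qed
  moreover have "a i \<ge> 0" for i
    by (auto simp: a_def intro!: sum_nonneg block_inverse_spec(4)[OF M R m])
  moreover have "a i = 0" if "i \<ge> m" for i using that by (simp add: a_def)
  ultimately show ?thesis using that[of a] by blast
qed

text \<open>
  The block formula for \<open>w\<close> is one step of Gaussian elimination: the multipliers
  \<open>u\<close> make the row combination \<open>u' R\<close> vanish before position
  \<open>k\<close>, and the entry at \<open>k\<close> is the Schur complement of the leading
  block. Its positivity is a consequence of nonsingularity: otherwise the nonzero vector \<open>v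
  \<ge> 0\<close> that solves the first \<open>k\<close> equations with \<open>v\<^sub>k =
  1\<close> would be mapped to a nonpositive vector.
\<close>
lemma u_vec_props:
  assumes M: "nonsingular_M d (\<lambda>i j. R $$ (i, j))" and R: "R \<in> carrier_mat d d" and k: "k < d"
  shows "u_vec d R k \<in> carrier_vec d"
    and "\<And>i. i < d \<Longrightarrow> u_vec d R k $ i \<ge> 0"
    and "u_vec d R k $ k = 1"
    and "\<And>i. k < i \<Longrightarrow> i < d \<Longrightarrow> u_vec d R k $ i = 0"
    and "\<And>j. j < k \<Longrightarrow> (\<Sum>i<d. u_vec d R k $ i * R $$ (i, j)) = 0"
    and "(\<Sum>i<d. u_vec d R k $ i * R $$ (i, k)) = - limit_drift R k"
    and "\<And>j. k < j \<Longrightarrow> j < d \<Longrightarrow> (\<Sum>i<d. u_vec d R k $ i * R $$ (i, j)) \<le> 0"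
    and "limit_drift R k < 0"
proof -
  let ?I = "block_inverse R k"
  have kd: "k \<le> d" using k by simp
  note bi = block_inverse_spec[OF M R kd]
  have off: "R $$ (i, j) \<le> 0" if "i < d" "j < d" "i \<noteq> j" for i j
    using M that unfolding nonsingular_M_def by auto
  have w: "w_coeff R i k = - (\<Sum>l<k. R $$ (k, l) * ?I $$ (l, i))" if i: "i < k" for i
    using i bi(1) R k unfolding w_coeff_def submatrix_row[OF R k]
    by (simp add: scalar_prod_def lessThan_atLeast0)
  have w_nonneg: "w_coeff R i k \<ge> 0" if i: "i < k" for i
  proof -
    have "(\<Sum>l<k. R $$ (k, l) * ?I $$ (l, i)) \<le> (\<Sum>l<k. 0)"
      using i k off bi(4) by (intro sum_mono mult_nonpos_nonneg) auto
    then show ?thesis using w[OF i] by simp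
  qed
  have wk: "1 - w_coeff R k k = R $$ (k, k) + (\<Sum>i<k. w_coeff R i k * R $$ (i, k))"
  proof -
    have "(submatrix R {k} {..<k} * ?I * submatrix R {..<k} {k}) $$ (0, 0)
        = (\<Sum>i<k. (\<Sum>l<k. R $$ (k, l) * ?I $$ (l, i)) * R $$ (i, k))"
      using bi(1) R k unfolding submatrix_row[OF R k] submatrix_col[OF R k]
      by (simp add: scalar_prod_def lessThan_atLeast0)
    also have "\<dots> = (\<Sum>i<k. - w_coeff R i k * R $$ (i, k))"
      by (intro sum.cong) (auto simp: w)
    finally show ?thesis by (simp add: w_coeff_def[of R k k] sum_negf)
  qed
  show uc: "u_vec d R k \<in> carrier_vec d" by (simp add: u_vec_def)
  have ui: "u_vec d R k $ i = (if i < k then w_coeff R i k else if i = k then 1 else 0)" if "i < d" for i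
    using that by (simp add: u_vec_def)
  show "u_vec d R k $ i \<ge> 0" if "i < d" for i using w_nonneg ui[OF that] by simp
  show "u_vec d R k $ k = 1" using ui k by simp
  show "u_vec d R k $ i = 0" if "k < i" "i < d" for i using ui that by simp
  have sum_u: "(\<Sum>i<d. u_vec d R k $ i * f i) = (\<Sum>i<k. w_coeff R i k * f i) + f k" for f
  proof -
    have "(\<Sum>i<d. u_vec d R k $ i * f i) = (\<Sum>i<Suc k. u_vec d R k $ i * f i)"
      using k ui by (intro sum.mono_neutral_right) auto
    also have "\<dots> = (\<Sum>i<k. u_vec d R k $ i * f i) + f k" using k ui by simp
    also have "(\<Sum>i<k. u_vec d R k $ i * f i) = (\<Sum>i<k. w_coeff R i k * f i)"
      using k ui by (intro sum.cong) auto
    finally show ?thesis .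
  qed
  show "(\<Sum>i<d. u_vec d R k $ i * R $$ (i, j)) = 0" if j: "j < k" for j
  proof -
    have "(\<Sum>i<k. w_coeff R i k * R $$ (i, j))
        = - (\<Sum>i<k. \<Sum>l<k. R $$ (k, l) * ?I $$ (l, i) * R $$ (i, j))"
      by (simp add: w sum_distrib_right flip: sum_negf)
    also have "\<dots> = - (\<Sum>l<k. R $$ (k, l) * (\<Sum>i<k. ?I $$ (l, i) * R $$ (i, j)))"
      by (subst sum.swap) (simp add: sum_distrib_left mult.assoc)
    also have "\<dots> = - (\<Sum>l<k. if l = j then R $$ (k, l) else 0)"
      using j by (intro arg_cong[where f = uminus] sum.cong) (auto simp: bi(3))
    also have "\<dots> = - R $$ (k, j)" using j by simp
    finally show ?thesis unfolding sum_u by simp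
  qed
  show dr: "(\<Sum>i<d. u_vec d R k $ i * R $$ (i, k)) = - limit_drift R k"
    unfolding sum_u limit_drift_def using wk by simp
  show "(\<Sum>i<d. u_vec d R k $ i * R $$ (i, j)) \<le> 0" if j: "k < j" "j < d" for j
  proof -
    have "(\<Sum>i<k. w_coeff R i k * R $$ (i, j)) \<le> (\<Sum>i<k. 0)"
      using j off w_nonneg by (intro sum_mono mult_nonneg_nonpos) auto
    then show ?thesis unfolding sum_u using off[of k j] j k by simp
  qed
  show "limit_drift R k < 0"
  proof (rule ccontr)
    assume "\<not> limit_drift R k < 0"
    then have le: "R $$ (k, k) + (\<Sum>i<k. w_coeff R i k * R $$ (i, k)) \<le> 0"
      using wk by (simp add: limit_drift_def)
    \<comment> \<open>the column elimination: R v vanishes in the first k rows and equals the pivot in row k\<close>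
    define v where "v = (\<lambda>i. if i < k then - (\<Sum>l<k. ?I $$ (i, l) * R $$ (l, k)) else (1::real))"
    have v_nonneg: "v i \<ge> 0" for i
    proof (cases "i < k")
      case True
      then have "(\<Sum>l<k. ?I $$ (i, l) * R $$ (l, k)) \<le> (\<Sum>l<k. 0)"
        using k off bi(4) by (intro sum_mono mult_nonneg_nonpos) auto
      then show ?thesis using True by (simp add: v_def)
    qed (simp add: v_def)
    have "(\<Sum>j<Suc k. R $$ (i, j) * v j) \<le> 0" if i: "i < Suc k" for i
    proof -
      have s: "(\<Sum>j<Suc k. R $$ (i, j) * v j)
          = R $$ (i, k) - (\<Sum>j<k. \<Sum>l<k. R $$ (i, j) * ?I $$ (j, l) * R $$ (l, k))"
        by (simp add: v_def sum_distrib_left mult.assoc flip: sum_negf)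
      also have "\<dots> = R $$ (i, k) - (\<Sum>l<k. (\<Sum>j<k. R $$ (i, j) * ?I $$ (j, l)) * R $$ (l, k))"
        by (subst sum.swap) (simp add: sum_distrib_right)
      also have "\<dots> \<le> 0"
      proof (cases "i < k")
        case True
        have "(\<Sum>l<k. (\<Sum>j<k. R $$ (i, j) * ?I $$ (j, l)) * R $$ (l, k))
            = (\<Sum>l<k. if l = i then R $$ (l, k) else 0)"
          using True by (intro sum.cong) (auto simp: bi(2))
        then show ?thesis using True by simp
      next
        case False
        then have "i = k" using i by simp
        have "(\<Sum>l<k. (\<Sum>j<k. R $$ (k, j) * ?I $$ (j, l)) * R $$ (l, k))
            = (\<Sum>l<k. - w_coeff R l k * R $$ (l, k))"
          by (intro sum.cong) (auto simp: w)
        then show ?thesis using le \<open>i = k\<close> by (simp add: sum_negf)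
      qed
      finally show ?thesis .
    qed
    moreover have "nonsingular_M (Suc k) (\<lambda>i j. R $$ (i, j))"
      using nonsingular_M_block[OF M, of "Suc k"] k by simp
    ultimately have "v k = 0" using v_nonneg unfolding nonsingular_M_def by blast
    then show False by (simp add: v_def)
  qed
qed

section \<open>The Skorokhod problem and its least solution\<close>

text \<open>
  A working form of the Skorokhod problem in which the complementarity integral is replaced by a
  statement about single times: up to an arbitrarily small error, \<open>y\<^sub>j\<close> has not
  grown since some time at which \<open>z\<^sub>j\<close> was almost 0, or since time 0. The error
  terms let the definition cover paths with jumps, and the form is stable under rescaling of space
  and time.
\<close>
definition reflected ::
    "nat \<Rightarrow> (nat \<Rightarrow> nat \<Rightarrow> real) \<Rightarrow> (nat \<Rightarrow> real \<Rightarrow> real) \<Rightarrow> (nat \<Rightarrow> real \<Rightarrow> real) \<Rightarrow> (nat \<Rightarrow> real \<Rightarrow> real) \<Rightarrow> bool" where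
  "reflected d R x z y \<longleftrightarrow> (\<forall>j<d.
     (\<forall>t\<ge>0. z j t \<ge> 0) \<and> (\<forall>t\<ge>0. z j t = x j t + (\<Sum>k<d. R j k * y k t)) \<and>
     mono_on {0..} (y j) \<and> y j 0 = 0 \<and>
     (\<forall>t\<ge>0. \<forall>e>0. \<exists>s\<in>{0..t}. (s = 0 \<or> z j s < e) \<and> y j t < y j s + e))"

lemma reflectedD:
  assumes "reflected d R x z y" "j < d"
  shows "\<And>t. t \<ge> 0 \<Longrightarrow> z j t \<ge> 0"
    and "\<And>t. t \<ge> 0 \<Longrightarrow> z j t = x j t + (\<Sum>k<d. R j k * y k t)"
    and "\<And>s t. 0 \<le> s \<Longrightarrow> s \<le> t \<Longrightarrow> y j s \<le> y j t"
    and "y j 0 = 0"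
    and "\<And>t. t \<ge> 0 \<Longrightarrow> y j t \<ge> 0"
    and "\<And>t e. t \<ge> 0 \<Longrightarrow> e > 0 \<Longrightarrow> \<exists>s\<in>{0..t}. (s = 0 \<or> z j s < e) \<and> y j t < y j s + e"
proof -
  note a = assms(1)[unfolded reflected_def, rule_format, OF assms(2)]
  show "z j t \<ge> 0" if "t \<ge> 0" for t using a that by auto
  show "z j t = x j t + (\<Sum>k<d. R j k * y k t)" if "t \<ge> 0" for t using a that by auto
  show m: "y j s \<le> y j t" if "0 \<le> s" "s \<le> t" for s t
    using a that by (auto simp: mono_on_def)
  show z: "y j 0 = 0" using a by auto
  show "y j t \<ge> 0" if "t \<ge> 0" for t using m[of 0 t] that z by auto
  show "\<exists>s\<in>{0..t}. (s = 0 \<or> z j s < e) \<and> y j t < y j s + e" if "t \<ge> 0" "e > 0" for t e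
    using a that by blast
qed

text \<open>
  Let \<open>e\<^sub>j\<close> be the largest excess of \<open>y\<^sub>j\<close> over
  \<open>y'\<^sub>j\<close> on \<open>[0, T]\<close>. The excess at a time \<open>t\<close> is at
  most the excess at an earlier time where \<open>z\<^sub>j\<close> is almost 0; there the two
  equations give \<open>R\<^sub>j\<^sub>j e\<^sub>j \<le> \<Sum>\<^sub>i
  \<bar>R\<^sub>j\<^sub>i\<bar> e\<^sub>i\<close> over \<open>i \<noteq> j\<close>. So \<open>R e
  \<le> 0\<close>, and \<open>e = 0\<close>.
\<close>
lemma reflected_minimal:
  assumes M: "nonsingular_M d R" and refl: "reflected d R x z y"
    and mono': "\<And>j s t. j < d \<Longrightarrow> 0 \<le> s \<Longrightarrow> s \<le> t \<Longrightarrow> t \<le> T \<Longrightarrow> y' j s \<le> y' j t"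
    and nonneg': "\<And>j. j < d \<Longrightarrow> y' j 0 \<ge> 0"
    and feasible: "\<And>j t. j < d \<Longrightarrow> 0 \<le> t \<Longrightarrow> t \<le> T \<Longrightarrow> x j t + (\<Sum>k<d. R j k * y' k t) \<ge> 0"
    and j: "j < d" and t: "0 \<le> t" "t \<le> T"
  shows "y j t \<le> y' j t"
proof -
  note r = reflectedD[OF refl]
  have T: "T \<ge> 0" using t by simp
  define h where "h = (\<lambda>j t. max 0 (y j t - y' j t))"
  define e where "e = (\<lambda>j. SUP t\<in>{0..T}. h j t)"
  have y'0: "y' j t \<ge> 0" if "j < d" "0 \<le> t" "t \<le> T" for j t
    using nonneg'[of j] mono'[of j 0 t] that by simp
  have bdd: "bdd_above (h j ` {0..T})" if "j < d" for j
  proof (rule bdd_aboveI2)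
    fix t assume "t \<in> {0..T}"
    then show "h j t \<le> y j T"
      using r(3)[OF that, of t T] r(5)[OF that, of T] y'0[OF that, of t] by (auto simp: h_def)
  qed
  have he: "h j t \<le> e j" if "j < d" "0 \<le> t" "t \<le> T" for j t
    unfolding e_def using bdd[OF that(1)] that by (intro cSUP_upper) auto
  have e0: "e j \<ge> 0" if "j < d" for j
    using he[OF that, of 0] T by (auto simp: h_def)
  have Re: "(\<Sum>i<d. R j i * e i) \<le> 0" if j: "j < d" for j
  proof -
    have pos: "R j j > 0" using nonsingular_M_diag_pos[OF M j] .
    define S where "S = (\<Sum>i\<in>{..<d} - {j}. - R j i * e i)"
    have off: "- R j i \<ge> 0" if "i \<in> {..<d} - {j}" for i
      using M j that unfolding nonsingular_M_def by auto
    have S0: "S \<ge> 0" unfolding S_def using off e0 by (intro sum_nonneg mult_nonneg_nonneg) auto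
    have split: "(\<Sum>i<d. R j i * f i) = R j j * f j + (\<Sum>i\<in>{..<d} - {j}. R j i * f i)" for f
      using j by (intro sum.remove) auto
    have bound: "R j j * (y j t - y' j t) \<le> S" if t: "0 \<le> t" "t \<le> T" for t
    proof (rule field_le_epsilon)
      fix \<epsilon> :: real assume "\<epsilon> > 0"
      define \<delta> where "\<delta> = \<epsilon> / (1 + R j j)"
      have \<delta>: "\<delta> > 0" "\<delta> * (1 + R j j) = \<epsilon>" using \<open>\<epsilon> > 0\<close> pos by (auto simp: \<delta>_def)
      obtain s where s: "s \<in> {0..t}" "s = 0 \<or> z j s < \<delta>" "y j t < y j s + \<delta>"
        using r(6)[OF j t(1) \<delta>(1)] by blast
      have le: "y j t - y' j t \<le> y j s - y' j s + \<delta>"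
        using mono'[OF j, of s t] s t by auto
      have "R j j * (y j s - y' j s) \<le> \<delta> + S"
      proof (cases "s = 0")
        case True
        have "R j j * (y j s - y' j s) \<le> 0"
          using True r(4)[OF j] nonneg'[OF j] pos by (simp add: mult_le_0_iff)
        then show ?thesis using S0 \<delta> by simp
      next
        case False
        then have zs: "z j s < \<delta>" using s by simp
        have "z j s = x j s + (R j j * y j s + (\<Sum>i\<in>{..<d} - {j}. R j i * y i s))"
          using r(2)[OF j, of s] s split by simp
        moreover have "0 \<le> x j s + (R j j * y' j s + (\<Sum>i\<in>{..<d} - {j}. R j i * y' i s))"
          using feasible[OF j, of s] s t split by simp
        ultimately have "R j j * (y j s - y' j s) \<le> \<delta> + ((\<Sum>i\<in>{..<d} - {j}. R j i * y' i s) - (\<Sum>i\<in>{..<d} - {j}. R j i * y i s))"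
          using zs by (simp add: algebra_simps)
        also have "(\<Sum>i\<in>{..<d} - {j}. R j i * y' i s) - (\<Sum>i\<in>{..<d} - {j}. R j i * y i s)
            = (\<Sum>i\<in>{..<d} - {j}. - R j i * (y i s - y' i s))"
          unfolding sum_subtractf[symmetric] by (intro sum.cong) (auto simp: algebra_simps)
        also have "\<dots> \<le> S" unfolding S_def
        proof (intro sum_mono mult_left_mono off)
          fix i assume i: "i \<in> {..<d} - {j}"
          show "y i s - y' i s \<le> e i" using he[of i s] i s t by (auto simp: h_def)
        qed
        finally show ?thesis by simp
      qed
      then have "R j j * (y j t - y' j t) \<le> R j j * \<delta> + (\<delta> + S)"
        using mult_left_mono[OF le, of "R j j"] pos by (simp add: algebra_simps)
      also have "\<dots> = S + \<epsilon>" using \<delta>(2) by (simp add: algebra_simps)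
      finally show "R j j * (y j t - y' j t) \<le> S + \<epsilon>" .
    qed
    have "e j \<le> S / R j j" unfolding e_def
    proof (rule cSUP_least)
      fix t assume "t \<in> {0..T}"
      then show "h j t \<le> S / R j j" using bound[of t] S0 pos by (auto simp: h_def field_simps)
    qed (use T in auto)
    then have "R j j * e j \<le> S" using pos by (simp add: field_simps)
    then show ?thesis unfolding split by (simp add: S_def sum_negf)
  qed
  have "e j = 0" using M e0 Re j unfolding nonsingular_M_def by blast
  then show ?thesis using he[OF j t] by (simp add: h_def)
qed

lemma reflected_unique:
  assumes M: "nonsingular_M d R" and refl: "reflected d R x z y" "reflected d R x z' y'"
    and j: "j < d" and t: "0 \<le> t"
  shows "y j t = y' j t" and "z j t = z' j t"
proof -
  have le: "y1 i t \<le> y2 i t" if "reflected d R x z1 y1" "reflected d R x z2 y2" "i < d" for y1 y2 z1 z2 i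
    by (rule reflected_minimal[OF M that(1) _ _ _ that(3) t order_refl])
      (use reflectedD[OF that(2)] in auto)
  have y: "y i t = y' i t" if "i < d" for i
    using le[OF refl that] le[OF refl(2,1) that] by simp
  then show "y j t = y' j t" using j .
  show "z j t = z' j t"
    using reflectedD(2)[OF refl(1) j t] reflectedD(2)[OF refl(2) j t] y by simp
qed

text \<open>
  If the claim fails at time \<open>t\<close>, then \<open>z \<ge> e\<close> at all earlier times
  at which \<open>y\<close> exceeds \<open>y t - e\<close>. These times form an interval that
  carries at least mass \<open>e\<close> of the measure \<open>dy\<close>, which contradicts the
  vanishing integral. A jump of \<open>y\<close> may sit at the left end \<open>\<tau>\<close> of
  the interval; its mass is then obtained as a limit over half-open intervals that start before
  \<open>\<tau>\<close>.
\<close>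
lemma flat_off_imp_approx:
  assumes right: "\<And>t. t \<ge> 0 \<Longrightarrow> continuous (at_right t) y"
    and mono: "mono_on {0..} y" and y0: "y 0 = (0::real)"
    and int0: "(\<integral>\<^sup>+ t \<in> {0..}. ennreal (z t) \<partial>interval_measure (\<lambda>t. y (max 0 t))) = 0"
    and t: "t \<ge> 0" and e: "e > 0"
  shows "\<exists>s\<in>{0..t}. (s = 0 \<or> z s < e) \<and> y t < y s + e"
proof (rule ccontr)
  assume neg: "\<not> ?thesis"
  define F where "F = (\<lambda>t. y (max 0 t))"
  define c where "c = y t - e"
  have neg': "z s \<ge> e \<and> s \<noteq> 0" if "s \<in> {0..t}" "y s > c" for s
    using neg that by (auto simp: c_def not_less)
  have c0: "c \<ge> 0" using neg t y0 by (force simp: c_def not_less)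
  have mono': "y s \<le> y s'" if "0 \<le> s" "s \<le> s'" for s s'
    using mono that by (auto simp: mono_on_def)
  have Fm: "F s \<le> F s'" if "s \<le> s'" for s s' using mono' that by (simp add: F_def)
  have Fr: "continuous (at_right a) F" for a
  proof (cases "a \<ge> 0")
    case True
    have "(y \<longlongrightarrow> y a) (at_right a)" using right[OF True] by (simp add: continuous_within)
    moreover have "\<forall>\<^sub>F x in at_right a. y x = F x"
      using True eventually_at_right_less[of a] by (auto simp: F_def max_def elim: eventually_mono)
    ultimately have "(F \<longlongrightarrow> y a) (at_right a)" by (rule Lim_transform_eventually)
    then show ?thesis using True by (simp add: continuous_within F_def)
  next
    case False
    have "\<forall>\<^sub>F x in at_right a. x < 0"
      using False by (intro eventually_at_rightI[of a 0]) auto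
    then have "\<forall>\<^sub>F x in at_right a. 0 = F x"
      using y0 by (auto simp: F_def max_def elim: eventually_mono)
    then have "(F \<longlongrightarrow> 0) (at_right a)" using tendsto_const by (rule Lim_transform_eventually[rotated])
    then show ?thesis using False y0 by (simp add: continuous_within F_def max_def)
  qed
  let ?G = "interval_measure F"
  have Ioc: "emeasure ?G {a<..b} = F b - F a" if "a \<le> b" for a b
    using emeasure_interval_measure_Ioc[of a b F] Fm Fr that by blast
  define A where "A = {s\<in>{0..t}. y s > c}"
  have tA: "t \<in> A" using t e by (simp add: A_def c_def)
  have A_up: "s' \<in> A" if "s \<in> A" "s \<le> s'" "s' \<le> t" for s s'
    using that mono'[of s s'] by (auto simp: A_def)
  define \<tau> where "\<tau> = Inf A"
  have bdd: "bdd_below A" by (auto simp: A_def bdd_below_def)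
  have \<tau>: "\<tau> \<le> s" if "s \<in> A" for s unfolding \<tau>_def using that bdd by (rule cInf_lower)
  have \<tau>0: "\<tau> \<ge> 0" unfolding \<tau>_def using tA by (intro cInf_greatest) (auto simp: A_def)
  have below: "F s \<le> c" if "s < \<tau>" for s
  proof (cases "s \<ge> 0")
    case True
    have "s \<notin> A" using \<tau> that by force
    moreover have "s \<le> t" using that \<tau>[OF tA] by simp
    ultimately show ?thesis using True by (auto simp: A_def F_def)
  qed (simp add: F_def y0 c0)
  have above: "s \<in> A" if "s > \<tau>" "s \<le> t" for s
  proof -
    obtain s' where "s' \<in> A" "s' < s" using cInf_lessD[of A s] tA \<open>s > \<tau>\<close> unfolding \<tau>_def by auto
    then show ?thesis using A_up that by simp
  qed
  have "\<exists>B\<in>sets borel. B \<subseteq> A \<and> emeasure ?G B \<ge> ennreal e"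
  proof (cases "\<tau> \<in> A")
    case True
    have eq: "{\<tau>..t} = (\<Inter>n. {\<tau> - 1 / real (Suc n)<..t})" (is "_ = (\<Inter>n. ?D n)")
    proof (intro equalityI subsetI)
      fix s assume s: "s \<in> (\<Inter>n. ?D n)"
      have "\<tau> \<le> s"
      proof (rule field_le_epsilon)
        fix e' :: real assume "e' > 0"
        then obtain n where "1 / real (Suc n) < e'" using nat_approx_posE by blast
        moreover have "s \<in> ?D n" using s by blast
        ultimately show "\<tau> \<le> s + e'" by simp
      qed
      then show "s \<in> {\<tau>..t}" using s by auto
    next
      fix s n assume s: "s \<in> {\<tau>..t}"
      show "s \<in> (\<Inter>n. ?D n)"
      proof (rule INT_I)
        fix n
        have "\<tau> - 1 / real (Suc n) < \<tau>" by simp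
        then have "\<tau> - 1 / real (Suc n) < s" "s \<le> t" using s unfolding atLeastAtMost_iff by linarith+
        then show "s \<in> ?D n" unfolding greaterThanAtMost_iff by (rule conjI)
      qed
    qed
    have lt: "\<tau> - 1 / real (Suc n) \<le> t" for n
    proof -
      have "\<tau> - 1 / real (Suc n) < \<tau>" by simp
      then show ?thesis using \<tau>[OF tA] by linarith
    qed
    have "(INF n. emeasure ?G (?D n)) = emeasure ?G (\<Inter>n. ?D n)"
    proof (rule INF_emeasure_decseq)
      show "decseq ?D"
      proof (rule decseq_SucI, rule subsetI)
        fix n s assume "s \<in> ?D (Suc n)"
        moreover have "1 / real (Suc (Suc n)) \<le> 1 / real (Suc n)" by (simp add: field_simps)
        ultimately show "s \<in> ?D n" by auto
      qed
      show "emeasure ?G (?D n) \<noteq> \<infinity>" for n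
        unfolding Ioc[OF lt] by simp
    qed auto
    moreover have "ennreal e \<le> emeasure ?G (?D n)" for n
    proof -
      have "F (\<tau> - 1 / real (Suc n)) \<le> c" by (rule below) simp
      then have "e \<le> F t - F (\<tau> - 1 / real (Suc n))" using t by (simp add: F_def c_def)
      then show ?thesis unfolding Ioc[OF lt] by (rule ennreal_leI)
    qed
    ultimately have "ennreal e \<le> emeasure ?G (\<Inter>n. ?D n)"
      using INF_greatest[of UNIV "ennreal e" "\<lambda>n. emeasure ?G (?D n)"] by simp
    then have "ennreal e \<le> emeasure ?G {\<tau>..t}" unfolding eq .
    moreover have "{\<tau>..t} \<subseteq> A" using True A_up by auto
    ultimately show ?thesis by (intro bexI[of _ "{\<tau>..t}"]) auto
  next
    case False
    have "\<tau> < t" using False \<tau>[OF tA] tA by (cases "\<tau> = t") auto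
    have "y \<tau> \<le> c" using False \<tau>0 \<open>\<tau> < t\<close> by (auto simp: A_def)
    then have "e \<le> F t - F \<tau>" using t \<tau>0 by (simp add: F_def c_def)
    then have "ennreal e \<le> emeasure ?G {\<tau><..t}" using \<open>\<tau> < t\<close> by (subst Ioc) (auto intro: ennreal_leI)
    moreover have "{\<tau><..t} \<subseteq> A" using above by auto
    ultimately show ?thesis by (intro bexI[of _ "{\<tau><..t}"]) auto
  qed
  then obtain B where B: "B \<in> sets borel" "B \<subseteq> A" "emeasure ?G B \<ge> ennreal e" by blast
  have "ennreal e * emeasure ?G B = (\<integral>\<^sup>+ s. ennreal e * indicator B s \<partial>?G)"
    using B by (simp add: nn_integral_cmult_indicator)
  also have "\<dots> \<le> (\<integral>\<^sup>+ s \<in> {0..}. ennreal (z s) \<partial>?G)"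
  proof (rule nn_integral_mono)
    fix s
    show "ennreal e * indicator B s \<le> ennreal (z s) * indicator {0..} s"
    proof (cases "s \<in> B")
      case True
      then have "s \<in> {0..t}" "y s > c" using B(2) by (auto simp: A_def)
      then show ?thesis using neg' True e by (auto intro!: ennreal_leI)
    qed simp
  qed
  also have "\<dots> = 0" using int0 by (simp add: F_def)
  finally have "emeasure ?G B = 0" using e by simp
  then show False using B(3) e by simp
qed

lemma skorokhod_pair_imp_reflected:
  assumes "skorokhod_pair d R x z y"
  shows "reflected d (\<lambda>i j. R $$ (i, j)) x z y"
  unfolding reflected_def
proof (intro allI impI)
  fix j assume j: "j < d"
  note a = assms[unfolded skorokhod_pair_def, rule_format, OF j]
  have "\<exists>s\<in>{0..t}. (s = 0 \<or> z j s < e) \<and> y j t < y j s + e" if "t \<ge> 0" "e > 0" for t e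
    using a that by (intro flat_off_imp_approx) (auto simp: cadlag_def)
  then show "(\<forall>t\<ge>0. 0 \<le> z j t) \<and> (\<forall>t\<ge>0. z j t = x j t + (\<Sum>k<d. R $$ (j, k) * y k t)) \<and>
      mono_on {0..} (y j) \<and> y j 0 = 0 \<and>
      (\<forall>t\<ge>0. \<forall>e>0. \<exists>s\<in>{0..t}. (s = 0 \<or> z j s < e) \<and> y j t < y j s + e)"
    using a by auto
qed

lemma continuous_on_imp_cadlag:
  assumes c: "continuous_on {0..} x"
  shows "cadlag x"
  unfolding cadlag_def
proof (intro conjI allI impI)
  fix t :: real assume t: "t \<ge> 0"
  have "(x \<longlongrightarrow> x t) (at t within {0..})" using c t by (auto simp: continuous_on_def)
  then have "(x \<longlongrightarrow> x t) (at_right t)" by (rule tendsto_within_subset) (use t in auto)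
  then show "continuous (at_right t) x" by (simp add: continuous_within)
next
  fix t :: real assume t: "t > 0"
  have "(x \<longlongrightarrow> x t) (at t within {0..})" using c t by (auto simp: continuous_on_def)
  then have "(x \<longlongrightarrow> x t) (at t within {0<..<t})" by (rule tendsto_within_subset) auto
  moreover have "at t within {0<..<t} = at_left t"
    using t by (intro at_within_nhd[of t "{0<..}"]) auto
  ultimately show "\<exists>l. (x \<longlongrightarrow> l) (at_left t)" by auto
qed

lemma continuous_on_halfline_glue:
  fixes f :: "real \<Rightarrow> real"
  assumes "\<And>T. T \<ge> 0 \<Longrightarrow> continuous_on {0..T} f"
  shows "continuous_on {0..} f"
  unfolding continuous_on_def
proof
  fix t :: real assume t: "t \<in> {0..}"
  have "(f \<longlongrightarrow> f t) (at t within {0..t+1})"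
    using assms[of "t + 1"] t by (auto simp: continuous_on_def)
  moreover have "at t within {0..t+1} = at t within {0..}"
    by (rule at_within_nhd[of t "{..<t+1}"]) auto
  ultimately show "(f \<longlongrightarrow> f t) (at t within {0..})" by simp
qed

text \<open>
  Around a time at which \<open>z\<^sub>j\<close> is positive, \<open>y\<^sub>j\<close> is
  constant. Hence the positive times are covered by countably many rational intervals of measure
  0.
\<close>
lemma flat_off_of_reflected:
  assumes r: "reflected d R x z y" and j: "j < d"
    and cz: "continuous_on {0..} (z j)" and cy: "continuous_on {0..} (y j)"
  shows "(\<integral>\<^sup>+ t \<in> {0..}. ennreal (z j t) \<partial>interval_measure (\<lambda>t. y j (max 0 t))) = 0"
proof -
  note r = reflectedD[OF r j]
  define F where "F = (\<lambda>t. y j (max 0 t))"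
  have Fm: "F s \<le> F s'" if "s \<le> s'" for s s' using r(3) that by (simp add: F_def)
  have "continuous_on UNIV F" unfolding F_def
    by (rule continuous_on_compose2[OF cy]) (auto intro!: continuous_intros)
  then have Fr: "continuous (at_right a) F" for a
    by (meson continuous_at_imp_continuous_at_within continuous_on_eq_continuous_at open_UNIV UNIV_I)
  let ?G = "interval_measure F"
  have Ioc: "emeasure ?G {a<..b} = F b - F a" if "a \<le> b" for a b
    using emeasure_interval_measure_Ioc[of a b F] Fm Fr that by blast
  define Q where "Q = {(p, q) \<in> \<rat> \<times> \<rat>. p \<le> q \<and> F p = F q}"
  have "countable Q" unfolding Q_def
    by (rule countable_subset[of _ "\<rat> \<times> \<rat>"]) (auto simp: countable_rat)
  have cover: "\<exists>p q. (p, q) \<in> Q \<and> t \<in> {p<..q}" if t: "t \<ge> 0" and zt: "z j t > 0" for t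
  proof -
    define \<epsilon> where "\<epsilon> = z j t / 2"
    have \<epsilon>: "\<epsilon> > 0" using zt by (simp add: \<epsilon>_def)
    obtain \<delta> where \<delta>: "\<delta> > 0" "\<And>s. s \<ge> 0 \<Longrightarrow> \<bar>s - t\<bar> < \<delta> \<Longrightarrow> \<bar>z j s - z j t\<bar> < \<epsilon>"
      using cz t \<epsilon> unfolding continuous_on_iff dist_real_def by (metis atLeast_iff)
    obtain p where p: "p \<in> \<rat>" "t - \<delta> < p" "p < t" using Rats_dense_in_real[of "t - \<delta>" t] \<delta> by auto
    obtain q where q: "q \<in> \<rat>" "t < q" "q < t + \<delta>" using Rats_dense_in_real[of t "t + \<delta>"] \<delta> by auto
    have zpos: "z j s \<ge> \<epsilon>" if "max 0 p \<le> s" "s \<le> q" for s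
    proof -
      have "\<bar>z j s - z j t\<bar> < \<epsilon>" using that p q by (intro \<delta>(2)) auto
      then show ?thesis unfolding \<epsilon>_def by linarith
    qed
    have "F q \<le> F p"
    proof (rule field_le_epsilon)
      fix e :: real assume "e > 0"
      then have "min e \<epsilon> > 0" using \<epsilon> by simp
      then obtain s where s: "s \<in> {0..q}" "s = 0 \<or> z j s < min e \<epsilon>" "y j q < y j s + min e \<epsilon>"
        using r(6)[of q "min e \<epsilon>"] q t by (meson order_less_imp_le order_trans)
      have "y j s \<le> F p"
      proof (cases "s \<le> max 0 p")
        case True then show ?thesis using r(3)[of s "max 0 p"] s by (simp add: F_def)
      next
        case False
        then have "z j s \<ge> \<epsilon>" "s \<noteq> 0" using zpos[of s] s by auto
        then show ?thesis using s by auto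
      qed
      then show "F q \<le> F p + e" using s q t by (simp add: F_def)
    qed
    then have "F p = F q" using Fm[of p q] p q by simp
    then show ?thesis using p q by (intro exI[of _ p] exI[of _ q]) (auto simp: Q_def)
  qed
  have null: "(\<Union>(p, q)\<in>Q. {p<..q}) \<in> null_sets ?G"
  proof (rule null_sets_UN')
    show "countable Q" by fact
    fix pq assume "pq \<in> Q"
    then show "(case pq of (p, q) \<Rightarrow> {p<..q}) \<in> null_sets ?G"
      by (auto simp: Q_def null_sets_def Ioc)
  qed
  have "AE t in ?G. ennreal (z j t) * indicator {0..} t = 0"
  proof (rule AE_I'[OF null], rule subsetI)
    fix t assume "t \<in> {t \<in> space ?G. ennreal (z j t) * indicator {0..} t \<noteq> 0}"
    then have "t \<ge> 0" "z j t > 0" by (auto simp: indicator_def not_le[symmetric] ennreal_neg split: if_splits)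
    then show "t \<in> (\<Union>(p, q)\<in>Q. {p<..q})" using cover by blast
  qed
  then have "(\<integral>\<^sup>+ t \<in> {0..}. ennreal (z j t) \<partial>?G) = (\<integral>\<^sup>+ t. 0 \<partial>?G)"
    by (rule nn_integral_cong_AE)
  then show ?thesis by (simp add: F_def)
qed

text \<open>
  Truncated below at 0, so that it is the regulator of the one-dimensional problem with input
  \<open>- g\<close>.
\<close>
definition runsup :: "(real \<Rightarrow> real) \<Rightarrow> real \<Rightarrow> real" where
  "runsup g t = (SUP s\<in>{0..t}. max 0 (g s))"

lemma runsup_0: "runsup g 0 = max 0 (g 0)"
  by (simp add: runsup_def)

context
  fixes g :: "real \<Rightarrow> real"
  assumes g: "continuous_on {0..} g"
begin

lemma runsup_attained:
  assumes t: "t \<ge> 0"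
  obtains s where "s \<in> {0..t}" "runsup g t = max 0 (g s)"
    "\<And>s'. s' \<in> {0..t} \<Longrightarrow> max 0 (g s') \<le> max 0 (g s)"
proof -
  have c: "continuous_on {0..t} (\<lambda>s. max 0 (g s))"
    by (rule continuous_on_subset[of "{0..}"]) (auto intro!: continuous_intros g)
  obtain s where s: "s \<in> {0..t}" "\<And>s'. s' \<in> {0..t} \<Longrightarrow> max 0 (g s') \<le> max 0 (g s)"
    using continuous_attains_sup[OF _ _ c] t by auto
  have "runsup g t = max 0 (g s)" unfolding runsup_def
    using s by (intro cSup_eq_maximum) auto
  then show thesis using that s by blast
qed

lemma runsup_upper:
  assumes "0 \<le> s" "s \<le> t"
  shows "g s \<le> runsup g t" and "0 \<le> runsup g t"
proof -
  have t: "t \<ge> 0" using assms by simp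
  obtain s' where s': "runsup g t = max 0 (g s')"
    "\<And>s''. s'' \<in> {0..t} \<Longrightarrow> max 0 (g s'') \<le> max 0 (g s')"
    using runsup_attained[OF t] by metis
  show "g s \<le> runsup g t" "0 \<le> runsup g t" using s'(1) s'(2)[of s] assms by auto
qed

lemma runsup_least:
  assumes "t \<ge> 0" "c \<ge> 0" "\<And>s. 0 \<le> s \<Longrightarrow> s \<le> t \<Longrightarrow> g s \<le> c"
  shows "runsup g t \<le> c"
  by (rule runsup_attained[OF assms(1)]) (use assms in auto)

lemma runsup_mono:
  assumes "0 \<le> s" "s \<le> t"
  shows "runsup g s \<le> runsup g t"
  using assms by (intro runsup_least) (auto intro!: runsup_upper)

lemma runsup_continuous: "continuous_on {0..} (runsup g)"
  unfolding continuous_on_iff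
proof (intro ballI allI impI)
  fix t e :: real assume t: "t \<in> {0..}" and e: "e > 0"
  obtain \<delta> where \<delta>: "\<delta> > 0" "\<And>s. s \<ge> 0 \<Longrightarrow> \<bar>s - t\<bar> < \<delta> \<Longrightarrow> \<bar>g s - g t\<bar> < e / 4"
    using g t e unfolding continuous_on_iff dist_real_def by (metis atLeast_iff divide_pos_pos zero_less_numeral)
  have inc: "runsup g b \<le> runsup g a + e / 2" if ab: "0 \<le> a" "a \<le> b" "\<bar>a - t\<bar> < \<delta>" "\<bar>b - t\<bar> < \<delta>" for a b
  proof (rule runsup_least)
    fix s assume s: "0 \<le> s" "s \<le> b"
    show "g s \<le> runsup g a + e / 2"
    proof (cases "s \<le> a")
      case True then show ?thesis using runsup_upper(1)[of s a] s e by simp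
    next
      case False
      then have "\<bar>g s - g t\<bar> < e / 4" "\<bar>g a - g t\<bar> < e / 4" using \<delta>(2) ab s by auto
      then show ?thesis using runsup_upper(1)[of a a] ab by linarith
    qed
  qed (use ab e runsup_upper(2)[of a a] in auto)
  show "\<exists>d>0. \<forall>x'\<in>{0..}. dist x' t < d \<longrightarrow> dist (runsup g x') (runsup g t) < e"
  proof (intro exI conjI ballI impI)
    fix t' :: real assume t': "t' \<in> {0..}" "dist t' t < \<delta>"
    show "dist (runsup g t') (runsup g t) < e"
    proof (cases "t \<le> t'")
      case True
      then show ?thesis using inc[of t t'] runsup_mono[of t t'] t t' e \<delta> by (auto simp: dist_real_def)
    next
      case False
      then show ?thesis using inc[of t' t] runsup_mono[of t' t] t t' e \<delta> by (auto simp: dist_real_def)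
    qed
  qed (fact \<delta>)
qed

text \<open>
  The supremum is attained at some time \<open>s\<close>, and nothing is added to it between
  \<open>s\<close> and \<open>t\<close>.
\<close>
lemma runsup_approx:
  assumes t: "t \<ge> 0" and e: "e > 0"
  shows "\<exists>s\<in>{0..t}. (s = 0 \<or> runsup g s - g s < e) \<and> runsup g t < runsup g s + e"
proof -
  obtain s where s: "s \<in> {0..t}" "runsup g t = max 0 (g s)"
    using runsup_attained[OF t] by blast
  show ?thesis
  proof (cases "g s > 0")
    case True
    then have "runsup g t = g s" using s by simp
    moreover have "g s \<le> runsup g s" "runsup g s \<le> runsup g t"
      using s runsup_upper(1)[of s s] runsup_mono[of s t] by auto
    ultimately show ?thesis using s e by (intro bexI[of _ s]) auto
  next
    case False
    then have "runsup g t = 0" using s by simp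
    moreover have "runsup g 0 \<ge> 0" by (simp add: runsup_0)
    ultimately show ?thesis using t e by (intro bexI[of _ 0]) auto
  qed
qed

end

lemma runsup_lipschitz:
  assumes g: "continuous_on {0..} g" and h: "continuous_on {0..} h" and t: "t \<ge> 0"
    and D: "\<And>s. 0 \<le> s \<Longrightarrow> s \<le> t \<Longrightarrow> \<bar>g s - h s\<bar> \<le> D"
  shows "\<bar>runsup g t - runsup h t\<bar> \<le> D"
proof -
  have D0: "D \<ge> 0" using D[of 0] t by simp
  have "runsup g t \<le> runsup h t + D"
  proof (rule runsup_least[OF g t])
    fix s assume "0 \<le> s" "s \<le> t"
    then show "g s \<le> runsup h t + D" using D[of s] runsup_upper(1)[OF h, of s t] by simp
  qed (use D0 runsup_upper(2)[OF h, of 0 t] t in auto)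
  moreover have "runsup h t \<le> runsup g t + D"
  proof (rule runsup_least[OF h t])
    fix s assume "0 \<le> s" "s \<le> t"
    then show "h s \<le> runsup g t + D" using D[of s] runsup_upper(1)[OF g, of s t] by simp
  qed (use D0 runsup_upper(2)[OF g, of 0 t] t in auto)
  ultimately show ?thesis by simp
qed

section \<open>Existence, continuity and measurability of the Skorokhod map\<close>

text \<open>
  A countable dense subset of \<open>[0, T]\<close>; it contains the end point \<open>T\<close>,
  which keeps one-sided limits out of the density argument.
\<close>
definition rat_times :: "real \<Rightarrow> real set" where
  "rat_times T = (\<lambda>q. q * T) ` (\<rat> \<inter> {0..1})"

lemma countable_rat_times: "countable (rat_times T)"
  unfolding rat_times_def by (intro countable_image countable_Int1 countable_rat)

lemma rat_times_subset: "T \<ge> 0 \<Longrightarrow> rat_times T \<subseteq> {0..T}"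
  using mult_left_le_one_le[of T] by (auto simp: rat_times_def mult.commute)

lemma rat_times_dense:
  assumes s: "0 \<le> s" "s \<le> T" and e: "e > 0"
  obtains q where "q \<in> rat_times T" "\<bar>q - s\<bar> < e"
proof (cases "s = T")
  case True
  have "T \<in> rat_times T" unfolding rat_times_def by (rule image_eqI[of _ _ 1]) auto
  then show ?thesis by (rule that) (simp add: True e)
next
  case False
  then have T: "T > 0" "s < T" using s by auto
  then have "s / T < min 1 ((s + e) / T)" using e by (simp add: divide_strict_right_mono)
  then obtain r where r: "r \<in> \<rat>" "s / T < r" "r < min 1 ((s + e) / T)"
    using Rats_dense_in_real[of "s / T" "min 1 ((s + e) / T)"] by blast
  moreover have "0 \<le> s / T" using T s by simp
  ultimately have r0: "0 \<le> r" by linarith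
  from r T have rT: "s < r * T" "r * T < s + e" "r \<le> 1"
    by (simp_all add: pos_divide_less_eq pos_less_divide_eq)
  have "r * T \<in> rat_times T"
    unfolding rat_times_def by (rule image_eqI[of _ _ r]) (simp_all add: r(1) r0 rT(3))
  then show ?thesis by (rule that) (use rT in simp)
qed

lemma le_on_rat_times:
  fixes f :: "real \<Rightarrow> real"
  assumes c: "continuous_on {0..T} f" and le: "\<And>q. q \<in> rat_times T \<Longrightarrow> f q \<le> c"
    and s: "0 \<le> s" "s \<le> T"
  shows "f s \<le> c"
proof (rule field_le_epsilon)
  fix e :: real assume "e > 0"
  then obtain \<delta> where \<delta>: "\<delta> > 0" "\<And>q. q \<in> {0..T} \<Longrightarrow> \<bar>q - s\<bar> < \<delta> \<Longrightarrow> \<bar>f q - f s\<bar> < e"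
    using c[unfolded continuous_on_iff dist_real_def, rule_format, of s e] s by auto
  obtain q where q: "q \<in> rat_times T" "\<bar>q - s\<bar> < \<delta>" using rat_times_dense[OF s \<delta>(1)] .
  have "\<bar>f q - f s\<bar> < e" using \<delta>(2)[OF _ q(2)] q(1) rat_times_subset[of T] s by auto
  then show "f s \<le> c + e" using le[OF q(1)] by linarith
qed

lemma runsup_measurable:
  assumes c: "\<And>\<omega>. \<omega> \<in> space M \<Longrightarrow> continuous_on {0..} (g \<omega>)"
    and m: "\<And>t. t \<ge> 0 \<Longrightarrow> (\<lambda>\<omega>. g \<omega> t) \<in> borel_measurable M" and t: "t \<ge> 0"
  shows "(\<lambda>\<omega>. runsup (g \<omega>) t) \<in> borel_measurable M"
  unfolding borel_measurable_iff_le
proof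
  fix b
  have "{\<omega> \<in> space M. runsup (g \<omega>) t \<le> b} = {\<omega> \<in> space M. 0 \<le> b \<and> (\<forall>q\<in>rat_times t. g \<omega> q \<le> b)}"
  proof (intro Collect_cong conj_cong refl)
    fix \<omega> assume \<omega>: "\<omega> \<in> space M"
    note up = runsup_upper[OF c[OF \<omega>]]
    show "runsup (g \<omega>) t \<le> b \<longleftrightarrow> 0 \<le> b \<and> (\<forall>q\<in>rat_times t. g \<omega> q \<le> b)"
    proof
      assume "runsup (g \<omega>) t \<le> b"
      moreover have "g \<omega> q \<le> runsup (g \<omega>) t" if "q \<in> rat_times t" for q
        using up(1)[of q t] that rat_times_subset[OF t] by auto
      moreover have "0 \<le> runsup (g \<omega>) t" using up(2)[of 0 t] t by simp
      ultimately show "0 \<le> b \<and> (\<forall>q\<in>rat_times t. g \<omega> q \<le> b)" by force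
    next
      assume r: "0 \<le> b \<and> (\<forall>q\<in>rat_times t. g \<omega> q \<le> b)"
      show "runsup (g \<omega>) t \<le> b"
      proof (rule runsup_least[OF c[OF \<omega>] t])
        fix s assume "0 \<le> s" "s \<le> t"
        moreover have "continuous_on {0..t} (g \<omega>)"
          using c[OF \<omega>] by (rule continuous_on_subset) auto
        ultimately show "g \<omega> s \<le> b" using r le_on_rat_times[of t "g \<omega>" b s] by blast
      qed (use r in simp)
    qed
  qed
  also have "\<dots> \<in> sets M"
  proof (cases "0 \<le> b")
    case True
    have "{\<omega> \<in> space M. \<forall>q\<in>rat_times t. g \<omega> q \<le> b} \<in> sets M"
    proof (rule sets.sets_Collect_countable_All'[OF _ countable_rat_times])
      fix q assume "q \<in> rat_times t"
      then have "q \<ge> 0" using rat_times_subset[OF t] by auto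
      from m[OF this] show "{\<omega> \<in> space M. g \<omega> q \<le> b} \<in> sets M"
        unfolding borel_measurable_iff_le by blast
    qed
    then show ?thesis using True by simp
  qed simp
  finally show "{\<omega> \<in> space M. runsup (g \<omega>) t \<le> b} \<in> sets M" .
qed

text \<open>
  The part of the equation for \<open>z\<^sub>j\<close> that does not contain
  \<open>y\<^sub>j\<close>, with opposite sign; the one-dimensional problem for coordinate
  \<open>j\<close> then has the regulator \<open>R\<^sub>j\<^sub>j y\<^sub>j = runsup
  (residual)\<close>.
\<close>
definition sk_residual ::
    "nat \<Rightarrow> (nat \<Rightarrow> nat \<Rightarrow> real) \<Rightarrow> (nat \<Rightarrow> real \<Rightarrow> real) \<Rightarrow> (nat \<Rightarrow> real \<Rightarrow> real) \<Rightarrow> nat \<Rightarrow> real \<Rightarrow> real" where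
  "sk_residual d R x y j s = - x j s - (\<Sum>i\<in>{..<d} - {j}. R j i * y i s)"

primrec sk_iter ::
    "nat \<Rightarrow> (nat \<Rightarrow> nat \<Rightarrow> real) \<Rightarrow> (nat \<Rightarrow> real \<Rightarrow> real) \<Rightarrow> nat \<Rightarrow> nat \<Rightarrow> real \<Rightarrow> real" where
  "sk_iter d R x 0 = (\<lambda>j t. 0)"
| "sk_iter d R x (Suc n) = (\<lambda>j t. runsup (sk_residual d R x (sk_iter d R x n) j) t / R j j)"

lemma sk_residual_continuous:
  assumes "\<And>j. j < d \<Longrightarrow> continuous_on {0..} (x j)" "\<And>j. j < d \<Longrightarrow> continuous_on {0..} (y j)" "j < d"
  shows "continuous_on {0..} (sk_residual d R x y j)"
  unfolding sk_residual_def[abs_def] using assms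
  by (intro continuous_on_diff continuous_on_minus continuous_on_sum continuous_on_mult continuous_on_const) auto

lemma sk_residual_lipschitz:
  assumes off: "\<And>i. i \<in> {..<d} - {j} \<Longrightarrow> R j i \<le> 0"
    and D: "\<And>i. i \<in> {..<d} - {j} \<Longrightarrow> \<bar>y i s - y' i s\<bar> \<le> D i"
  shows "\<bar>sk_residual d R x y j s - sk_residual d R x y' j s\<bar> \<le> (\<Sum>i\<in>{..<d} - {j}. - R j i * D i)"
proof -
  have "sk_residual d R x y j s - sk_residual d R x y' j s
      = (\<Sum>i\<in>{..<d} - {j}. R j i * y' i s - R j i * y i s)"
    unfolding sk_residual_def sum_subtractf by simp
  also have "\<bar>\<dots>\<bar> \<le> (\<Sum>i\<in>{..<d} - {j}. \<bar>R j i * y' i s - R j i * y i s\<bar>)"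
    by (rule sum_abs)
  also have "\<dots> \<le> (\<Sum>i\<in>{..<d} - {j}. - R j i * D i)"
  proof (rule sum_mono)
    fix i assume i: "i \<in> {..<d} - {j}"
    have "\<bar>R j i * y' i s - R j i * y i s\<bar> = \<bar>R j i\<bar> * \<bar>y i s - y' i s\<bar>"
      unfolding right_diff_distrib[symmetric] abs_mult by (simp add: abs_minus_commute)
    also have "\<dots> = - R j i * \<bar>y i s - y' i s\<bar>" using off[OF i] by simp
    also have "\<dots> \<le> - R j i * D i" using off[OF i] D[OF i] by (intro mult_left_mono) auto
    finally show "\<bar>R j i * y' i s - R j i * y i s\<bar> \<le> - R j i * D i" .
  qed
  finally show ?thesis .
qed

lemma sk_iter_continuous:
  assumes x: "\<And>j. j < d \<Longrightarrow> continuous_on {0..} (x j)" and j: "j < d"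
    and diag: "\<And>j. j < d \<Longrightarrow> R j j > 0"
  shows "continuous_on {0..} (sk_iter d R x n j)"
  using j
proof (induction n arbitrary: j)
  case (Suc n)
  have "continuous_on {0..} (runsup (sk_residual d R x (sk_iter d R x n) j))"
  proof (rule runsup_continuous, rule sk_residual_continuous)
    show "continuous_on {0..} (x j)" if "j < d" for j using x[OF that] .
    show "continuous_on {0..} (sk_iter d R x n j)" if "j < d" for j using Suc.IH[OF that] .
    show "j < d" by (fact Suc.prems)
  qed
  then have "continuous_on {0..} (\<lambda>t. runsup (sk_residual d R x (sk_iter d R x n) j) t / R j j)"
    using diag[OF Suc.prems] by (intro continuous_on_divide continuous_on_const) auto
  then show ?case by simp
qed simp

lemma sk_iter_measurable:
  assumes x: "\<And>j \<omega>. j < d \<Longrightarrow> \<omega> \<in> space M \<Longrightarrow> continuous_on {0..} (x \<omega> j)"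
    and m: "\<And>j t. j < d \<Longrightarrow> t \<ge> 0 \<Longrightarrow> (\<lambda>\<omega>. x \<omega> j t) \<in> borel_measurable M"
    and j: "j < d" and diag: "\<And>j. j < d \<Longrightarrow> R j j > 0" and t: "t \<ge> 0"
  shows "(\<lambda>\<omega>. sk_iter d R (x \<omega>) n j t) \<in> borel_measurable M"
  using j t
proof (induction n arbitrary: j t)
  case (Suc n)
  have "(\<lambda>\<omega>. runsup (sk_residual d R (x \<omega>) (sk_iter d R (x \<omega>) n) j) t) \<in> borel_measurable M"
  proof (rule runsup_measurable[OF _ _ Suc.prems(2)])
    show "continuous_on {0..} (sk_residual d R (x \<omega>) (sk_iter d R (x \<omega>) n) j)" if "\<omega> \<in> space M" for \<omega>
    proof (rule sk_residual_continuous)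
      show xc: "continuous_on {0..} (x \<omega> j)" if "j < d" for j using x[OF that \<open>\<omega> \<in> space M\<close>] .
      show "continuous_on {0..} (sk_iter d R (x \<omega>) n j)" if "j < d" for j
        by (rule sk_iter_continuous) (fact xc that diag)+
      show "j < d" by (fact Suc.prems)
    qed
    show "(\<lambda>\<omega>. sk_residual d R (x \<omega>) (sk_iter d R (x \<omega>) n) j t) \<in> borel_measurable M" if "t \<ge> 0" for t
    proof -
      have "(\<lambda>\<omega>. - x \<omega> j t) \<in> borel_measurable M"
        using m[OF Suc.prems(1) that] by (rule borel_measurable_uminus)
      moreover have "(\<lambda>\<omega>. \<Sum>i\<in>{..<d} - {j}. R j i * sk_iter d R (x \<omega>) n i t) \<in> borel_measurable M"
      proof (rule borel_measurable_sum)
        fix i assume "i \<in> {..<d} - {j}"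
        then have "i < d" by simp
        from Suc.IH[OF this that]
        show "(\<lambda>\<omega>. R j i * sk_iter d R (x \<omega>) n i t) \<in> borel_measurable M"
          by (rule borel_measurable_times[OF borel_measurable_const])
      qed
      ultimately show ?thesis unfolding sk_residual_def by (rule borel_measurable_diff)
    qed
  qed
  then show ?case unfolding sk_iter.simps
    by (rule borel_measurable_divide[OF _ borel_measurable_const])
qed simp

text \<open>
  Since \<open>R a = 1\<close>, the off-diagonal part of row \<open>j\<close> maps
  \<open>a\<close> to \<open>R\<^sub>j\<^sub>j a\<^sub>j - 1 \<le> \<rho> R\<^sub>j\<^sub>j
  a\<^sub>j\<close> with \<open>\<rho> < 1\<close>. So the iteration contracts by
  \<open>\<rho>\<close> in the supremum norm on \<open>[0, T]\<close> weighted by \<open>1 /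
  a\<close>, and its limit is a continuous fixed point.
\<close>
lemma sk_iter_limit:
  assumes M: "nonsingular_M d R"
    and a: "\<And>j. j < d \<Longrightarrow> a j \<ge> 0" "\<And>j. j < d \<Longrightarrow> (\<Sum>i<d. R j i * a i) = 1"
    and x: "\<And>j. j < d \<Longrightarrow> continuous_on {0..} (x j)" and x0: "\<And>j. j < d \<Longrightarrow> x j 0 \<ge> 0"
  obtains y z where "reflected d R x z y"
    "\<And>j. j < d \<Longrightarrow> continuous_on {0..} (y j)" "\<And>j. j < d \<Longrightarrow> continuous_on {0..} (z j)"
    "\<And>j t. j < d \<Longrightarrow> t \<ge> 0 \<Longrightarrow> (\<lambda>n. sk_iter d R x n j t) \<longlonglongrightarrow> y j t"
proof -
  let ?it = "sk_iter d R x"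
  have diag: "R j j > 0" if "j < d" for j using nonsingular_M_diag_pos[OF M that] .
  have off: "- R j i \<ge> 0" if "j < d" "i \<in> {..<d} - {j}" for i j
    using M that unfolding nonsingular_M_def by auto
  have split: "(\<Sum>i<d. R j i * f i) = R j j * f j + (\<Sum>i\<in>{..<d} - {j}. R j i * f i)" if "j < d" for f j
    using that by (intro sum.remove) auto
  have itc: "continuous_on {0..} (?it n j)" if "j < d" for n j
    by (rule sk_iter_continuous[OF x that diag]) auto
  have resc: "continuous_on {0..} (sk_residual d R x (?it n) j)" if "j < d" for n j
    using that by (intro sk_residual_continuous x itc)
  have offa: "(\<Sum>i\<in>{..<d} - {j}. - R j i * a i) = R j j * a j - 1" if "j < d" for j
    using a(2)[OF that] split[OF that, of a] by (simp add: sum_negf)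
  have Ra1: "R j j * a j \<ge> 1" if "j < d" for j
  proof -
    have "(\<Sum>i\<in>{..<d} - {j}. - R j i * a i) \<ge> 0"
      using that off a(1) by (intro sum_nonneg mult_nonneg_nonneg) auto
    then show ?thesis using offa[OF that] by simp
  qed
  have apos: "a j > 0" if "j < d" for j
    using Ra1[OF that] a(1)[OF that] by (cases "a j = 0") auto
  \<comment> \<open>the 1 makes m positive when there is no coordinate\<close>
  define m where "m = Max (insert 1 ((\<lambda>j. R j j * a j) ` {..<d}))"
  have m: "m \<ge> 1" "\<And>j. j < d \<Longrightarrow> R j j * a j \<le> m" unfolding m_def by (auto intro!: Max_ge)
  define \<rho> where "\<rho> = 1 - 1 / m"
  have \<rho>: "0 \<le> \<rho>" "\<rho> < 1" using m by (auto simp: \<rho>_def)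
  have contr: "R j j * a j - 1 \<le> \<rho> * (R j j * a j)" if "j < d" for j
    using m(1) m(2)[OF that] by (simp add: \<rho>_def field_simps)
  have step: "\<exists>C\<ge>0. \<forall>n. \<forall>j<d. \<forall>t\<in>{0..T}. \<bar>?it (Suc n) j t - ?it n j t\<bar> \<le> C * \<rho> ^ n * a j" if T: "T \<ge> 0" for T
  proof -
    define C where "C = (\<Sum>j<d. runsup (sk_residual d R x (?it 0) j) T / (R j j * a j))"
    have Cj: "runsup (sk_residual d R x (?it 0) j) T / (R j j * a j) \<le> C" if "j < d" for j
      unfolding C_def using that diag apos T
      by (intro member_le_sum divide_nonneg_pos runsup_upper(2)[OF resc, of _ 0]) auto
    have C0: "C \<ge> 0" unfolding C_def using diag apos T
      by (intro sum_nonneg divide_nonneg_pos runsup_upper(2)[OF resc, of _ 0]) auto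
    have "\<bar>?it (Suc n) j t - ?it n j t\<bar> \<le> C * \<rho> ^ n * a j" if "j < d" "t \<in> {0..T}" for n j t
      using that
    proof (induction n arbitrary: j t)
      case 0
      note res0 = resc[of j 0, OF 0(1)]
      have "0 \<le> runsup (sk_residual d R x (?it 0) j) t"
        using 0(2) by (intro runsup_upper(2)[OF res0, of 0]) auto
      moreover have "runsup (sk_residual d R x (?it 0) j) t \<le> runsup (sk_residual d R x (?it 0) j) T"
        using 0(2) by (intro runsup_mono[OF res0]) auto
      moreover have "runsup (sk_residual d R x (?it 0) j) T \<le> C * (R j j * a j)"
        using Cj[of j] 0 diag[of j] apos[of j] by (simp add: field_simps)
      ultimately show ?case using diag[of j] 0 by (simp add: field_simps)
    next
      case (Suc n)
      have "\<bar>runsup (sk_residual d R x (?it (Suc n)) j) t - runsup (sk_residual d R x (?it n) j) t\<bar>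
          \<le> C * \<rho> ^ n * (R j j * a j - 1)"
      proof (rule runsup_lipschitz)
        fix s assume s: "0 \<le> s" "s \<le> t"
        have "\<bar>sk_residual d R x (?it (Suc n)) j s - sk_residual d R x (?it n) j s\<bar>
            \<le> (\<Sum>i\<in>{..<d} - {j}. - R j i * (C * \<rho> ^ n * a i))"
        proof (rule sk_residual_lipschitz)
          fix i assume i: "i \<in> {..<d} - {j}"
          show "R j i \<le> 0" using off[OF Suc.prems(1) i] by simp
          show "\<bar>?it (Suc n) i s - ?it n i s\<bar> \<le> C * \<rho> ^ n * a i"
            by (rule Suc.IH) (use i s Suc.prems in auto)
        qed
        also have "\<dots> = C * \<rho> ^ n * (\<Sum>i\<in>{..<d} - {j}. - R j i * a i)"
          unfolding sum_distrib_left by (rule sum.cong) auto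
        finally show "\<bar>sk_residual d R x (?it (Suc n)) j s - sk_residual d R x (?it n) j s\<bar>
            \<le> C * \<rho> ^ n * (R j j * a j - 1)" unfolding offa[OF Suc.prems(1)] .
      next
        show "continuous_on {0..} (sk_residual d R x (?it (Suc n)) j)" by (rule resc[OF Suc.prems(1)])
        show "continuous_on {0..} (sk_residual d R x (?it n) j)" by (rule resc[OF Suc.prems(1)])
        show "0 \<le> t" using Suc.prems(2) by simp
      qed
      also have "\<dots> \<le> C * \<rho> ^ n * (\<rho> * (R j j * a j))"
        using contr[OF Suc.prems(1)] C0 \<rho> by (intro mult_left_mono) auto
      finally have le: "\<bar>runsup (sk_residual d R x (?it (Suc n)) j) t - runsup (sk_residual d R x (?it n) j) t\<bar>
          \<le> C * \<rho> ^ n * (\<rho> * (R j j * a j))" .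
      have eq: "?it (Suc (Suc n)) j t - ?it (Suc n) j t
          = (runsup (sk_residual d R x (?it (Suc n)) j) t - runsup (sk_residual d R x (?it n) j) t) / R j j"
        by (simp only: sk_iter.simps(2) diff_divide_distrib)
      have "\<bar>?it (Suc (Suc n)) j t - ?it (Suc n) j t\<bar> \<le> C * \<rho> ^ n * (\<rho> * (R j j * a j)) / R j j"
        unfolding eq abs_divide abs_of_pos[OF diag[OF Suc.prems(1)]]
        using le diag[OF Suc.prems(1)] by (intro divide_right_mono) simp_all
      also have "\<dots> = C * \<rho> ^ Suc n * a j" using diag[OF Suc.prems(1)] by simp
      finally show ?case .
    qed
    then show ?thesis using C0 by blast
  qed
  define y where "y = (\<lambda>j t. \<Sum>n. ?it (Suc n) j t - ?it n j t)"
  have unif: "uniform_limit {0..T} (\<lambda>n. ?it n j) (y j) sequentially" if T: "T \<ge> 0" and j: "j < d" for T j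
  proof -
    obtain C where C: "\<And>n j t. j < d \<Longrightarrow> t \<in> {0..T} \<Longrightarrow> \<bar>?it (Suc n) j t - ?it n j t\<bar> \<le> C * \<rho> ^ n * a j"
      using step[OF T] by blast
    have "uniform_limit {0..T} (\<lambda>n t. \<Sum>i<n. ?it (Suc i) j t - ?it i j t) (\<lambda>t. \<Sum>i. ?it (Suc i) j t - ?it i j t) sequentially"
    proof (rule Weierstrass_m_test)
      show "norm (?it (Suc n) j t - ?it n j t) \<le> C * \<rho> ^ n * a j" if "t \<in> {0..T}" for n t
        using C[OF j that] by (simp del: sk_iter.simps)
      show "summable (\<lambda>n. C * \<rho> ^ n * a j)"
        using \<rho> by (intro summable_mult summable_mult2 summable_geometric) auto
    qed
    moreover have "(\<Sum>i<n. ?it (Suc i) j t - ?it i j t) = ?it n j t" for n t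
      by (subst sum_lessThan_telescope[of "\<lambda>n. ?it n j t" n]) simp
    ultimately show ?thesis by (simp add: y_def del: sk_iter.simps)
  qed
  have yc: "continuous_on {0..} (y j)" if j: "j < d" for j
  proof (rule continuous_on_halfline_glue)
    fix T :: real assume "T \<ge> 0"
    then show "continuous_on {0..T} (y j)"
      by (intro uniform_limit_theorem[OF _ unif])
        (auto intro!: always_eventually continuous_on_subset[OF itc] j)
  qed
  have lim: "(\<lambda>n. ?it n j t) \<longlonglongrightarrow> y j t" if "j < d" "t \<ge> 0" for j t
    using tendsto_uniform_limitI[OF unif[OF that(2,1)], of t] that by simp
  have grc: "continuous_on {0..} (sk_residual d R x y j)" if "j < d" for j
    using that by (intro sk_residual_continuous x yc)
  have fix_pt: "R j j * y j t = runsup (sk_residual d R x y j) t" if j: "j < d" and t: "t \<ge> 0" for j t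
  proof -
    have "(\<lambda>n. runsup (sk_residual d R x (?it n) j) t) \<longlonglongrightarrow> runsup (sk_residual d R x y j) t"
    proof (rule LIMSEQ_I)
      fix e :: real assume e: "e > 0"
      define S where "S = (\<Sum>i\<in>{..<d} - {j}. - R j i)"
      have S0: "S \<ge> 0" unfolding S_def using off[OF j] by (intro sum_nonneg) auto
      define e' where "e' = e / (S + 1) / 2"
      have e': "e' > 0" using e S0 by (simp add: e'_def)
      have "S + 1 \<noteq> 0" using S0 by simp
      then have "(S + 1) * e' = e / 2" unfolding e'_def times_divide_eq_right by (metis nonzero_mult_div_cancel_left)
      then have "S * e' + e' = e / 2" by (simp add: distrib_right)
      then have Se': "S * e' < e" using e e' by linarith
      have "\<forall>\<^sub>F n in sequentially. \<forall>i\<in>{..<d}. \<forall>s\<in>{0..t}. dist (?it n i s) (y i s) < e'"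
        using uniform_limitD[OF unif[OF t] e'] by (intro eventually_ball_finite) auto
      then obtain N where N: "\<And>n i s. n \<ge> N \<Longrightarrow> i < d \<Longrightarrow> s \<in> {0..t} \<Longrightarrow> dist (?it n i s) (y i s) < e'"
        unfolding eventually_sequentially by blast
      show "\<exists>N. \<forall>n\<ge>N. norm (runsup (sk_residual d R x (?it n) j) t - runsup (sk_residual d R x y j) t) < e"
      proof (intro exI allI impI)
        fix n assume n: "n \<ge> N"
        have "\<bar>runsup (sk_residual d R x (?it n) j) t - runsup (sk_residual d R x y j) t\<bar> \<le> S * e'"
        proof (rule runsup_lipschitz[OF resc[OF j] grc[OF j] t])
          fix s assume s: "0 \<le> s" "s \<le> t"
          have "\<bar>sk_residual d R x (?it n) j s - sk_residual d R x y j s\<bar> \<le> (\<Sum>i\<in>{..<d} - {j}. - R j i * e')"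
          proof (rule sk_residual_lipschitz)
            fix i assume i: "i \<in> {..<d} - {j}"
            show "R j i \<le> 0" using off[OF j i] by simp
            have "dist (?it n i s) (y i s) < e'" by (rule N[OF n]) (use i s in auto)
            then show "\<bar>?it n i s - y i s\<bar> \<le> e'" by (simp add: dist_real_def)
          qed
          also have "\<dots> = S * e'" by (simp add: S_def sum_distrib_right)
          finally show "\<bar>sk_residual d R x (?it n) j s - sk_residual d R x y j s\<bar> \<le> S * e'" .
        qed
        then show "norm (runsup (sk_residual d R x (?it n) j) t - runsup (sk_residual d R x y j) t) < e"
          using Se' by simp
      qed
    qed
    then have "(\<lambda>n. runsup (sk_residual d R x (?it n) j) t / R j j) \<longlonglongrightarrow> runsup (sk_residual d R x y j) t / R j j"
      using diag[OF j] by (intro tendsto_divide tendsto_const) auto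
    then have "(\<lambda>n. ?it (Suc n) j t) \<longlonglongrightarrow> runsup (sk_residual d R x y j) t / R j j" by simp
    moreover have "(\<lambda>n. ?it (Suc n) j t) \<longlonglongrightarrow> y j t" using lim[OF j t] by (rule LIMSEQ_Suc)
    ultimately have "y j t = runsup (sk_residual d R x y j) t / R j j" using LIMSEQ_unique by blast
    then show ?thesis using diag[OF j] by simp
  qed
  define z where "z = (\<lambda>j t. x j t + (\<Sum>k<d. R j k * y k t))"
  have zres: "z j t = runsup (sk_residual d R x y j) t - sk_residual d R x y j t" if "j < d" "t \<ge> 0" for j t
    using fix_pt[OF that] split[OF that(1), of "\<lambda>i. y i t"] by (simp add: z_def sk_residual_def)
  have zc: "continuous_on {0..} (z j)" if "j < d" for j
    unfolding z_def using x yc that by (auto intro!: continuous_intros)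
  have it0: "?it n j 0 = 0" if "j < d" for n j
    using that
  proof (induction n arbitrary: j)
    case (Suc n)
    have "sk_residual d R x (?it n) j 0 = - x j 0"
      using Suc.IH by (simp add: sk_residual_def)
    then show ?case using x0[OF Suc.prems] by (simp add: runsup_0)
  qed simp
  have y0: "y j 0 = 0" if "j < d" for j
    unfolding y_def it0[OF that] by simp
  have "reflected d R x z y"
    unfolding reflected_def
  proof (intro allI impI conjI)
    fix j assume j: "j < d"
    show "0 \<le> z j t" if "0 \<le> t" for t
      using zres[OF j that] runsup_upper(1)[OF grc[OF j], of t t] that by simp
    show "z j t = x j t + (\<Sum>k<d. R j k * y k t)" if "0 \<le> t" for t by (simp add: z_def)
    show "mono_on {0..} (y j)"
    proof (rule mono_onI)
      fix s t :: real assume st: "s \<in> {0..}" "t \<in> {0..}" "s \<le> t"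
      then have "R j j * y j s \<le> R j j * y j t"
        using fix_pt[OF j] runsup_mono[OF grc[OF j], of s t] by simp
      then show "y j s \<le> y j t" using diag[OF j] by simp
    qed
    show "y j 0 = 0" using y0[OF j] .
    fix t e :: real assume t: "t \<ge> 0" and e: "e > 0"
    define e' where "e' = min e (R j j * e)"
    have "e' > 0" using e diag[OF j] by (simp add: e'_def)
    then obtain s where s: "s \<in> {0..t}" "s = 0 \<or> runsup (sk_residual d R x y j) s - sk_residual d R x y j s < e'"
      "runsup (sk_residual d R x y j) t < runsup (sk_residual d R x y j) s + e'"
      using runsup_approx[OF grc[OF j] t] by blast
    have "R j j * y j t < R j j * (y j s + e)"
      using s(1,3) fix_pt[OF j, of s] fix_pt[OF j t] by (simp add: e'_def distrib_left)
    then have "y j t < y j s + e" using diag[OF j] by simp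
    moreover have "s = 0 \<or> z j s < e" using s(1,2) zres[OF j, of s] by (auto simp: e'_def)
    ultimately show "\<exists>s\<in>{0..t}. (s = 0 \<or> z j s < e) \<and> y j t < y j s + e" using s(1) by blast
  qed
  then show thesis using that yc zc lim by blast
qed

text \<open>
  The definition of the Skorokhod map only chooses some pair. The limit of the iteration shows
  that a pair exists, and uniqueness identifies the chosen pair with this limit, whatever
  regularity the choice guarantees.
\<close>
theorem Phi_Psi_reflected:
  assumes M: "nonsingular_M d (\<lambda>i j. R $$ (i, j))" and R: "R \<in> carrier_mat d d"
    and x: "\<And>j. j < d \<Longrightarrow> continuous_on {0..} (x j)" and x0: "\<And>j. j < d \<Longrightarrow> x j 0 \<ge> 0"
  shows "reflected d (\<lambda>i j. R $$ (i, j)) x (Phi d R x) (Psi d R x)"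
    and "\<And>j. j < d \<Longrightarrow> continuous_on {0..} (Phi d R x j)"
    and "\<And>j. j < d \<Longrightarrow> continuous_on {0..} (Psi d R x j)"
    and "\<And>j t. j < d \<Longrightarrow> t \<ge> 0 \<Longrightarrow> (\<lambda>n. sk_iter d (\<lambda>i j. R $$ (i, j)) x n j t) \<longlonglongrightarrow> Psi d R x j t"
proof -
  let ?R = "\<lambda>i j. R $$ (i, j)"
  obtain a where a: "\<And>i. a i \<ge> 0" "\<And>i. i < d \<Longrightarrow> (\<Sum>j<d. R $$ (i, j) * a j) = 1"
    using unit_potential[OF M R order_refl] by metis
  obtain y z where yz: "reflected d ?R x z y"
    "\<And>j. j < d \<Longrightarrow> continuous_on {0..} (y j)" "\<And>j. j < d \<Longrightarrow> continuous_on {0..} (z j)"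
    "\<And>j t. j < d \<Longrightarrow> t \<ge> 0 \<Longrightarrow> (\<lambda>n. sk_iter d ?R x n j t) \<longlonglongrightarrow> y j t"
    by (rule sk_iter_limit[where a = a and x = x, OF M a x x0]) (assumption | rule that)+
  have "skorokhod_pair d R x z y"
    unfolding skorokhod_pair_def
  proof (intro allI impI)
    fix j assume j: "j < d"
    show "cadlag (z j) \<and> cadlag (y j) \<and> (\<forall>t\<ge>0. 0 \<le> z j t \<and> 0 \<le> y j t) \<and>
        (\<forall>t\<ge>0. z j t = x j t + (\<Sum>k<d. R $$ (j, k) * y k t)) \<and> mono_on {0..} (y j) \<and> y j 0 = 0 \<and>
        (\<integral>\<^sup>+ t \<in> {0..}. ennreal (z j t) \<partial>interval_measure (\<lambda>t. y j (max 0 t))) = 0"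
      using flat_off_of_reflected[OF yz(1) j yz(3,2)] j reflectedD[OF yz(1) j] yz(2,3)
      by (auto intro!: continuous_on_imp_cadlag mono_onI)
  qed
  then have "skorokhod_pair d R x (fst (z, y)) (snd (z, y))" by simp
  then have "skorokhod_pair d R x (Phi d R x) (Psi d R x)"
    unfolding Phi_def Psi_def skorokhod_map_def by (rule someI)
  then show refl: "reflected d ?R x (Phi d R x) (Psi d R x)"
    by (rule skorokhod_pair_imp_reflected)
  note eq = reflected_unique[OF M refl yz(1)]
  show "continuous_on {0..} (Phi d R x j)" if "j < d" for j
    using yz(3)[OF that] by (rule continuous_on_eq) (use eq(2)[OF that] in auto)
  show "continuous_on {0..} (Psi d R x j)" if "j < d" for j
    using yz(2)[OF that] by (rule continuous_on_eq) (use eq(1)[OF that] in auto)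
  show "(\<lambda>n. sk_iter d ?R x n j t) \<longlonglongrightarrow> Psi d R x j t" if "j < d" "t \<ge> 0" for j t
    using yz(4)[OF that] eq(1)[OF that] by simp
qed

text \<open>
  Each iterate is measurable because a running supremum of a continuous path is determined by
  countably many times.
\<close>
lemma Phi_Psi_measurable:
  assumes M: "nonsingular_M d (\<lambda>i j. R $$ (i, j))" and R: "R \<in> carrier_mat d d"
    and x: "\<And>j \<omega>. j < d \<Longrightarrow> \<omega> \<in> space P \<Longrightarrow> continuous_on {0..} (x \<omega> j)"
    and x0: "\<And>j \<omega>. j < d \<Longrightarrow> \<omega> \<in> space P \<Longrightarrow> x \<omega> j 0 \<ge> 0"
    and m: "\<And>j t. j < d \<Longrightarrow> t \<ge> 0 \<Longrightarrow> (\<lambda>\<omega>. x \<omega> j t) \<in> borel_measurable P"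
    and j: "j < d" and t: "t \<ge> 0"
  shows "(\<lambda>\<omega>. Psi d R (x \<omega>) j t) \<in> borel_measurable P"
    and "(\<lambda>\<omega>. Phi d R (x \<omega>) j t) \<in> borel_measurable P"
proof -
  have pp: "reflected d (\<lambda>i j. R $$ (i, j)) (x \<omega>) (Phi d R (x \<omega>)) (Psi d R (x \<omega>))"
    "\<And>j t. j < d \<Longrightarrow> t \<ge> 0 \<Longrightarrow> (\<lambda>n. sk_iter d (\<lambda>i j. R $$ (i, j)) (x \<omega>) n j t) \<longlonglongrightarrow> Psi d R (x \<omega>) j t"
    if "\<omega> \<in> space P" for \<omega>
    using Phi_Psi_reflected(1,4)[where x = "x \<omega>", OF M R x[OF _ that] x0[OF _ that]] by auto
  have psi: "(\<lambda>\<omega>. Psi d R (x \<omega>) j t) \<in> borel_measurable P" if j: "j < d" for j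
  proof (rule borel_measurable_LIMSEQ_real)
    show "(\<lambda>n. sk_iter d (\<lambda>i j. R $$ (i, j)) (x \<omega>) n j t) \<longlonglongrightarrow> Psi d R (x \<omega>) j t"
      if "\<omega> \<in> space P" for \<omega> by (rule pp(2)[OF that j t])
    show "(\<lambda>\<omega>. sk_iter d (\<lambda>i j. R $$ (i, j)) (x \<omega>) n j t) \<in> borel_measurable P" for n
      by (rule sk_iter_measurable[where x = x]) (fact x m j nonsingular_M_diag_pos[OF M] t)+
  qed
  show "(\<lambda>\<omega>. Psi d R (x \<omega>) j t) \<in> borel_measurable P" by (rule psi[OF j])
  have "(\<lambda>\<omega>. x \<omega> j t + (\<Sum>k<d. R $$ (j, k) * Psi d R (x \<omega>) k t)) \<in> borel_measurable P"
    using psi m[OF j t] by (intro borel_measurable_add borel_measurable_sum borel_measurable_times) auto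
  then show "(\<lambda>\<omega>. Phi d R (x \<omega>) j t) \<in> borel_measurable P"
    by (rule measurable_cong[THEN iffD1, rotated]) (simp add: reflectedD(2)[OF pp(1) j t])
qed

text \<open>
  In one dimension the least regulator is explicit.
\<close>
lemma reflected_one_dim:
  assumes g: "continuous_on {0..} g" and g0: "g 0 \<ge> 0" and r: "reflected 1 (\<lambda>i j. 1) (\<lambda>_. g) z y" and t: "t \<ge> 0"
  shows "z 0 t = g t + runsup (\<lambda>s. - g s) t"
proof -
  have M: "nonsingular_M 1 (\<lambda>i j. 1)" by (auto simp: nonsingular_M_def lessThan_Suc)
  have c: "continuous_on {0..} (\<lambda>s. - g s)" using g by (intro continuous_intros)
  have "reflected 1 (\<lambda>i j. 1) (\<lambda>_. g) (\<lambda>_ t. g t + runsup (\<lambda>s. - g s) t) (\<lambda>_. runsup (\<lambda>s. - g s))"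
    unfolding reflected_def
  proof (intro allI impI conjI)
    show "0 \<le> g t + runsup (\<lambda>s. - g s) t" if "0 \<le> t" for t
      using runsup_upper(1)[OF c that order_refl] by simp
    show "g t + runsup (\<lambda>s. - g s) t = g t + (\<Sum>k<1::nat. 1 * runsup (\<lambda>s. - g s) t)" for t by simp
    show "mono_on {0..} (runsup (\<lambda>s. - g s))" by (rule mono_onI) (simp add: runsup_mono[OF c])
    show "runsup (\<lambda>s. - g s) 0 = 0" using g0 by (simp add: runsup_0)
    fix t e :: real assume "0 \<le> t" "0 < e"
    then show "\<exists>s\<in>{0..t}. (s = 0 \<or> g s + runsup (\<lambda>s. - g s) s < e) \<and> runsup (\<lambda>s. - g s) t < runsup (\<lambda>s. - g s) s + e"
      using runsup_approx[OF c, of t e] by (simp add: add.commute)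
  qed
  from reflected_unique(2)[OF M r this _ t, of 0] show ?thesis by simp
qed

lemma Phi1_eq:
  assumes g: "continuous_on {0..} g" and g0: "g 0 \<ge> 0" and t: "t \<ge> 0"
  shows "Phi1 g t = g t + runsup (\<lambda>s. - g s) t"
proof -
  have "reflected 1 (\<lambda>i j. 1\<^sub>m 1 $$ (i, j)) (\<lambda>_. g) (Phi 1 (1\<^sub>m 1) (\<lambda>_. g)) (Psi 1 (1\<^sub>m 1) (\<lambda>_. g))"
    using g g0 by (intro Phi_Psi_reflected(1) nonsingular_M_one) auto
  moreover have "reflected 1 (\<lambda>i j. 1\<^sub>m 1 $$ (i, j)) = reflected 1 (\<lambda>i j. 1)"
    unfolding reflected_def by (auto simp: fun_eq_iff)
  ultimately show ?thesis
    unfolding Phi1_def using reflected_one_dim[OF g g0 _ t] by simp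
qed

lemma Phi1_continuous:
  assumes g: "continuous_on {0..} g" and g0: "g 0 \<ge> 0"
  shows "continuous_on {0..} (Phi1 g)"
proof -
  have "continuous_on {0..} (\<lambda>t. g t + runsup (\<lambda>s. - g s) t)"
    using g by (intro continuous_intros runsup_continuous)
  then show ?thesis by (rule continuous_on_eq) (use Phi1_eq[OF g g0] in auto)
qed

lemma Phi1_lipschitz:
  assumes "continuous_on {0..} g" "g 0 \<ge> 0" "continuous_on {0..} h" "h 0 \<ge> 0"
    and t: "t \<ge> 0" and D: "\<And>s. 0 \<le> s \<Longrightarrow> s \<le> t \<Longrightarrow> \<bar>g s - h s\<bar> \<le> D"
  shows "\<bar>Phi1 g t - Phi1 h t\<bar> \<le> 2 * D"
proof -
  have "\<bar>runsup (\<lambda>s. - g s) t - runsup (\<lambda>s. - h s) t\<bar> \<le> D"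
    using assms by (intro runsup_lipschitz) (auto intro!: continuous_intros simp: abs_minus_commute)
  then show ?thesis using D[of t] t Phi1_eq[OF assms(1,2) t] Phi1_eq[OF assms(3,4) t] by linarith
qed

section \<open>Random elements of path space\<close>

text \<open>
  Continuity in the path topology at a single path, read off from the basic neighbourhoods.
\<close>
lemma path_continuousD:
  assumes f: "continuous_map path_topology euclideanreal f" and x: "cadlag x" and e: "e > 0"
  obtains T \<delta> where "\<delta> > 0"
    "\<And>y. cadlag y \<Longrightarrow> (\<And>t. 0 \<le> t \<Longrightarrow> t \<le> T \<Longrightarrow> \<bar>y t - x t\<bar> < \<delta>) \<Longrightarrow> \<bar>f y - f x\<bar> < e"
proof -
  have "openin path_topology {y \<in> topspace path_topology. f y \<in> ball (f x) e}"
    by (rule openin_continuous_map_preimage[OF f]) simp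
  moreover have "x \<in> {y \<in> topspace path_topology. f y \<in> ball (f x) e}"
    using x e by (simp add: topspace_path_topology)
  ultimately obtain T \<delta> where \<delta>: "\<delta> > 0"
    "{y. cadlag y \<and> (\<forall>t\<in>{0..T}. \<bar>y t - x t\<bar> < \<delta>)} \<subseteq> {y \<in> topspace path_topology. f y \<in> ball (f x) e}"
    unfolding openin_path_topology by (elim conjE) (drule (1) bspec, elim exE conjE, blast)
  show thesis
  proof (rule that[OF \<delta>(1)])
    fix y assume "cadlag y" "\<And>t. 0 \<le> t \<Longrightarrow> t \<le> T \<Longrightarrow> \<bar>y t - x t\<bar> < \<delta>"
    then have "y \<in> {y. cadlag y \<and> (\<forall>t\<in>{0..T}. \<bar>y t - x t\<bar> < \<delta>)}" by simp
    then have "f y \<in> ball (f x) e" using \<delta>(2) by blast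
    then show "\<bar>f y - f x\<bar> < e" by (simp add: dist_real_def abs_minus_commute)
  qed
qed

lemma path_continuous_tendsto:
  assumes f: "continuous_map path_topology euclideanreal f" and x: "cadlag x"
    and X: "\<And>i. cadlag (X i)" and lim: "\<And>T. T \<ge> 0 \<Longrightarrow> uniform_limit {0..T} X x F"
  shows "((\<lambda>i. f (X i)) \<longlongrightarrow> f x) F"
proof (rule tendstoI)
  fix e :: real assume e: "e > 0"
  obtain T \<delta> where \<delta>: "\<delta> > 0"
    "\<And>y. cadlag y \<Longrightarrow> (\<And>t. 0 \<le> t \<Longrightarrow> t \<le> T \<Longrightarrow> \<bar>y t - x t\<bar> < \<delta>) \<Longrightarrow> \<bar>f y - f x\<bar> < e"
    using path_continuousD[OF f x e] by metis
  have "\<forall>\<^sub>F i in F. \<forall>t\<in>{0..max 0 T}. dist (X i t) (x t) < \<delta>"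
    using lim[of "max 0 T"] \<delta>(1) unfolding uniform_limit_iff by simp
  then show "\<forall>\<^sub>F i in F. dist (f (X i)) (f x) < e"
  proof (rule eventually_mono)
    fix i assume i: "\<forall>t\<in>{0..max 0 T}. dist (X i t) (x t) < \<delta>"
    have "\<bar>f (X i) - f x\<bar> < e"
    proof (rule \<delta>(2)[OF X])
      fix t assume "0 \<le> t" "t \<le> T"
      then show "\<bar>X i t - x t\<bar> < \<delta>" using i by (simp add: dist_real_def)
    qed
    then show "dist (f (X i)) (f x) < e" by (simp add: dist_real_def)
  qed
qed

text \<open>
  Translates of the tent function are the partition of unity behind piecewise linear
  interpolation.
\<close>
definition tent :: "real \<Rightarrow> real" where
  "tent y = max 0 (1 - \<bar>y\<bar>)"

lemma tent_nonneg: "tent y \<ge> 0" by (simp add: tent_def)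

lemma tent_sum:
  assumes "0 \<le> y" "y \<le> real N"
  shows "(\<Sum>k\<le>N. tent (y - real k)) = 1"
  using assms
proof (induction N)
  case 0
  then show ?case by (simp add: tent_def)
next
  case (Suc N)
  show ?case
  proof (cases "y \<le> real N")
    case True
    then have "tent (y - real (Suc N)) = 0" by (simp add: tent_def)
    then show ?thesis using Suc.IH[OF Suc.prems(1) True] by simp
  next
    case False
    have z: "tent (y - real k) = 0" if "k < N" for k
    proof -
      have "real k + 1 \<le> real N" using that by linarith
      then show ?thesis using False by (simp add: tent_def)
    qed
    have "(\<Sum>k\<le>Suc N. tent (y - real k)) = (\<Sum>k<N. tent (y - real k)) + tent (y - real N) + tent (y - real (Suc N))"
      by (simp add: lessThan_Suc_atMost[symmetric])
    also have "(\<Sum>k<N. tent (y - real k)) = 0" using z by simp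
    also have "tent (y - real N) = 1 - (y - real N)" using False Suc.prems by (simp add: tent_def)
    also have "tent (y - real (Suc N)) = 1 - (real (Suc N) - y)" using False Suc.prems by (simp add: tent_def)
    finally show ?thesis by simp
  qed
qed

definition interp :: "nat \<Rightarrow> nat \<Rightarrow> (nat \<Rightarrow> real) \<Rightarrow> real \<Rightarrow> real" where
  "interp n N c t = (\<Sum>k\<le>N. c k * tent (real n * t - real k))"

lemma interp_continuous: "continuous_on A (interp n N c)"
  unfolding interp_def[abs_def] tent_def
  by (intro continuous_on_sum continuous_on_mult continuous_on_const continuous_on_max continuous_on_diff
      continuous_on_rabs continuous_on_id)

lemma interp_close:
  assumes t: "0 \<le> t" "real n * t \<le> real N"
    and c: "\<And>k. k \<le> N \<Longrightarrow> \<bar>real n * t - real k\<bar> < 1 \<Longrightarrow> \<bar>c k - v\<bar> \<le> e"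
  shows "\<bar>interp n N c t - v\<bar> \<le> e"
proof -
  let ?w = "\<lambda>k. tent (real n * t - real k)"
  have one: "(\<Sum>k\<le>N. ?w k) = 1" using t by (intro tent_sum) auto
  have "interp n N c t - v = (\<Sum>k\<le>N. c k * ?w k) - v * (\<Sum>k\<le>N. ?w k)"
    unfolding one interp_def by simp
  also have "\<dots> = (\<Sum>k\<le>N. (c k - v) * ?w k)"
    by (simp add: sum_distrib_left left_diff_distrib sum_subtractf)
  also have "\<bar>\<dots>\<bar> \<le> (\<Sum>k\<le>N. \<bar>(c k - v) * ?w k\<bar>)" by (rule sum_abs)
  also have "\<dots> \<le> (\<Sum>k\<le>N. e * ?w k)"
  proof (rule sum_mono)
    fix k assume k: "k \<in> {..N}"
    show "\<bar>(c k - v) * ?w k\<bar> \<le> e * ?w k"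
    proof (cases "\<bar>real n * t - real k\<bar> < 1")
      case True
      then show ?thesis using c[of k] k tent_nonneg
        unfolding abs_mult by (simp add: mult_right_mono)
    next
      case False
      then have "?w k = 0" by (simp add: tent_def)
      then show ?thesis by simp
    qed
  qed
  also have "\<dots> = e" unfolding sum_distrib_left[symmetric] one by simp
  finally show ?thesis .
qed

text \<open>
  Interpolation of \<open>x\<close> from its values at the multiples of \<open>1 / (n + 1)\<close>
  up to time \<open>n + 1\<close>: both the mesh and the horizon are governed by the one index
  \<open>n\<close>.
\<close>
definition sampled :: "nat \<Rightarrow> (real \<Rightarrow> real) \<Rightarrow> real \<Rightarrow> real" where
  "sampled n x = interp (Suc n) (Suc n * Suc n) (\<lambda>k. x (real k / real (Suc n)))"

lemma sampled_continuous: "continuous_on A (sampled n x)"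
  unfolding sampled_def by (rule interp_continuous)

text \<open>
  The two requirements on \<open>n\<close> for interpolation on \<open>[0, T]\<close> to be
  accurate: the mesh resolves the modulus of continuity, and the grid covers the interval. Grid
  points may lie slightly beyond \<open>T\<close>, whence the modulus on \<open>[0, T +
  1]\<close>.
\<close>
lemma sample_uniform:
  fixes x :: "real \<Rightarrow> real"
  assumes x: "continuous_on {0..} x" and e: "e > 0"
  obtains n0 where "\<And>n t k. n \<ge> n0 \<Longrightarrow> 0 \<le> t \<Longrightarrow> t \<le> T \<Longrightarrow> \<bar>real (Suc n) * t - real k\<bar> < 1 \<Longrightarrow>
    \<bar>x (real k / real (Suc n)) - x t\<bar> < e" "\<And>n t. n \<ge> n0 \<Longrightarrow> t \<le> T \<Longrightarrow> real (Suc n) * t \<le> real (Suc n * Suc n)"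
proof -
  have "uniformly_continuous_on {0..T + 1} x"
    using x by (intro compact_uniformly_continuous) (auto intro: continuous_on_subset)
  then obtain \<delta> where \<delta>: "\<delta> > 0"
    "\<And>s t. s \<in> {0..T+1} \<Longrightarrow> t \<in> {0..T+1} \<Longrightarrow> dist s t < \<delta> \<Longrightarrow> dist (x s) (x t) < e"
    unfolding uniformly_continuous_on_def using e by meson
  obtain n1 where n1: "1 / real (Suc n1) < \<delta>" using \<delta>(1) nat_approx_posE by blast
  define n0 where "n0 = max n1 (nat \<lceil>T\<rceil>)"
  show thesis
  proof
    fix n t k assume n: "n0 \<le> n" and t: "0 \<le> t" "t \<le> T" and k: "\<bar>real (Suc n) * t - real k\<bar> < 1"
    let ?s = "real k / real (Suc n)"
    have "t - ?s = (real (Suc n) * t - real k) / real (Suc n)" by (simp add: field_simps)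
    then have "\<bar>t - ?s\<bar> = \<bar>real (Suc n) * t - real k\<bar> / real (Suc n)" by (simp only: abs_divide abs_of_nat)
    also have "\<dots> < 1 / real (Suc n)" using k by (intro divide_strict_right_mono) auto
    finally have d: "\<bar>t - ?s\<bar> < 1 / real (Suc n)" .
    have "1 / real (Suc n) \<le> 1 / real (Suc n1)" using n by (intro divide_left_mono) (auto simp: n0_def)
    moreover have "1 / real (Suc n) \<le> 1" by simp
    ultimately have "\<bar>t - ?s\<bar> < \<delta>" "\<bar>t - ?s\<bar> < 1" using d n1 by linarith+
    moreover from this have "?s \<in> {0..T+1}" using t by auto
    moreover have "t \<in> {0..T+1}" using t by auto
    ultimately have "dist (x ?s) (x t) < e" by (intro \<delta>(2)) (auto simp: dist_real_def abs_minus_commute)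
    then show "\<bar>x ?s - x t\<bar> < e" by (simp add: dist_real_def)
  next
    fix n t assume n: "n0 \<le> n" and t: "t \<le> T"
    have "t \<le> real (Suc n)" using n t real_nat_ceiling_ge[of T] by (auto simp: n0_def)
    then have "real (Suc n) * t \<le> real (Suc n) * real (Suc n)" by (intro mult_left_mono) auto
    then show "real (Suc n) * t \<le> real (Suc n * Suc n)" by (simp only: of_nat_mult)
  qed
qed

lemma sampled_limit:
  assumes x: "continuous_on {0..} x"
  shows "uniform_limit {0..T} (\<lambda>n. sampled n x) x sequentially"
  unfolding uniform_limit_iff
proof (intro allI impI)
  fix e :: real assume e: "e > 0"
  then have "e / 2 > 0" by simp
  then obtain n0 where n0: "\<And>n t k. n \<ge> n0 \<Longrightarrow> 0 \<le> t \<Longrightarrow> t \<le> T \<Longrightarrow> \<bar>real (Suc n) * t - real k\<bar> < 1 \<Longrightarrow>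
    \<bar>x (real k / real (Suc n)) - x t\<bar> < e / 2" "\<And>n t. n \<ge> n0 \<Longrightarrow> t \<le> T \<Longrightarrow> real (Suc n) * t \<le> real (Suc n * Suc n)"
    using sample_uniform[OF x, of "e / 2" T] by metis
  show "\<forall>\<^sub>F n in sequentially. \<forall>t\<in>{0..T}. dist (sampled n x t) (x t) < e"
    unfolding eventually_sequentially
  proof (intro exI allI impI ballI)
    fix n t assume n: "n0 \<le> n" and t: "t \<in> {0..T}"
    have "\<bar>sampled n x t - x t\<bar> \<le> e / 2"
      unfolding sampled_def
    proof (rule interp_close)
      show "0 \<le> t" "real (Suc n) * t \<le> real (Suc n * Suc n)" using n0(2)[OF n] t by auto
      show "\<bar>x (real k / real (Suc n)) - x t\<bar> \<le> e / 2" if "\<bar>real (Suc n) * t - real k\<bar> < 1" for k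
        using n0(1)[OF n _ _ that] t by (auto intro: less_imp_le)
    qed
    then show "dist (sampled n x t) (x t) < e" using e by (simp add: dist_real_def)
  qed
qed

text \<open>
  A countable family that is dense among the continuous paths. The appended 0 supplies a value at
  the last grid point.
\<close>
definition rational_path :: "nat \<times> rat list \<Rightarrow> real \<Rightarrow> real" where
  "rational_path p = interp (fst p) (length (snd p)) (\<lambda>k. of_rat ((snd p @ [0]) ! k))"

lemma rational_path_dense:
  assumes x: "continuous_on {0..} x" and e: "e > 0"
  obtains p where "\<And>t. 0 \<le> t \<Longrightarrow> t \<le> T \<Longrightarrow> \<bar>x t - rational_path p t\<bar> \<le> e"
proof -
  have "e / 2 > 0" using e by simp
  then obtain n where n: "\<And>t k. 0 \<le> t \<Longrightarrow> t \<le> T \<Longrightarrow> \<bar>real (Suc n) * t - real k\<bar> < 1 \<Longrightarrow>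
    \<bar>x (real k / real (Suc n)) - x t\<bar> < e / 2" "\<And>t. t \<le> T \<Longrightarrow> real (Suc n) * t \<le> real (Suc n * Suc n)"
    using sample_uniform[OF x, of "e / 2" T] by (metis order_refl)
  have "\<exists>q. \<bar>of_rat q - x (real k / real (Suc n))\<bar> < e / 2" for k
  proof -
    obtain q where "x (real k / real (Suc n)) - e / 2 < of_rat q" "of_rat q < x (real k / real (Suc n)) + e / 2"
      using of_rat_dense[of "x (real k / real (Suc n)) - e / 2" "x (real k / real (Suc n)) + e / 2"] e by auto
    then show ?thesis by (intro exI[of _ q]) linarith
  qed
  then obtain q where q: "\<And>k. \<bar>of_rat (q k) - x (real k / real (Suc n))\<bar> < e / 2" by metis
  define N where "N = Suc n * Suc n + 1"
  define ls where "ls = map q [0..<N]"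
  have len: "length ls = N" by (simp add: ls_def)
  have ls: "(ls @ [0]) ! k = (if k < N then q k else 0)" if "k \<le> N" for k
    using that by (auto simp: nth_append ls_def)
  show thesis
  proof (rule that)
    fix t assume t: "0 \<le> t" "t \<le> T"
    have nt: "real (Suc n) * t \<le> real (Suc n * Suc n)" using n(2)[OF t(2)] .
    have "\<bar>interp (Suc n) N (\<lambda>k. of_rat ((ls @ [0]) ! k)) t - x t\<bar> \<le> e"
    proof (rule interp_close[OF t(1)])
      show "real (Suc n) * t \<le> real N" using nt unfolding N_def by linarith
      fix k assume k: "k \<le> N" "\<bar>real (Suc n) * t - real k\<bar> < 1"
      have "real k < real N" using k(2) nt unfolding N_def by linarith
      then have eq: "(ls @ [0]) ! k = q k" using ls[OF k(1)] by simp
      show "\<bar>of_rat ((ls @ [0]) ! k) - x t\<bar> \<le> e"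
        unfolding eq using q[of k] n(1)[OF t k(2)] by linarith
    qed
    then show "\<bar>x t - rational_path (Suc n, ls) t\<bar> \<le> e"
      by (simp add: rational_path_def len abs_minus_commute)
  qed
qed

text \<open>
  The Borel sets of the path topology are far more than what finitely many times generate. But a
  process with continuous paths lives in a separable part of the space: an open set meets it in a
  countable union of closed balls around the paths of a countable dense family, and such a ball is
  an event because it can be tested at rational times.
\<close>
lemma path_measurable:
  assumes c: "\<And>\<omega>. \<omega> \<in> space M \<Longrightarrow> continuous_on {0..} (X \<omega>)"
    and m: "\<And>t. t \<ge> 0 \<Longrightarrow> (\<lambda>\<omega>. X \<omega> t) \<in> borel_measurable M"
  shows "X \<in> measurable M (borel_of_topology path_topology)"
  unfolding borel_of_topology_def
proof (rule measurable_measure_of)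
  show "{U. openin path_topology U} \<subseteq> Pow (topspace path_topology)"
    using openin_subset by auto
  show "X \<in> space M \<rightarrow> topspace path_topology"
    using c continuous_on_imp_cadlag by (auto simp: topspace_path_topology)
  fix U assume "U \<in> {U. openin path_topology U}"
  then have U: "\<And>x. x \<in> U \<Longrightarrow> \<exists>T e. e > 0 \<and> {y. cadlag y \<and> (\<forall>t\<in>{0..T}. \<bar>y t - x t\<bar> < e)} \<subseteq> U"
    unfolding openin_path_topology by blast
  define B where "B = (\<lambda>(p, m::nat). {y. cadlag y \<and> (\<forall>t\<in>{0..real m}. \<bar>y t - rational_path p t\<bar> \<le> 1 / real (Suc m))})"
  define E where "E = (\<lambda>(p, m::nat). {\<omega> \<in> space M. \<forall>q\<in>rat_times (real m). \<bar>X \<omega> q - rational_path p q\<bar> \<le> 1 / real (Suc m)})"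
  define Good where "Good = {pm. B pm \<subseteq> U}"
  have E_B: "\<omega> \<in> E pm \<longleftrightarrow> \<omega> \<in> space M \<and> X \<omega> \<in> B pm" for \<omega> pm
  proof (cases pm)
    case (Pair p m)
    have "(\<forall>q\<in>rat_times (real m). \<bar>X \<omega> q - rational_path p q\<bar> \<le> 1 / real (Suc m))
        \<longleftrightarrow> (\<forall>t\<in>{0..real m}. \<bar>X \<omega> t - rational_path p t\<bar> \<le> 1 / real (Suc m))" if \<omega>: "\<omega> \<in> space M"
    proof
      assume q: "\<forall>q\<in>rat_times (real m). \<bar>X \<omega> q - rational_path p q\<bar> \<le> 1 / real (Suc m)"
      have "continuous_on {0..real m} (X \<omega>)" using c[OF \<omega>] by (rule continuous_on_subset) auto
      moreover have "continuous_on {0..real m} (rational_path p)"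
        unfolding rational_path_def by (rule interp_continuous)
      ultimately have "continuous_on {0..real m} (\<lambda>t. \<bar>X \<omega> t - rational_path p t\<bar>)"
        by (intro continuous_on_rabs continuous_on_diff)
      from le_on_rat_times[OF this] q
      show "\<forall>t\<in>{0..real m}. \<bar>X \<omega> t - rational_path p t\<bar> \<le> 1 / real (Suc m)" by auto
    next
      assume "\<forall>t\<in>{0..real m}. \<bar>X \<omega> t - rational_path p t\<bar> \<le> 1 / real (Suc m)"
      then show "\<forall>q\<in>rat_times (real m). \<bar>X \<omega> q - rational_path p q\<bar> \<le> 1 / real (Suc m)"
        using rat_times_subset[of "real m"] by auto
    qed
    then show ?thesis
      using c[of \<omega>] continuous_on_imp_cadlag[of "X \<omega>"] by (auto simp: Pair E_def B_def)
  qed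
  have "X -` U \<inter> space M = (\<Union>pm\<in>Good. E pm)"
  proof (intro equalityI subsetI)
    fix \<omega> assume "\<omega> \<in> X -` U \<inter> space M"
    then have \<omega>: "\<omega> \<in> space M" "X \<omega> \<in> U" by auto
    obtain T e where e: "e > 0" "{y. cadlag y \<and> (\<forall>t\<in>{0..T}. \<bar>y t - X \<omega> t\<bar> < e)} \<subseteq> U"
      using U[OF \<omega>(2)] by blast
    have "e / 2 > 0" using e by simp
    then obtain m1 where m1: "1 / real (Suc m1) < e / 2" using nat_approx_posE by blast
    define m where "m = max m1 (nat \<lceil>T\<rceil>)"
    have "1 / real (Suc m) \<le> 1 / real (Suc m1)" by (intro divide_left_mono) (auto simp: m_def)
    then have m: "1 / real (Suc m) < e / 2" using m1 by simp
    have mT: "T \<le> real m" using real_nat_ceiling_ge[of T] by (auto simp: m_def)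
    obtain p where p: "\<And>t. 0 \<le> t \<Longrightarrow> t \<le> real m \<Longrightarrow> \<bar>X \<omega> t - rational_path p t\<bar> \<le> 1 / real (Suc m)"
      using rational_path_dense[OF c[OF \<omega>(1)], of "1 / real (Suc m)" "real m"] by auto
    have XB: "X \<omega> \<in> B (p, m)"
      using p continuous_on_imp_cadlag[OF c[OF \<omega>(1)]] by (simp add: B_def)
    have "B (p, m) \<subseteq> U"
    proof (rule subset_trans[OF subsetI e(2)])
      fix y assume y: "y \<in> B (p, m)"
      have "\<bar>y t - X \<omega> t\<bar> < e" if t: "t \<in> {0..T}" for t
      proof -
        have "\<bar>y t - rational_path p t\<bar> \<le> 1 / real (Suc m)" using y t mT by (simp add: B_def)
        moreover have "\<bar>X \<omega> t - rational_path p t\<bar> \<le> 1 / real (Suc m)" using p t mT by simp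
        ultimately show ?thesis using m by linarith
      qed
      then show "y \<in> {y. cadlag y \<and> (\<forall>t\<in>{0..T}. \<bar>y t - X \<omega> t\<bar> < e)}" using y by (simp add: B_def)
    qed
    then show "\<omega> \<in> (\<Union>pm\<in>Good. E pm)" using XB \<omega>(1) E_B unfolding Good_def by blast
  next
    fix \<omega> assume "\<omega> \<in> (\<Union>pm\<in>Good. E pm)"
    then show "\<omega> \<in> X -` U \<inter> space M" using E_B by (auto simp: Good_def)
  qed
  also have "\<dots> \<in> sets M"
  proof (rule sets.countable_UN'')
    show "countable Good" by (rule countableI_type)
    show "E pm \<in> sets M" for pm
    proof (cases pm)
      case (Pair p m')
      show ?thesis unfolding E_def Pair prod.case
      proof (rule sets.sets_Collect_countable_All'[OF _ countable_rat_times])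
        fix q assume "q \<in> rat_times (real m')"
        then have "q \<ge> 0" using rat_times_subset[of "real m'"] by auto
        from m[OF this] have "(\<lambda>\<omega>. \<bar>X \<omega> q - rational_path p q\<bar>) \<in> borel_measurable M"
          by (intro borel_measurable_abs borel_measurable_diff borel_measurable_const)
        then show "{\<omega> \<in> space M. \<bar>X \<omega> q - rational_path p q\<bar> \<le> 1 / real (Suc m')} \<in> sets M"
          unfolding borel_measurable_iff_le by blast
      qed
    qed
  qed
  finally show "X -` U \<inter> space M \<in> sets M" .
qed

lemma path_functional_measurable:
  assumes "continuous_map path_topology euclideanreal f"
  shows "f \<in> borel_measurable (borel_of_topology path_topology)"
proof -
  have sp: "space (borel_of_topology path_topology) = topspace path_topology"
    unfolding borel_of_topology_def by (rule space_measure_of) (use openin_subset in auto)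
  have st: "U \<in> sets (borel_of_topology path_topology)" if "openin path_topology U" for U
    unfolding borel_of_topology_def
    by (subst sets_measure_of) (use openin_subset that in \<open>auto intro: sigma_sets.Basic\<close>)
  show ?thesis
  proof (rule borel_measurableI)
    fix S :: "real set" assume "open S"
    then have "openin path_topology {x \<in> topspace path_topology. f x \<in> S}"
      using openin_continuous_map_preimage[OF assms] by simp
    moreover have "f -` S \<inter> topspace path_topology = {x \<in> topspace path_topology. f x \<in> S}" by auto
    ultimately show "f -` S \<inter> space (borel_of_topology path_topology) \<in> sets (borel_of_topology path_topology)"
      unfolding sp using st by simp
  qed
qed

section \<open>The law of Brownian motion\<close>

lemma std_bmD:
  assumes "std_brownian_motion M d W"
  shows "prob_space M"
    and "\<And>j t. j < d \<Longrightarrow> t \<ge> 0 \<Longrightarrow> W j t \<in> borel_measurable M"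
    and "\<And>j \<omega>. j < d \<Longrightarrow> \<omega> \<in> space M \<Longrightarrow> W j 0 \<omega> = 0"
    and "\<And>j \<omega>. j < d \<Longrightarrow> \<omega> \<in> space M \<Longrightarrow> continuous_on {0..} (\<lambda>t. W j t \<omega>)"
    and "\<And>j s t. j < d \<Longrightarrow> 0 \<le> s \<Longrightarrow> s < t \<Longrightarrow>
      distributed M lborel (\<lambda>\<omega>. W j t \<omega> - W j s \<omega>) (normal_density 0 (sqrt (t - s)))"
    and "\<And>n t. 0 \<le> t 0 \<Longrightarrow> (\<And>i. i < n \<Longrightarrow> t i \<le> t (Suc i)) \<Longrightarrow>
      prob_space.indep_vars M (\<lambda>_. borel)
        (\<lambda>(j, i) \<omega>. W j (t (Suc i)) \<omega> - W j (t i) \<omega>) ({..<d} \<times> {..<n::nat})"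
  using assms unfolding std_brownian_motion_def by auto

text \<open>
  Brownian scaling together with projection onto a unit vector. The increments of the combination
  over disjoint time intervals are functions of disjoint groups of increments of \<open>W\<close>;
  coefficients that vanish are left out of the sum of normal variables, which requires positive
  variances.
\<close>
lemma bm_combination:
  assumes W: "std_brownian_motion M d W" and c: "(\<Sum>l<d. (c l)\<^sup>2) = 1" and g: "g > 0"
  shows "std_brownian_motion M 1 (\<lambda>j t \<omega>. \<Sum>l<d. c l * (g * W l (t / g\<^sup>2) \<omega>))"
proof -
  note w = std_bmD[OF W]
  interpret prob_space M by (rule w(1))
  let ?\<beta> = "\<lambda>t \<omega>. \<Sum>l<d. c l * (g * W l (t / g\<^sup>2) \<omega>)"
  have nn: "t / g\<^sup>2 \<ge> 0" if "t \<ge> 0" for t using that by simp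
  have meas: "?\<beta> t \<in> borel_measurable M" if "t \<ge> 0" for t
    by (intro borel_measurable_sum borel_measurable_times borel_measurable_const w(2) nn that) simp
  have zero: "?\<beta> 0 \<omega> = 0" if "\<omega> \<in> space M" for \<omega>
    using w(3)[OF _ that] by simp
  have cont: "continuous_on {0..} (\<lambda>t. ?\<beta> t \<omega>)" if "\<omega> \<in> space M" for \<omega>
  proof (intro continuous_on_sum continuous_on_mult continuous_on_const)
    fix l assume "l \<in> {..<d}"
    then have "continuous_on {0..} (\<lambda>t. W l t \<omega>)" using w(4) that by simp
    then show "continuous_on {0..} (\<lambda>t. W l (t / g\<^sup>2) \<omega>)"
      by (rule continuous_on_compose2) (use g in \<open>auto intro!: continuous_intros\<close>)
  qed
  have diff: "?\<beta> t \<omega> - ?\<beta> s \<omega> = (\<Sum>l<d. c l * (g * (W l (t / g\<^sup>2) \<omega> - W l (s / g\<^sup>2) \<omega>)))" for s t \<omega>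
    by (simp add: right_diff_distrib sum_subtractf)
  have normal: "distributed M lborel (\<lambda>\<omega>. ?\<beta> t \<omega> - ?\<beta> s \<omega>) (normal_density 0 (sqrt (t - s)))"
    if st: "0 \<le> s" "s < t" for s t
  proof -
    define \<tau> where "\<tau> = (\<lambda>i::nat. if i = 0 then s / g\<^sup>2 else t / g\<^sup>2)"
    define X where "X = (\<lambda>(j, i::nat) \<omega>. W j (\<tau> (Suc i)) \<omega> - W j (\<tau> i) \<omega>)"
    define I where "I = {l. l < d \<and> c l \<noteq> 0} \<times> {0::nat}"
    have st': "s / g\<^sup>2 < t / g\<^sup>2" using st g by (intro divide_strict_right_mono) auto
    have "indep_vars (\<lambda>_. borel) X ({..<d} \<times> {..<1})"
      unfolding X_def by (rule w(6)) (use st st' in \<open>auto simp: \<tau>_def intro: less_imp_le\<close>)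
    then have "indep_vars (\<lambda>_. borel) X I"
      by (rule indep_vars_subset) (auto simp: I_def)
    then have ind: "indep_vars (\<lambda>_. borel) (\<lambda>p \<omega>. (c (fst p) * g) * X p \<omega>) I"
      by (rule indep_vars_compose2) simp
    have Ine: "I \<noteq> {}"
    proof
      assume "I = {}"
      then have "(\<Sum>l<d. (c l)\<^sup>2) = (\<Sum>l<d. 0)" by (intro sum.cong) (auto simp: I_def)
      then show False using c by simp
    qed
    have norm1: "distributed M lborel (\<lambda>\<omega>. (c (fst p) * g) * X p \<omega>)
        (normal_density 0 (\<bar>c (fst p)\<bar> * sqrt (t - s)))" if p: "p \<in> I" for p
    proof -
      have X: "distributed M lborel (X p) (normal_density 0 (sqrt (t / g\<^sup>2 - s / g\<^sup>2)))"
        using w(5)[OF _ _ st', of "fst p"] p st by (auto simp: X_def \<tau>_def I_def)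
      have "distributed M lborel (\<lambda>\<omega>. 0 + (c (fst p) * g) * X p \<omega>)
          (normal_density (0 + (c (fst p) * g) * 0) (\<bar>c (fst p) * g\<bar> * sqrt (t / g\<^sup>2 - s / g\<^sup>2)))"
        by (rule normal_density_affine[OF X]) (use st' p g in \<open>auto simp: I_def\<close>)
      moreover have "\<bar>c (fst p) * g\<bar> * sqrt (t / g\<^sup>2 - s / g\<^sup>2) = \<bar>c (fst p)\<bar> * sqrt (t - s)"
        using g by (simp add: diff_divide_distrib[symmetric] real_sqrt_divide abs_mult)
      ultimately show ?thesis by simp
    qed
    have "distributed M lborel (\<lambda>\<omega>. \<Sum>p\<in>I. (c (fst p) * g) * X p \<omega>)
        (normal_density (\<Sum>p\<in>I. 0) (sqrt (\<Sum>p\<in>I. (\<bar>c (fst p)\<bar> * sqrt (t - s))\<^sup>2)))"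
      by (rule sum_indep_normal[OF _ Ine ind _ norm1]) (use st in \<open>auto simp: I_def\<close>)
    moreover have "(\<Sum>p\<in>I. (c (fst p) * g) * X p \<omega>) = ?\<beta> t \<omega> - ?\<beta> s \<omega>" for \<omega>
    proof -
      have "(\<Sum>p\<in>I. (c (fst p) * g) * X p \<omega>) = (\<Sum>l | l < d \<and> c l \<noteq> 0. (c l * g) * X (l, 0) \<omega>)"
        by (rule sum.reindex_bij_witness[of _ "\<lambda>l. (l, 0)" fst]) (auto simp: I_def)
      also have "\<dots> = (\<Sum>l<d. (c l * g) * X (l, 0) \<omega>)"
        by (rule sum.mono_neutral_left) auto
      finally show ?thesis unfolding diff by (simp add: X_def \<tau>_def mult.assoc)
    qed
    moreover have "(\<Sum>p\<in>I. (\<bar>c (fst p)\<bar> * sqrt (t - s))\<^sup>2) = t - s"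
    proof -
      have "(\<Sum>p\<in>I. (\<bar>c (fst p)\<bar> * sqrt (t - s))\<^sup>2) = (\<Sum>l | l < d \<and> c l \<noteq> 0. (c l)\<^sup>2 * (t - s))"
        by (rule sum.reindex_bij_witness[of _ "\<lambda>l. (l, 0)" fst])
          (use st in \<open>auto simp: I_def power_mult_distrib\<close>)
      also have "\<dots> = (\<Sum>l<d. (c l)\<^sup>2 * (t - s))"
        by (rule sum.mono_neutral_left) auto
      also have "\<dots> = t - s" using c by (simp add: sum_distrib_right[symmetric])
      finally show ?thesis .
    qed
    ultimately show ?thesis by simp
  qed
  have indep: "indep_vars (\<lambda>_. borel) (\<lambda>(j::nat, i) \<omega>. ?\<beta> (t (Suc i)) \<omega> - ?\<beta> (t i) \<omega>) ({..<1} \<times> {..<n})"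
    if t0: "0 \<le> t 0" and t: "\<And>i. i < n \<Longrightarrow> t i \<le> t (Suc i)" for n t
  proof -
    define X where "X = (\<lambda>(j, i) \<omega>. W j (t (Suc i) / g\<^sup>2) \<omega> - W j (t i / g\<^sup>2) \<omega>)"
    define K where "K = (\<lambda>p::nat \<times> nat. {..<d} \<times> {snd p})"
    have "indep_vars (\<lambda>_. borel) X ({..<d} \<times> {..<n})"
      unfolding X_def by (rule w(6)) (use t0 t g in \<open>auto intro!: divide_right_mono\<close>)
    then have "indep_vars (\<lambda>p. PiM (K p) (\<lambda>_. borel)) (\<lambda>p \<omega>. restrict (\<lambda>q. X q \<omega>) (K p)) ({..<1} \<times> {..<n})"
      by (rule indep_vars_restrict) (auto simp: K_def disjoint_family_on_def)
    then have "indep_vars (\<lambda>_. borel)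
        (\<lambda>p \<omega>. (\<Sum>l<d. c l * (g * restrict (\<lambda>q. X q \<omega>) (K p) (l, snd p)))) ({..<1} \<times> {..<n})"
    proof (rule indep_vars_compose2)
      fix p :: "nat \<times> nat"
      show "(\<lambda>v. \<Sum>l<d. c l * (g * v (l, snd p))) \<in> PiM (K p) (\<lambda>_. borel) \<rightarrow>\<^sub>M borel"
      proof (intro borel_measurable_sum borel_measurable_times borel_measurable_const)
        fix l assume "l \<in> {..<d}"
        then show "(\<lambda>v. v (l, snd p)) \<in> PiM (K p) (\<lambda>_. borel) \<rightarrow>\<^sub>M borel"
          by (intro measurable_component_singleton) (simp add: K_def)
      qed
    qed
    moreover have "(\<lambda>\<omega>. \<Sum>l<d. c l * (g * restrict (\<lambda>q. X q \<omega>) (K p) (l, snd p)))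
        = (\<lambda>(j::nat, i) \<omega>. ?\<beta> (t (Suc i)) \<omega> - ?\<beta> (t i) \<omega>) p" for p
      by (cases p) (simp add: diff K_def X_def fun_eq_iff)
    ultimately show ?thesis by (simp only:)
  qed
  show ?thesis
    unfolding std_brownian_motion_def
    using meas zero cont normal indep prob_space_axioms by (intro conjI allI impI ballI) auto
qed

definition bm_fdd :: "(nat \<times> real) set \<Rightarrow> (nat \<times> real \<Rightarrow> real set) \<Rightarrow> ennreal" where
  "bm_fdd J A = (let xs = sorted_list_of_set (insert 0 (insert 1 (snd ` J))); n = length xs - 1;
     I = {..<1::nat} \<times> {..<n} in
     emeasure (PiM I (\<lambda>p. density lborel (normal_density 0 (sqrt (xs ! Suc (snd p) - xs ! snd p)))))
       {v \<in> space (PiM I (\<lambda>_. borel)). \<forall>p\<in>J. \<forall>m<length xs. xs ! m = snd p \<longrightarrow> (\<Sum>i<m. v (0, i)) \<in> A p})"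

lemma process_element_measurable:
  assumes W: "std_brownian_motion M d W"
  shows "process_element d W \<in> measurable M (process_space d)"
  unfolding process_element_def
  using std_bmD(2)[OF W] by (intro measurable_restrict) (auto split: prod.splits)

lemma bm_fdd:
  assumes W: "std_brownian_motion M 1 W" and J: "finite J" "J \<subseteq> {..<1} \<times> {0..}"
    and A: "\<And>p. p \<in> J \<Longrightarrow> A p \<in> sets borel"
  shows "emeasure (distr M (process_space 1) (process_element 1 W))
    (prod_emb ({..<1} \<times> {0..}) (\<lambda>_. borel) J (Pi\<^sub>E J A)) = bm_fdd J A"
proof -
  note w = std_bmD[OF W]
  interpret prob_space M by (rule w(1))
  \<comment> \<open>time 0 starts the telescoping sum of increments, and time 1 guarantees at least one increment\<close>
  define S where "S = insert 0 (insert 1 (snd ` J))"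
  define xs where "xs = sorted_list_of_set S"
  define n where "n = length xs - 1"
  define I where "I = {..<1::nat} \<times> {..<n}"
  have finS: "finite S" using J by (simp add: S_def)
  have setxs: "set xs = S" using finS by (simp add: xs_def)
  have S0: "s \<ge> 0" if "s \<in> S" for s using that J(2) by (auto simp: S_def)
  have len: "length xs = card S" by (simp add: xs_def)
  have "card {0, 1::real} \<le> card S" by (rule card_mono[OF finS]) (auto simp: S_def)
  then have len2: "length xs \<ge> 2" by (simp add: len)
  have incr: "xs ! i < xs ! j" if "i < j" "j < length xs" for i j
    using sorted_wrt_nth_less[of "(<)" xs i j] that strict_sorted_list_of_set[of S] by (simp add: xs_def)
  have x0: "xs ! 0 = 0"
  proof -
    have "0 \<in> set xs" using setxs by (simp add: S_def)
    then obtain m where m: "m < length xs" "xs ! m = 0" by (auto simp: in_set_conv_nth)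
    have "xs ! 0 \<ge> 0" using S0 setxs len2 by (metis nth_mem less_le_trans pos2)
    then show ?thesis using incr[of 0 m] m by (cases "m = 0") auto
  qed
  have xge: "xs ! i \<ge> 0" if "i < length xs" for i
    using S0 setxs nth_mem[OF that] by simp
  define inc where "inc = (\<lambda>(j::nat, i) \<omega>. W j (xs ! Suc i) \<omega> - W j (xs ! i) \<omega>)"
  have "indep_vars (\<lambda>_. borel) (\<lambda>(j, i) \<omega>. W j (xs ! Suc i) \<omega> - W j (xs ! i) \<omega>) ({..<1} \<times> {..<n})"
    by (rule w(6)[of "\<lambda>i. xs ! i"]) (use incr x0 in \<open>auto simp: n_def intro: less_imp_le\<close>)
  then have ind: "indep_vars (\<lambda>_. borel) inc I" unfolding inc_def I_def .
  have Ine: "I \<noteq> {}" using len2 by (auto simp: I_def n_def lessThan_empty_iff)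
  have incm: "inc p \<in> borel_measurable M" if "p \<in> I" for p
    using that w(2) xge by (auto simp: inc_def I_def n_def intro!: borel_measurable_diff)
  let ?P = "PiM I (\<lambda>p. density lborel (normal_density 0 (sqrt (xs ! Suc (snd p) - xs ! snd p))))"
  let ?D = "\<lambda>\<omega>. \<lambda>p\<in>I. inc p \<omega>"
  have distrD: "distr M (PiM I (\<lambda>_. borel)) ?D = ?P"
  proof -
    have "distr M (PiM I (\<lambda>_. borel)) ?D = PiM I (\<lambda>p. distr M borel (inc p))"
      using indep_vars_iff_distr_eq_PiM'[where M' = "\<lambda>_. borel" and X = inc, OF Ine] incm ind by simp
    also have "\<dots> = ?P"
    proof (rule PiM_cong[OF refl])
      fix p assume p: "p \<in> I"
      have "distributed M lborel (inc p) (normal_density 0 (sqrt (xs ! Suc (snd p) - xs ! snd p)))"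
        using p w(5)[of 0 "xs ! snd p" "xs ! Suc (snd p)"] incr[of "snd p" "Suc (snd p)"] xge[of "snd p"]
        by (auto simp: I_def inc_def n_def)
      from distributed_distr_eq_density[OF this]
      show "distr M borel (inc p) = density lborel (normal_density 0 (sqrt (xs ! Suc (snd p) - xs ! snd p)))"
        by (simp cong: distr_cong)
    qed
    finally show ?thesis .
  qed
  have Dm: "?D \<in> measurable M (PiM I (\<lambda>_. borel))"
    using incm by (intro measurable_restrict) auto
  define B where "B = {v \<in> space (PiM I (\<lambda>_. borel :: real measure)).
    \<forall>p\<in>J. \<forall>m<length xs. xs ! m = snd p \<longrightarrow> (\<Sum>i<m. v (0, i)) \<in> A p}"
  have Bsets: "B \<in> sets (PiM I (\<lambda>_. borel))"
  proof -
    have one: "{v \<in> space (PiM I (\<lambda>_. borel :: real measure)). xs ! m = snd p \<longrightarrow> (\<Sum>i<m. v (0, i)) \<in> A p}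
        \<in> sets (PiM I (\<lambda>_. borel))" if "p \<in> J" "m \<in> {..<length xs}" for p m
    proof -
      have "(\<lambda>v. \<Sum>i<m. v (0, i)) \<in> borel_measurable (PiM I (\<lambda>_. borel :: real measure))"
      proof (rule borel_measurable_sum)
        fix i assume "i \<in> {..<m}"
        then show "(\<lambda>v. v (0, i)) \<in> borel_measurable (PiM I (\<lambda>_. borel :: real measure))"
          using that(2) by (intro measurable_component_singleton) (auto simp: I_def n_def)
      qed
      from measurable_sets[OF this A[OF that(1)]]
      have "{v \<in> space (PiM I (\<lambda>_. borel :: real measure)). (\<Sum>i<m. v (0, i)) \<in> A p} \<in> sets (PiM I (\<lambda>_. borel))"
        by (simp add: vimage_def Int_def conj_commute)
      then show ?thesis by (cases "xs ! m = snd p") auto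
    qed
    have "B = {v \<in> space (PiM I (\<lambda>_. borel :: real measure)).
        \<forall>p\<in>J. \<forall>m\<in>{..<length xs}. xs ! m = snd p \<longrightarrow> (\<Sum>i<m. v (0, i)) \<in> A p}"
      unfolding B_def by auto
    also have "\<dots> \<in> sets (PiM I (\<lambda>_. borel))"
      by (intro sets.sets_Collect_countable_All' one countable_finite J(1) finite_lessThan)
    finally show ?thesis .
  qed
  have tele: "(\<Sum>i<m. inc (0, i) \<omega>) = W 0 (xs ! m) \<omega>" if "m < length xs" "\<omega> \<in> space M" for m \<omega>
  proof -
    have "(\<Sum>i<m. inc (0, i) \<omega>) = (\<Sum>i<m. W 0 (xs ! Suc i) \<omega> - W 0 (xs ! i) \<omega>)" by (simp add: inc_def)
    also have "\<dots> = W 0 (xs ! m) \<omega> - W 0 (xs ! 0) \<omega>" by (rule sum_lessThan_telescope)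
    finally show ?thesis using w(3)[of 0 \<omega>] that x0 by simp
  qed
  have ev: "process_element 1 W -` prod_emb ({..<1} \<times> {0..}) (\<lambda>_. borel) J (Pi\<^sub>E J A) \<inter> space M
      = ?D -` B \<inter> space M"
  proof (intro equalityI subsetI IntI vimageI2)
    fix \<omega> assume "\<omega> \<in> process_element 1 W -` prod_emb ({..<1} \<times> {0..}) (\<lambda>_. borel) J (Pi\<^sub>E J A) \<inter> space M"
    then have \<omega>: "\<omega> \<in> space M" and "restrict (process_element 1 W \<omega>) J \<in> Pi\<^sub>E J A"
      unfolding prod_emb_iff Int_iff vimage_eq by blast+
    then have in_J: "process_element 1 W \<omega> p \<in> A p" if "p \<in> J" for p
      using PiE_mem[OF _ that] that by fastforce
    show "\<omega> \<in> space M" by fact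
    show "?D \<omega> \<in> B" unfolding B_def
    proof (intro CollectI conjI ballI allI impI)
      show "?D \<omega> \<in> space (PiM I (\<lambda>_. borel))" by (simp add: space_PiM)
      fix p m assume p: "p \<in> J" and m: "m < length xs" "xs ! m = snd p"
      have "(\<Sum>i<m. ?D \<omega> (0, i)) = (\<Sum>i<m. inc (0, i) \<omega>)"
        using m by (intro sum.cong) (auto simp: I_def n_def)
      also have "\<dots> = process_element 1 W \<omega> p"
        using tele[OF m(1) \<omega>] m p J(2) by (auto simp: process_element_def)
      finally show "(\<Sum>i<m. ?D \<omega> (0, i)) \<in> A p" using in_J[OF p] by simp
    qed
  next
    fix \<omega> assume "\<omega> \<in> ?D -` B \<inter> space M"
    then have \<omega>: "\<omega> \<in> space M" and B: "?D \<omega> \<in> B" by auto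
    show "\<omega> \<in> space M" by fact
    show "process_element 1 W \<omega> \<in> prod_emb ({..<1} \<times> {0..}) (\<lambda>_. borel) J (Pi\<^sub>E J A)"
      unfolding prod_emb_iff
    proof (intro conjI ballI)
      show "process_element 1 W \<omega> \<in> extensional ({..<1} \<times> {0..})" by (simp add: process_element_def)
      show "process_element 1 W \<omega> p \<in> space borel" for p by simp
      show "restrict (process_element 1 W \<omega>) J \<in> Pi\<^sub>E J A"
      proof (rule restrict_PiE_iff[THEN iffD2], rule ballI)
        fix p assume p: "p \<in> J"
        have "snd p \<in> set xs" using p setxs by (auto simp: S_def)
        then obtain m where m: "m < length xs" "xs ! m = snd p" by (auto simp: in_set_conv_nth)
        have "(\<Sum>i<m. ?D \<omega> (0, i)) = (\<Sum>i<m. inc (0, i) \<omega>)"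
          using m by (intro sum.cong) (auto simp: I_def n_def)
        also have "\<dots> = process_element 1 W \<omega> p"
          using tele[OF m(1) \<omega>] m p J(2) by (auto simp: process_element_def)
        finally have eq: "(\<Sum>i<m. ?D \<omega> (0, i)) = process_element 1 W \<omega> p" .
        have "(\<Sum>i<m. ?D \<omega> (0, i)) \<in> A p" using B p m unfolding B_def by blast
        then show "process_element 1 W \<omega> p \<in> A p" unfolding eq .
      qed
    qed
  qed
  have "prod_emb ({..<1} \<times> {0..}) (\<lambda>_. borel) J (Pi\<^sub>E J A) \<in> sets (process_space 1)"
    using J A by (intro measurable_prod_emb sets_PiM_I_finite) auto
  then have "emeasure (distr M (process_space 1) (process_element 1 W))
      (prod_emb ({..<1} \<times> {0..}) (\<lambda>_. borel) J (Pi\<^sub>E J A))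
      = emeasure M (process_element 1 W -` prod_emb ({..<1} \<times> {0..}) (\<lambda>_. borel) J (Pi\<^sub>E J A) \<inter> space M)"
    by (rule emeasure_distr[OF process_element_measurable[OF W]])
  also have "\<dots> = emeasure M (?D -` B \<inter> space M)" unfolding ev ..
  also have "\<dots> = emeasure (distr M (PiM I (\<lambda>_. borel)) ?D) B"
    by (rule emeasure_distr[OF Dm Bsets, symmetric])
  also have "\<dots> = emeasure ?P B" unfolding distrD ..
  also have "\<dots> = bm_fdd J A"
    unfolding bm_fdd_def Let_def B_def I_def n_def xs_def S_def ..
  finally show ?thesis .
qed

text \<open>
  The finite-dimensional distributions of Brownian motion are explicit, so its law on the product
  space is unique. This is what makes estimates for the scaled noise uniform in \<open>r\<close>
  and allows a comparison of processes that live on different probability spaces.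
\<close>
lemma bm_law_unique:
  assumes W1: "std_brownian_motion M1 1 W1" and W2: "std_brownian_motion M2 1 W2"
  shows "distr M1 (process_space 1) (process_element 1 W1) = distr M2 (process_space 1) (process_element 1 W2)"
proof (rule measure_eqI_PiM_infinite)
  interpret M1: prob_space M1 by (rule std_bmD(1)[OF W1])
  show "finite_measure (distr M1 (process_space 1) (process_element 1 W1))"
    by (rule M1.finite_measure_distr[OF process_element_measurable[OF W1]])
  fix A :: "nat \<times> real \<Rightarrow> real set" and J :: "(nat \<times> real) set"
  assume J: "finite J" "J \<subseteq> {..<1} \<times> {0..}" and A: "\<And>i. i \<in> J \<Longrightarrow> A i \<in> sets borel"
  show "emeasure (distr M1 (process_space 1) (process_element 1 W1)) (prod_emb ({..<1} \<times> {0..}) (\<lambda>_. borel) J (Pi\<^sub>E J A))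
      = emeasure (distr M2 (process_space 1) (process_element 1 W2)) (prod_emb ({..<1} \<times> {0..}) (\<lambda>_. borel) J (Pi\<^sub>E J A))"
    by (rule trans[OF bm_fdd[OF W1 J A] bm_fdd[OF W2 J A, symmetric]])
qed (simp_all only: sets_distr)

lemma indep_elements_map:
  assumes ind: "indep_elements M S X T Y" and M: "prob_space M"
    and f: "f \<in> measurable S S'" and g: "g \<in> measurable T T'"
    and X': "\<And>\<omega>. \<omega> \<in> space M \<Longrightarrow> X' \<omega> = f (X \<omega>)" and Y': "\<And>\<omega>. \<omega> \<in> space M \<Longrightarrow> Y' \<omega> = g (Y \<omega>)"
  shows "indep_elements M S' X' T' Y'"
proof -
  interpret prob_space M by fact
  have X: "X \<in> measurable M S" and Y: "Y \<in> measurable M T"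
    and i: "indep_set {X -` A \<inter> space M | A. A \<in> sets S} {Y -` B \<inter> space M | B. B \<in> sets T}"
    using ind unfolding indep_elements_def by auto
  have X'm: "X' \<in> measurable M S'"
    using measurable_compose[OF X f] by (rule measurable_cong[THEN iffD2, rotated]) (rule X')
  have Y'm: "Y' \<in> measurable M T'"
    using measurable_compose[OF Y g] by (rule measurable_cong[THEN iffD2, rotated]) (rule Y')
  have "indep_set {X' -` A \<inter> space M | A. A \<in> sets S'} {Y' -` B \<inter> space M | B. B \<in> sets T'}"
  proof (rule indep_setI)
    show "{X' -` A \<inter> space M | A. A \<in> sets S'} \<subseteq> events" using measurable_sets[OF X'm] by auto
    show "{Y' -` A \<inter> space M | A. A \<in> sets T'} \<subseteq> events" using measurable_sets[OF Y'm] by auto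
    fix a b assume "a \<in> {X' -` A \<inter> space M | A. A \<in> sets S'}" "b \<in> {Y' -` A \<inter> space M | A. A \<in> sets T'}"
    then obtain A B where A: "A \<in> sets S'" "a = X' -` A \<inter> space M" and B: "B \<in> sets T'" "b = Y' -` B \<inter> space M"
      by auto
    have a: "a = X -` (f -` A \<inter> space S) \<inter> space M"
      unfolding A(2) using X' measurable_space[OF X] by auto
    have b: "b = Y -` (g -` B \<inter> space T) \<inter> space M"
      unfolding B(2) using Y' measurable_space[OF Y] by auto
    show "prob (a \<inter> b) = prob a * prob b"
      by (rule indep_setD[OF i]) (use a b measurable_sets[OF f A(1)] measurable_sets[OF g B(1)] in blast)+
  qed
  then show ?thesis using X'm Y'm unfolding indep_elements_def by simp
qed

text \<open>
  Independence in the sense of events is the factorisation of the joint law, now for two value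
  types.
\<close>
lemma indep_elements_distr:
  assumes ind: "indep_elements M S X T Y" and M: "prob_space M"
  shows "distr M (S \<Otimes>\<^sub>M T) (\<lambda>\<omega>. (X \<omega>, Y \<omega>)) = distr M S X \<Otimes>\<^sub>M distr M T Y"
proof -
  interpret prob_space M by fact
  have X: "X \<in> measurable M S" and Y: "Y \<in> measurable M T"
    and i: "indep_set {X -` A \<inter> space M | A. A \<in> sets S} {Y -` B \<inter> space M | B. B \<in> sets T}"
    using ind unfolding indep_elements_def by auto
  interpret X: prob_space "distr M S X" by (rule prob_space_distr[OF X])
  interpret Y: prob_space "distr M T Y" by (rule prob_space_distr[OF Y])
  have XY: "(\<lambda>\<omega>. (X \<omega>, Y \<omega>)) \<in> measurable M (S \<Otimes>\<^sub>M T)" using X Y by (rule measurable_Pair)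
  show ?thesis
  proof (rule pair_measure_eqI[symmetric])
    show "sigma_finite_measure (distr M S X)" "sigma_finite_measure (distr M T Y)" by unfold_locales
    show "sets (distr M S X \<Otimes>\<^sub>M distr M T Y) = sets (distr M (S \<Otimes>\<^sub>M T) (\<lambda>\<omega>. (X \<omega>, Y \<omega>)))"
      by (simp cong: sets_pair_measure_cong)
    fix A B assume "A \<in> sets (distr M S X)" "B \<in> sets (distr M T Y)"
    then have A: "A \<in> sets S" and B: "B \<in> sets T" by auto
    have "prob ((X -` A \<inter> space M) \<inter> (Y -` B \<inter> space M)) = prob (X -` A \<inter> space M) * prob (Y -` B \<inter> space M)"
      by (rule indep_setD[OF i]) (use A B in blast)+
    moreover have "(\<lambda>\<omega>. (X \<omega>, Y \<omega>)) -` (A \<times> B) \<inter> space M = (X -` A \<inter> space M) \<inter> (Y -` B \<inter> space M)" by auto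
    ultimately show "emeasure (distr M S X) A * emeasure (distr M T Y) B
        = emeasure (distr M (S \<Otimes>\<^sub>M T) (\<lambda>\<omega>. (X \<omega>, Y \<omega>))) (A \<times> B)"
      using A B X Y XY by (simp add: emeasure_distr emeasure_eq_measure ennreal_mult'')
  qed
qed

text \<open>
  One condition with a single parameter \<open>n\<close> for both the bound and the modulus of
  continuity, so that it becomes weaker as \<open>n\<close> grows. The strict inequality lets it
  be tested at rational times.
\<close>
definition modulus_ok :: "real \<Rightarrow> real \<Rightarrow> nat \<Rightarrow> (real \<Rightarrow> real) \<Rightarrow> bool" where
  "modulus_ok T e n b \<longleftrightarrow> (\<forall>s\<in>{0..T}. \<forall>t\<in>{0..T}. \<bar>b t\<bar> \<le> real n \<and> (\<bar>s - t\<bar> < 1 / real (Suc n) \<longrightarrow> \<bar>b s - b t\<bar> \<le> e))"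

lemma modulus_ok_rat:
  assumes b: "continuous_on {0..} b"
  shows "modulus_ok T e n b \<longleftrightarrow> (\<forall>s\<in>rat_times T \<inter> {0..T}. \<forall>t\<in>rat_times T \<inter> {0..T}.
    \<bar>b t\<bar> \<le> real n \<and> (\<bar>s - t\<bar> < 1 / real (Suc n) \<longrightarrow> \<bar>b s - b t\<bar> \<le> e))" (is "_ \<longleftrightarrow> ?R")
proof
  assume "modulus_ok T e n b"
  then show ?R unfolding modulus_ok_def by blast
next
  assume r: ?R
  show "modulus_ok T e n b" unfolding modulus_ok_def
  proof (intro ballI)
    fix s t assume s: "s \<in> {0..T}" and t: "t \<in> {0..T}"
    have near: "\<exists>q. q \<in> rat_times T \<inter> {0..T} \<and> \<bar>q - u\<bar> < \<delta> \<and> \<bar>b q - b u\<bar> < \<epsilon>"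
      if u: "u \<in> {0..T}" and \<delta>: "\<delta> > 0" and \<epsilon>: "\<epsilon> > 0" for u \<delta> \<epsilon> :: real
    proof -
      have "u \<in> {0..}" using u by simp
      then obtain \<delta>' where \<delta>': "\<delta>' > 0" "\<And>v. v \<in> {0..} \<Longrightarrow> dist v u < \<delta>' \<Longrightarrow> dist (b v) (b u) < \<epsilon>"
        using b[unfolded continuous_on_iff, rule_format, of u \<epsilon>] \<epsilon> by auto
      obtain q where q: "q \<in> rat_times T" "\<bar>q - u\<bar> < min \<delta> \<delta>'"
        using rat_times_dense[of u T "min \<delta> \<delta>'"] u \<delta> \<delta>'(1) by auto
      have "q \<in> {0..T}" using q(1) rat_times_subset[of T] u by auto
      then show ?thesis using q \<delta>'(2)[of q] by (intro exI[of _ q]) (auto simp: dist_real_def)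
    qed
    have "\<bar>b t\<bar> \<le> real n"
    proof (rule field_le_epsilon)
      fix \<epsilon> :: real assume "\<epsilon> > 0"
      then obtain q where q: "q \<in> rat_times T \<inter> {0..T}" "\<bar>b q - b t\<bar> < \<epsilon>" using near[OF t, of 1 \<epsilon>] by auto
      have "\<bar>b q\<bar> \<le> real n" using r q(1) by blast
      then show "\<bar>b t\<bar> \<le> real n + \<epsilon>" using q(2) by linarith
    qed
    moreover have "\<bar>b s - b t\<bar> \<le> e" if st: "\<bar>s - t\<bar> < 1 / real (Suc n)"
    proof (rule field_le_epsilon)
      fix \<epsilon> :: real assume "\<epsilon> > 0"
      then have \<epsilon>: "\<epsilon> / 2 > 0" by simp
      define c where "c = 1 / real (Suc n)"
      define \<delta> where "\<delta> = (c - \<bar>s - t\<bar>) / 2"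
      have \<delta>: "\<delta> > 0" using st by (simp add: \<delta>_def c_def)
      have c\<delta>: "2 * \<delta> = c - \<bar>s - t\<bar>" by (simp add: \<delta>_def)
      obtain p where p: "p \<in> rat_times T \<inter> {0..T}" "\<bar>p - s\<bar> < \<delta>" "\<bar>b p - b s\<bar> < \<epsilon> / 2" using near[OF s \<delta> \<epsilon>] by blast
      obtain q where q: "q \<in> rat_times T \<inter> {0..T}" "\<bar>q - t\<bar> < \<delta>" "\<bar>b q - b t\<bar> < \<epsilon> / 2" using near[OF t \<delta> \<epsilon>] by blast
      have "\<bar>p - q\<bar> < c" using p(2) q(2) c\<delta> by linarith
      then have "\<bar>p - q\<bar> < 1 / real (Suc n)" unfolding c_def .
      then have "\<bar>b p - b q\<bar> \<le> e" using r p(1) q(1) by blast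
      then show "\<bar>b s - b t\<bar> \<le> e + \<epsilon>" using p(3) q(3) by linarith
    qed
    ultimately show "\<bar>b t\<bar> \<le> real n \<and> (\<bar>s - t\<bar> < 1 / real (Suc n) \<longrightarrow> \<bar>b s - b t\<bar> \<le> e)" by blast
  qed
qed

lemma bm_zero: "std_brownian_motion M 1 W \<Longrightarrow> \<omega> \<in> space M \<Longrightarrow> W 0 0 \<omega> = 0"
  by (rule std_bmD(3)) auto

lemma bm_continuous: "std_brownian_motion M 1 W \<Longrightarrow> \<omega> \<in> space M \<Longrightarrow> continuous_on {0..} (\<lambda>t. W 0 t \<omega>)"
  by (rule std_bmD(4)) auto

text \<open>
  Although the set of continuous paths is not measurable in the product space, this condition is:
  for continuous paths it involves countably many times only. Therefore its probability is
  determined by the law of Brownian motion.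
\<close>
lemma modulus_ok_event:
  fixes T e :: real and n :: nat
  assumes W: "std_brownian_motion M 1 W"
  defines "E \<equiv> {w \<in> space (process_space 1). \<forall>s\<in>rat_times T \<inter> {0..T}. \<forall>t\<in>rat_times T \<inter> {0..T}.
    \<bar>w (0, t)\<bar> \<le> real n \<and> (\<bar>s - t\<bar> < 1 / real (Suc n) \<longrightarrow> \<bar>w (0, s) - w (0, t)\<bar> \<le> e)}"
  shows "E \<in> sets (process_space 1)"
    and "{\<omega> \<in> space M. modulus_ok T e n (\<lambda>t. W 0 t \<omega>)} = process_element 1 W -` E \<inter> space M"
    and "{\<omega> \<in> space M. modulus_ok T e n (\<lambda>t. W 0 t \<omega>)} \<in> sets M"
    and "measure M {\<omega> \<in> space M. modulus_ok T e n (\<lambda>t. W 0 t \<omega>)}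
      = measure (distr M (process_space 1) (process_element 1 W)) E"
proof -
  have comp: "(\<lambda>w. w (0, t)) \<in> borel_measurable (process_space 1)" if "t \<in> rat_times T \<inter> {0..T}" for t
    using that by (intro measurable_component_singleton) auto
  show E: "E \<in> sets (process_space 1)" unfolding E_def
  proof (intro sets.sets_Collect_countable_All' countable_Int1 countable_rat_times)
    fix s t assume s: "s \<in> rat_times T \<inter> {0..T}" and t: "t \<in> rat_times T \<inter> {0..T}"
    have a: "{w \<in> space (process_space 1). \<bar>w (0, t)\<bar> \<le> real n} \<in> sets (process_space 1)"
      using borel_measurable_abs[OF comp[OF t]] unfolding borel_measurable_iff_le by blast
    have b: "{w \<in> space (process_space 1). \<bar>w (0, s) - w (0, t)\<bar> \<le> e} \<in> sets (process_space 1)"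
      using borel_measurable_abs[OF borel_measurable_diff[OF comp[OF s] comp[OF t]]]
      unfolding borel_measurable_iff_le by blast
    have "{w \<in> space (process_space 1). \<bar>s - t\<bar> < 1 / real (Suc n) \<longrightarrow> \<bar>w (0, s) - w (0, t)\<bar> \<le> e}
        \<in> sets (process_space 1)"
    proof (cases "\<bar>s - t\<bar> < 1 / real (Suc n)")
      case True
      then show ?thesis using b by (simp only: simp_thms)
    next
      case False
      then show ?thesis by (simp only: simp_thms Collect_mem_eq sets.top)
    qed
    from sets.sets_Collect_conj[OF this a]
    show "{w \<in> space (process_space 1). \<bar>w (0, t)\<bar> \<le> real n \<and>
        (\<bar>s - t\<bar> < 1 / real (Suc n) \<longrightarrow> \<bar>w (0, s) - w (0, t)\<bar> \<le> e)} \<in> sets (process_space 1)" .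
  qed
  have pm: "process_element 1 W \<in> measurable M (process_space 1)" by (rule process_element_measurable[OF W])
  show eq: "{\<omega> \<in> space M. modulus_ok T e n (\<lambda>t. W 0 t \<omega>)} = process_element 1 W -` E \<inter> space M"
  proof (intro equalityI subsetI)
    fix \<omega> assume "\<omega> \<in> {\<omega> \<in> space M. modulus_ok T e n (\<lambda>t. W 0 t \<omega>)}"
    then have \<omega>: "\<omega> \<in> space M" and ok: "modulus_ok T e n (\<lambda>t. W 0 t \<omega>)" by auto
    have "process_element 1 W \<omega> \<in> E"
      using ok measurable_space[OF pm \<omega>] unfolding modulus_ok_rat[OF bm_continuous[OF W \<omega>]]
      by (simp add: E_def process_element_def)
    then show "\<omega> \<in> process_element 1 W -` E \<inter> space M" using \<omega> by simp
  next
    fix \<omega> assume "\<omega> \<in> process_element 1 W -` E \<inter> space M"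
    then have \<omega>: "\<omega> \<in> space M" and "process_element 1 W \<omega> \<in> E" by auto
    then have "modulus_ok T e n (\<lambda>t. W 0 t \<omega>)"
      unfolding modulus_ok_rat[OF bm_continuous[OF W \<omega>]]
      by (simp add: E_def process_element_def)
    then show "\<omega> \<in> {\<omega> \<in> space M. modulus_ok T e n (\<lambda>t. W 0 t \<omega>)}" using \<omega> by simp
  qed
  show "{\<omega> \<in> space M. modulus_ok T e n (\<lambda>t. W 0 t \<omega>)} \<in> sets M"
    unfolding eq by (rule measurable_sets[OF pm E])
  show "measure M {\<omega> \<in> space M. modulus_ok T e n (\<lambda>t. W 0 t \<omega>)}
      = measure (distr M (process_space 1) (process_element 1 W)) E"
    unfolding eq by (rule measure_distr[OF pm E, symmetric])
qed

lemma modulus_ok_prob_eq: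
  assumes W1: "std_brownian_motion M1 1 W1" and W2: "std_brownian_motion M2 1 W2"
  shows "measure M1 {\<omega> \<in> space M1. modulus_ok T e n (\<lambda>t. W1 0 t \<omega>)}
    = measure M2 {\<omega> \<in> space M2. modulus_ok T e n (\<lambda>t. W2 0 t \<omega>)}"
  unfolding modulus_ok_event(4)[OF W1] modulus_ok_event(4)[OF W2] bm_law_unique[OF W1 W2] ..

text \<open>
  A continuous path on \<open>[0, T]\<close> is bounded and uniformly continuous, so the events
  increase to the whole space.
\<close>
lemma bm_tight:
  assumes W: "std_brownian_motion M 1 W" and \<eta>: "\<eta> > 0" and e: "e > 0"
  obtains n where "measure M {\<omega> \<in> space M. modulus_ok T e n (\<lambda>t. W 0 t \<omega>)} \<ge> 1 - \<eta>"
proof -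
  interpret prob_space M by (rule std_bmD(1)[OF W])
  let ?E = "\<lambda>n. {\<omega> \<in> space M. modulus_ok T e n (\<lambda>t. W 0 t \<omega>)}"
  have sets: "range ?E \<subseteq> events" using modulus_ok_event(3)[OF W] by auto
  have inc: "incseq ?E"
  proof (rule incseq_SucI, rule subsetI)
    fix n \<omega> assume "\<omega> \<in> ?E n"
    moreover have "1 / real (Suc (Suc n)) \<le> 1 / real (Suc n)" by (intro divide_left_mono) auto
    ultimately show "\<omega> \<in> ?E (Suc n)" unfolding modulus_ok_def by fastforce
  qed
  have "(\<Union>n. ?E n) = space M"
  proof (intro equalityI subsetI)
    fix \<omega> assume \<omega>: "\<omega> \<in> space M"
    let ?b = "\<lambda>t. W 0 t \<omega>"
    have b: "continuous_on {0..T} ?b"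
      using bm_continuous[OF W \<omega>] by (rule continuous_on_subset) auto
    have "bounded (?b ` {0..T})" by (intro compact_imp_bounded compact_continuous_image b) auto
    then obtain C where "\<forall>t\<in>{0..T}. \<bar>?b t\<bar> \<le> C" unfolding bounded_iff by auto
    then have C: "\<bar>?b t\<bar> \<le> C" if "t \<in> {0..T}" for t using that by blast
    have "uniformly_continuous_on {0..T} ?b" by (intro compact_uniformly_continuous b) auto
    then obtain \<delta> where \<delta>: "\<delta> > 0" "\<And>s t. s \<in> {0..T} \<Longrightarrow> t \<in> {0..T} \<Longrightarrow> dist s t < \<delta> \<Longrightarrow> dist (?b s) (?b t) < e"
      unfolding uniformly_continuous_on_def using e by meson
    obtain n1 where n1: "1 / real (Suc n1) < \<delta>" using \<delta>(1) nat_approx_posE by blast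
    define n where "n = max n1 (nat \<lceil>C\<rceil>)"
    have "1 / real (Suc n) \<le> 1 / real (Suc n1)" by (intro divide_left_mono) (auto simp: n_def)
    then have n\<delta>: "1 / real (Suc n) < \<delta>" using n1 by simp
    have nC: "C \<le> real n" using real_nat_ceiling_ge[of C] by (auto simp: n_def)
    have "modulus_ok T e n ?b" unfolding modulus_ok_def
    proof (intro ballI conjI impI)
      fix s t assume st: "s \<in> {0..T}" "t \<in> {0..T}"
      show "\<bar>?b t\<bar> \<le> real n" using C[OF st(2)] nC by simp
      assume "\<bar>s - t\<bar> < 1 / real (Suc n)"
      then have "dist s t < \<delta>" using n\<delta> by (simp add: dist_real_def)
      from \<delta>(2)[OF st this] show "\<bar>?b s - ?b t\<bar> \<le> e" by (simp add: dist_real_def)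
    qed
    then show "\<omega> \<in> (\<Union>n. ?E n)" using \<omega> by auto
  qed auto
  then have "(\<lambda>n. prob (?E n)) \<longlonglongrightarrow> 1"
    using finite_Lim_measure_incseq[OF sets inc] prob_space by simp
  then have "\<forall>\<^sub>F n in sequentially. prob (?E n) > 1 - \<eta>"
    by (rule order_tendstoD) (use \<eta> in simp)
  then obtain n where "prob (?E n) > 1 - \<eta>" unfolding eventually_sequentially by blast
  then show thesis by (intro that[of n]) simp
qed

section \<open>Expectations of functionals of one-dimensional SRBM\<close>

text \<open>
  The truncation of \<open>a\<close> and the subtraction of \<open>b 0\<close> change nothing for
  an SRBM; they make the reflected path defined and continuous in \<open>(a, b)\<close> without
  side conditions.
\<close>
definition srbm_path :: "real \<Rightarrow> real \<Rightarrow> real \<Rightarrow> (real \<Rightarrow> real) \<Rightarrow> real \<Rightarrow> real" where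
  "srbm_path a \<theta> \<sigma> b = Phi1 (\<lambda>t. max 0 a + \<theta> * t + \<sigma> * (b t - b 0))"

lemma srbm_path_input:
  assumes "continuous_on {0..} b"
  shows "continuous_on {0..} (\<lambda>t::real. max 0 a + \<theta> * t + \<sigma> * (b t - b 0))"
  using assms by (intro continuous_on_add continuous_on_mult continuous_on_diff continuous_on_const continuous_on_id)

lemma srbm_path_continuous:
  assumes "continuous_on {0..} b"
  shows "continuous_on {0..} (srbm_path a \<theta> \<sigma> b)"
  unfolding srbm_path_def by (rule Phi1_continuous[OF srbm_path_input[OF assms]]) simp

lemma srbm_path_cadlag: "continuous_on {0..} b \<Longrightarrow> cadlag (srbm_path a \<theta> \<sigma> b)"
  by (rule continuous_on_imp_cadlag[OF srbm_path_continuous])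

lemma srbm_path_lipschitz:
  assumes b: "continuous_on {0..} b" "continuous_on {0..} b'" and t: "t \<ge> 0"
    and a: "\<bar>a - a'\<bar> \<le> e" and e': "\<And>s. 0 \<le> s \<Longrightarrow> s \<le> t \<Longrightarrow> \<bar>b s - b' s\<bar> \<le> e'"
  shows "\<bar>srbm_path a \<theta> \<sigma> b t - srbm_path a' \<theta> \<sigma> b' t\<bar> \<le> 2 * (e + \<bar>\<sigma>\<bar> * (2 * e'))"
  unfolding srbm_path_def
proof (rule Phi1_lipschitz[OF srbm_path_input[OF b(1)] _ srbm_path_input[OF b(2)] _ t])
  fix s assume s: "0 \<le> s" "s \<le> t"
  have "\<bar>(b s - b 0) - (b' s - b' 0)\<bar> \<le> 2 * e'" using e'[OF s] e'[of 0] t by linarith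
  then have "\<bar>\<sigma> * ((b s - b 0) - (b' s - b' 0))\<bar> \<le> \<bar>\<sigma>\<bar> * (2 * e')"
    unfolding abs_mult by (intro mult_left_mono) auto
  moreover have "\<bar>max 0 a - max 0 a'\<bar> \<le> e" using a by (cases "a \<ge> 0"; cases "a' \<ge> 0") auto
  moreover have "max 0 a + \<theta> * s + \<sigma> * (b s - b 0) - (max 0 a' + \<theta> * s + \<sigma> * (b' s - b' 0))
      = (max 0 a - max 0 a') + \<sigma> * ((b s - b 0) - (b' s - b' 0))" by (simp add: right_diff_distrib)
  ultimately show "\<bar>max 0 a + \<theta> * s + \<sigma> * (b s - b 0) - (max 0 a' + \<theta> * s + \<sigma> * (b' s - b' 0))\<bar>
      \<le> e + \<bar>\<sigma>\<bar> * (2 * e')" by (metis abs_triangle_ineq add_mono order_trans)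
qed auto

lemma srbm_path_limit:
  assumes B: "\<And>i. continuous_on {0..} (B i)" and b: "continuous_on {0..} b"
    and A: "(A \<longlongrightarrow> a) F" and lim: "\<And>T. T \<ge> 0 \<Longrightarrow> uniform_limit {0..T} B b F" and T: "T \<ge> 0"
  shows "uniform_limit {0..T} (\<lambda>i. srbm_path (A i) \<theta> \<sigma> (B i)) (srbm_path a \<theta> \<sigma> b) F"
  unfolding uniform_limit_iff
proof (intro allI impI)
  fix \<epsilon> :: real assume \<epsilon>: "\<epsilon> > 0"
  define e where "e = \<epsilon> / (4 * (1 + 2 * \<bar>\<sigma>\<bar>))"
  have pos: "1 + 2 * \<bar>\<sigma>\<bar> > 0" by (simp add: add_pos_nonneg)
  have e: "e > 0" using \<epsilon> pos by (simp add: e_def)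
  have e4: "4 * (1 + 2 * \<bar>\<sigma>\<bar>) * e = \<epsilon>" unfolding e_def using pos by (metis less_irrefl mult_pos_pos nonzero_mult_div_cancel_left times_divide_eq_right zero_less_numeral)
  have "\<forall>\<^sub>F i in F. dist (A i) a < e" using A e by (rule tendstoD)
  moreover have "\<forall>\<^sub>F i in F. \<forall>s\<in>{0..T}. dist (B i s) (b s) < e" using lim[OF T] e unfolding uniform_limit_iff by blast
  ultimately show "\<forall>\<^sub>F i in F. \<forall>t\<in>{0..T}. dist (srbm_path (A i) \<theta> \<sigma> (B i) t) (srbm_path a \<theta> \<sigma> b t) < \<epsilon>"
  proof eventually_elim
    case (elim i)
    show ?case
    proof
      fix t assume t: "t \<in> {0..T}"
      have "\<bar>srbm_path (A i) \<theta> \<sigma> (B i) t - srbm_path a \<theta> \<sigma> b t\<bar> \<le> 2 * (e + \<bar>\<sigma>\<bar> * (2 * e))"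
      proof (rule srbm_path_lipschitz[OF B b])
        show "0 \<le> t" using t by simp
        show "\<bar>A i - a\<bar> \<le> e" using elim(1) by (simp add: dist_real_def)
        fix s assume "0 \<le> s" "s \<le> t"
        then have "s \<in> {0..T}" using t by simp
        then have "dist (B i s) (b s) < e" using elim(2) by blast
        then show "\<bar>B i s - b s\<bar> \<le> e" by (simp add: dist_real_def)
      qed
      also have "2 * (e + \<bar>\<sigma>\<bar> * (2 * e)) = \<epsilon> / 2" using e4 by (simp add: algebra_simps)
      also have "\<dots> < \<epsilon>" using \<epsilon> by simp
      finally show "dist (srbm_path (A i) \<theta> \<sigma> (B i) t) (srbm_path a \<theta> \<sigma> b t) < \<epsilon>" by (simp add: dist_real_def)
    qed
  qed
qed

lemma srbm_path_measurable:
  assumes a: "a \<in> borel_measurable M" and c: "\<And>\<omega>. \<omega> \<in> space M \<Longrightarrow> continuous_on {0..} (b \<omega>)"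
    and m: "\<And>t. t \<ge> 0 \<Longrightarrow> (\<lambda>\<omega>. b \<omega> t) \<in> borel_measurable M"
  shows "(\<lambda>\<omega>. srbm_path (a \<omega>) \<theta> \<sigma> (b \<omega>)) \<in> measurable M (borel_of_topology path_topology)"
proof (rule path_measurable)
  show "continuous_on {0..} (srbm_path (a \<omega>) \<theta> \<sigma> (b \<omega>))" if "\<omega> \<in> space M" for \<omega>
    by (rule srbm_path_continuous[OF c[OF that]])
  fix t :: real assume t: "t \<ge> 0"
  let ?g = "\<lambda>\<omega> t. max 0 (a \<omega>) + \<theta> * t + \<sigma> * (b \<omega> t - b \<omega> 0)"
  have gm: "(\<lambda>\<omega>. ?g \<omega> t) \<in> borel_measurable M" if "t \<ge> 0" for t
    by (intro borel_measurable_add borel_measurable_times borel_measurable_diff borel_measurable_max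
        borel_measurable_const a m that order_refl)
  have "(\<lambda>\<omega>. runsup (\<lambda>s. - ?g \<omega> s) t) \<in> borel_measurable M"
  proof (rule runsup_measurable[OF _ _ t])
    show "continuous_on {0..} (\<lambda>s. - ?g \<omega> s)" if "\<omega> \<in> space M" for \<omega>
      by (rule continuous_on_minus[OF srbm_path_input[OF c[OF that]]])
    show "(\<lambda>\<omega>. - ?g \<omega> t) \<in> borel_measurable M" if "t \<ge> 0" for t
      by (rule borel_measurable_uminus[OF gm[OF that]])
  qed
  then have "(\<lambda>\<omega>. ?g \<omega> t + runsup (\<lambda>s. - ?g \<omega> s) t) \<in> borel_measurable M"
    by (rule borel_measurable_add[OF gm[OF t]])
  moreover have "srbm_path (a \<omega>) \<theta> \<sigma> (b \<omega>) t = ?g \<omega> t + runsup (\<lambda>s. - ?g \<omega> s) t" if "\<omega> \<in> space M" for \<omega>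
    unfolding srbm_path_def by (rule Phi1_eq[OF srbm_path_input[OF c[OF that]] _ t]) simp
  ultimately show "(\<lambda>\<omega>. srbm_path (a \<omega>) \<theta> \<sigma> (b \<omega>) t) \<in> borel_measurable M"
    by (subst measurable_cong) auto
qed

lemma sampled_process_element: "sampled n (\<lambda>t. process_element 1 W \<omega> (0, t)) = sampled n (\<lambda>t. W 0 t \<omega>)"
  unfolding sampled_def by (simp add: process_element_def)

context
  fixes f :: "(real \<Rightarrow> real) \<Rightarrow> real" and C \<theta> \<sigma> :: real
  assumes f: "continuous_map path_topology euclideanreal f" and C: "\<And>x. cadlag x \<Longrightarrow> \<bar>f x\<bar> \<le> C"
begin

lemma srbm_functional_measurable:
  assumes "a \<in> borel_measurable M" "\<And>\<omega>. \<omega> \<in> space M \<Longrightarrow> continuous_on {0..} (b \<omega>)"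
    and "\<And>t. t \<ge> 0 \<Longrightarrow> (\<lambda>\<omega>. b \<omega> t) \<in> borel_measurable M"
  shows "(\<lambda>\<omega>. f (srbm_path (a \<omega>) \<theta> \<sigma> (b \<omega>))) \<in> borel_measurable M"
  by (rule measurable_compose[OF srbm_path_measurable[OF assms] path_functional_measurable[OF f]])

lemma srbm_functional_limit:
  assumes "\<And>i. continuous_on {0..} (B i)" "continuous_on {0..} b" "(A \<longlongrightarrow> a) F"
    and "\<And>T. T \<ge> 0 \<Longrightarrow> uniform_limit {0..T} B b F"
  shows "((\<lambda>i. f (srbm_path (A i) \<theta> \<sigma> (B i))) \<longlongrightarrow> f (srbm_path a \<theta> \<sigma> b)) F"
  by (rule path_continuous_tendsto[OF f srbm_path_cadlag[OF assms(2)] srbm_path_cadlag[OF assms(1)]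
        srbm_path_limit[OF assms]])

lemma srbm_functional_bound: "continuous_on {0..} b \<Longrightarrow> \<bar>f (srbm_path a \<theta> \<sigma> b)\<bar> \<le> C"
  by (rule C[OF srbm_path_cadlag])

definition srbm_mean :: "'m measure \<Rightarrow> (nat \<Rightarrow> real \<Rightarrow> 'm \<Rightarrow> real) \<Rightarrow> real \<Rightarrow> real" where
  "srbm_mean M W a = (\<integral>\<omega>. f (srbm_path a \<theta> \<sigma> (\<lambda>t. W 0 t \<omega>)) \<partial>M)"

text \<open>
  Dominated convergence: the reflected path depends continuously on its initial state.
\<close>
lemma srbm_mean_continuous:
  assumes W: "std_brownian_motion M 1 W"
  shows "continuous_on UNIV (srbm_mean M W)" and "\<bar>srbm_mean M W a\<bar> \<le> C"
proof -
  interpret prob_space M by (rule std_bmD(1)[OF W])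
  have m: "(\<lambda>\<omega>. f (srbm_path a \<theta> \<sigma> (\<lambda>t. W 0 t \<omega>))) \<in> borel_measurable M" for a
    by (rule srbm_functional_measurable[OF borel_measurable_const bm_continuous[OF W]])
      (auto intro: std_bmD(2)[OF W])
  have bnd: "\<bar>f (srbm_path a \<theta> \<sigma> (\<lambda>t. W 0 t \<omega>))\<bar> \<le> C" if "\<omega> \<in> space M" for \<omega> a
    by (rule srbm_functional_bound[OF bm_continuous[OF W that]])
  have "continuous (at a) (srbm_mean M W)" for a
  proof (rule continuous_at_sequentiallyI)
    fix u :: "nat \<Rightarrow> real" assume u: "u \<longlonglongrightarrow> a"
    show "(\<lambda>n. srbm_mean M W (u n)) \<longlonglongrightarrow> srbm_mean M W a"
      unfolding srbm_mean_def
    proof (rule integral_dominated_convergence[where w = "\<lambda>_. C"])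
      show "AE \<omega> in M. (\<lambda>i. f (srbm_path (u i) \<theta> \<sigma> (\<lambda>t. W 0 t \<omega>))) \<longlonglongrightarrow> f (srbm_path a \<theta> \<sigma> (\<lambda>t. W 0 t \<omega>))"
      proof (rule AE_I2)
        fix \<omega> assume \<omega>: "\<omega> \<in> space M"
        show "(\<lambda>i. f (srbm_path (u i) \<theta> \<sigma> (\<lambda>t. W 0 t \<omega>))) \<longlonglongrightarrow> f (srbm_path a \<theta> \<sigma> (\<lambda>t. W 0 t \<omega>))"
          by (rule srbm_functional_limit[OF bm_continuous[OF W \<omega>] bm_continuous[OF W \<omega>] u])
            (simp add: uniform_limit_iff)
      qed
    qed (use m bnd in auto)
  qed
  then show "continuous_on UNIV (srbm_mean M W)" by (simp add: continuous_on_eq_continuous_at)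
  have "norm (srbm_mean M W a) \<le> (\<integral>\<omega>. norm (f (srbm_path a \<theta> \<sigma> (\<lambda>t. W 0 t \<omega>))) \<partial>M)"
    unfolding srbm_mean_def by (rule integral_norm_bound)
  also have "\<dots> \<le> (\<integral>\<omega>. C \<partial>M)"
    by (rule integral_mono) (use m bnd in \<open>auto intro!: integrable_const_bound[where B = C]\<close>)
  finally show "\<bar>srbm_mean M W a\<bar> \<le> C" by (simp add: prob_space)
qed

text \<open>
  A functional of the whole path is not obviously measurable on the product space, where the law
  of Brownian motion is known. For the piecewise linear interpolation it is, as finitely many
  times enter. For this functional the joint law of initial state and Brownian motion factorises,
  and Fubini's theorem together with uniqueness of the Brownian law gives the formula; then the
  mesh tends to 0 on both sides.
\<close>
theorem srbm_expectation:
  assumes W: "std_brownian_motion M 1 W" and W': "std_brownian_motion M' 1 W'"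
    and ind: "indep_elements M' borel x (process_space 1) (process_element 1 W')"
  shows "(\<integral>\<omega>. f (srbm_path (x \<omega>) \<theta> \<sigma> (\<lambda>t. W' 0 t \<omega>)) \<partial>M') = (\<integral>\<omega>. srbm_mean M W (x \<omega>) \<partial>M')"
proof -
  interpret M: prob_space M by (rule std_bmD(1)[OF W])
  interpret M': prob_space M' by (rule std_bmD(1)[OF W'])
  have x: "x \<in> borel_measurable M'" using ind unfolding indep_elements_def by simp
  note pm = process_element_measurable[OF W] and pm' = process_element_measurable[OF W']
  let ?ps = "process_space 1"
  define Q where "Q = distr M ?ps (process_element 1 W)"
  have Q': "distr M' ?ps (process_element 1 W') = Q" unfolding Q_def by (rule bm_law_unique[OF W' W])
  define P where "P = distr M' borel x"
  interpret Q: prob_space Q unfolding Q_def by (rule M.prob_space_distr[OF pm])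
  interpret P: prob_space P unfolding P_def by (rule M'.prob_space_distr[OF x])
  interpret PQ: pair_prob_space P Q ..
  have setsQ: "sets Q = sets ?ps" and setsP: "sets P = sets borel" by (simp_all add: Q_def P_def)
  \<comment> \<open>the functional of the interpolated path, as a function on the product space\<close>
  define F where "F = (\<lambda>n (p :: real \<times> (nat \<times> real \<Rightarrow> real)). f (srbm_path (fst p) \<theta> \<sigma> (sampled n (\<lambda>t. snd p (0, t)))))"
  have Fm: "F n \<in> borel_measurable (borel \<Otimes>\<^sub>M ?ps)" for n
    unfolding F_def
  proof (rule srbm_functional_measurable[OF measurable_fst sampled_continuous])
    fix t :: real assume "t \<ge> 0"
    show "(\<lambda>p. sampled n (\<lambda>t. snd p (0, t)) t) \<in> borel_measurable (borel \<Otimes>\<^sub>M ?ps)"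
      unfolding sampled_def interp_def
    proof (intro borel_measurable_sum borel_measurable_times borel_measurable_const)
      fix k
      have "(0, real k / real (Suc n)) \<in> {..<1::nat} \<times> {0..}" by simp
      then show "(\<lambda>p. snd p (0, real k / real (Suc n))) \<in> borel_measurable (borel \<Otimes>\<^sub>M ?ps)"
        by (rule measurable_compose[OF measurable_snd measurable_component_singleton])
    qed
  qed
  have FmPQ: "F n \<in> borel_measurable (P \<Otimes>\<^sub>M Q)" for n
    using Fm[of n] by (subst measurable_cong_sets[OF sets_pair_measure_cong[OF setsP setsQ] refl])
  have Fb: "\<bar>F n p\<bar> \<le> C" for n p
    unfolding F_def by (rule srbm_functional_bound[OF sampled_continuous])
  define H where "H = (\<lambda>n a. \<integral>w. F n (a, w) \<partial>Q)"
  have lim: "(\<lambda>n. f (srbm_path a \<theta> \<sigma> (sampled n b))) \<longlonglongrightarrow> f (srbm_path a \<theta> \<sigma> b)"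
    if "continuous_on {0..} b" for a b
    by (rule srbm_functional_limit[OF sampled_continuous that tendsto_const sampled_limit[OF that]])
  have mW: "(\<lambda>\<omega>. f (srbm_path a \<theta> \<sigma> (\<lambda>t. W 0 t \<omega>))) \<in> borel_measurable M" for a
    by (rule srbm_functional_measurable[OF borel_measurable_const bm_continuous[OF W]])
      (auto intro: std_bmD(2)[OF W])
  have mW': "(\<lambda>\<omega>. f (srbm_path (x \<omega>) \<theta> \<sigma> (\<lambda>t. W' 0 t \<omega>))) \<in> borel_measurable M'"
    by (rule srbm_functional_measurable[OF x bm_continuous[OF W']])
      (auto intro: std_bmD(2)[OF W'])
  have Fam: "(\<lambda>w. F n (a, w)) \<in> borel_measurable ?ps" for n a
    using measurable_compose[OF measurable_Pair1' Fm, of a] by simp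
  have Hlim: "(\<lambda>n. H n a) \<longlonglongrightarrow> srbm_mean M W a" for a
  proof -
    have H: "H n a = (\<integral>\<omega>. F n (a, process_element 1 W \<omega>) \<partial>M)" for n
      unfolding H_def Q_def by (rule integral_distr[OF pm Fam])
    show ?thesis unfolding H srbm_mean_def
    proof (rule integral_dominated_convergence[where w = "\<lambda>_. C"])
      show "AE \<omega> in M. (\<lambda>n. F n (a, process_element 1 W \<omega>)) \<longlonglongrightarrow> f (srbm_path a \<theta> \<sigma> (\<lambda>t. W 0 t \<omega>))"
        by (rule AE_I2) (simp only: F_def fst_conv snd_conv sampled_process_element lim[OF bm_continuous[OF W]])
      show "(\<lambda>\<omega>. F n (a, process_element 1 W \<omega>)) \<in> borel_measurable M" for n
        by (rule measurable_compose[OF pm Fam])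
      show "AE \<omega> in M. norm (F n (a, process_element 1 W \<omega>)) \<le> C" for n using Fb by simp
    qed (use mW in auto)
  qed
  have Hm: "H n \<in> borel_measurable borel" for n
  proof -
    have "H n \<in> borel_measurable P"
      unfolding H_def by (rule Q.borel_measurable_lebesgue_integral) (simp add: FmPQ)
    then show ?thesis by (subst (asm) measurable_cong_sets[OF setsP refl])
  qed
  have Hb: "\<bar>H n a\<bar> \<le> C" for n a
  proof -
    have "norm (H n a) \<le> (\<integral>w. norm (F n (a, w)) \<partial>Q)" unfolding H_def by (rule integral_norm_bound)
    also have "\<dots> \<le> (\<integral>w. C \<partial>Q)"
    proof (rule integral_mono)
      have "(\<lambda>w. F n (a, w)) \<in> borel_measurable Q"
        using Fam by (subst measurable_cong_sets[OF setsQ refl])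
      then show "integrable Q (\<lambda>w. norm (F n (a, w)))"
        using Fb by (intro integrable_norm Q.integrable_const_bound[where B = C]) auto
    qed (use Fb in auto)
    finally show ?thesis by (simp add: Q.prob_space)
  qed
  have pair: "(\<lambda>\<omega>. (x \<omega>, process_element 1 W' \<omega>)) \<in> measurable M' (borel \<Otimes>\<^sub>M ?ps)"
    by (rule measurable_Pair[OF x pm'])
  have eq: "(\<integral>\<omega>. F n (x \<omega>, process_element 1 W' \<omega>) \<partial>M') = (\<integral>\<omega>. H n (x \<omega>) \<partial>M')" for n
  proof -
    have "(\<integral>\<omega>. F n (x \<omega>, process_element 1 W' \<omega>) \<partial>M')
        = (\<integral>p. F n p \<partial>distr M' (borel \<Otimes>\<^sub>M ?ps) (\<lambda>\<omega>. (x \<omega>, process_element 1 W' \<omega>)))"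
      by (rule integral_distr[OF pair Fm, symmetric])
    also have "\<dots> = (\<integral>p. F n p \<partial>(P \<Otimes>\<^sub>M Q))"
      unfolding indep_elements_distr[OF ind M'.prob_space_axioms] Q' P_def ..
    also have "\<dots> = (\<integral>a. H n a \<partial>P)"
    proof -
      have "integrable (P \<Otimes>\<^sub>M Q) (F n)"
        by (rule PQ.integrable_const_bound[where B = C]) (use Fb FmPQ in auto)
      from PQ.integral_fst'[OF this] show ?thesis by (simp add: H_def)
    qed
    also have "\<dots> = (\<integral>\<omega>. H n (x \<omega>) \<partial>M')"
      unfolding P_def by (rule integral_distr[OF x Hm])
    finally show ?thesis .
  qed
  have lim1: "(\<lambda>n. \<integral>\<omega>. F n (x \<omega>, process_element 1 W' \<omega>) \<partial>M')
      \<longlonglongrightarrow> (\<integral>\<omega>. f (srbm_path (x \<omega>) \<theta> \<sigma> (\<lambda>t. W' 0 t \<omega>)) \<partial>M')"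
  proof (rule integral_dominated_convergence[where w = "\<lambda>_. C"])
    show "AE \<omega> in M'. (\<lambda>n. F n (x \<omega>, process_element 1 W' \<omega>)) \<longlonglongrightarrow> f (srbm_path (x \<omega>) \<theta> \<sigma> (\<lambda>t. W' 0 t \<omega>))"
      by (rule AE_I2) (simp only: F_def fst_conv snd_conv sampled_process_element lim[OF bm_continuous[OF W']])
    show "(\<lambda>\<omega>. F n (x \<omega>, process_element 1 W' \<omega>)) \<in> borel_measurable M'" for n
      by (rule measurable_compose[OF pair Fm])
    show "AE \<omega> in M'. norm (F n (x \<omega>, process_element 1 W' \<omega>)) \<le> C" for n using Fb by simp
  qed (use mW' in auto)
  have lim2: "(\<lambda>n. \<integral>\<omega>. H n (x \<omega>) \<partial>M') \<longlonglongrightarrow> (\<integral>\<omega>. srbm_mean M W (x \<omega>) \<partial>M')"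
  proof (rule integral_dominated_convergence[where w = "\<lambda>_. C"])
    show "AE \<omega> in M'. (\<lambda>n. H n (x \<omega>)) \<longlonglongrightarrow> srbm_mean M W (x \<omega>)" using Hlim by simp
    show "(\<lambda>\<omega>. H n (x \<omega>)) \<in> borel_measurable M'" for n by (rule measurable_compose[OF x Hm])
    show "AE \<omega> in M'. norm (H n (x \<omega>)) \<le> C" for n using Hb by simp
    show "(\<lambda>\<omega>. srbm_mean M W (x \<omega>)) \<in> borel_measurable M'"
      by (rule measurable_compose[OF x borel_measurable_continuous_onI[OF srbm_mean_continuous(1)[OF W]]])
  qed auto
  show ?thesis using LIMSEQ_unique[OF lim1[unfolded eq] lim2] .
qed

end

text \<open>
  Arzela-Ascoli on the half-line. A subsequence converges at all rational times; dividing by the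
  bounds \<open>D\<close> makes the values uniformly bounded over all these times at once. The
  common moduli of continuity upgrade this to uniform convergence on every \<open>[0, T]\<close>.
\<close>
lemma modulus_compact:
  fixes b :: "nat \<Rightarrow> real \<Rightarrow> real"
  assumes c: "\<And>i. continuous_on {0..} (b i)"
    and ok: "\<And>i m. modulus_ok (real m) (1 / real (Suc m)) (ns m) (b i)"
  obtains k \<beta> where "strict_mono (k :: nat \<Rightarrow> nat)" "continuous_on {0..} \<beta>"
    "\<And>T. T \<ge> 0 \<Longrightarrow> uniform_limit {0..T} (\<lambda>i. b (k i)) \<beta> sequentially"
proof -
  define D where "D = (\<lambda>x::real. 1 + real (ns (nat \<lceil>x\<rceil>)))"
  have D: "D x > 0" for x by (simp add: D_def add_pos_nonneg)
  have "norm (b n x / D x) \<le> 1" if "x \<in> \<rat> \<inter> {0..}" for n x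
  proof -
    have "x \<in> {0..real (nat \<lceil>x\<rceil>)}" using that real_nat_ceiling_ge[of x] by simp
    then have "\<bar>b n x\<bar> \<le> real (ns (nat \<lceil>x\<rceil>))" using ok[of "nat \<lceil>x\<rceil>" n] unfolding modulus_ok_def by blast
    then have "\<bar>b n x\<bar> \<le> D x" by (simp add: D_def)
    then show ?thesis using D[of x] by (simp add: abs_divide)
  qed
  from function_convergent_subsequence[of "\<rat> \<inter> {0..}" "\<lambda>n x. b n x / D x" 1, OF countable_Int1[OF countable_rat] this]
  obtain k where k: "strict_mono (k::nat\<Rightarrow>nat)"
    and conv: "\<And>x. x \<in> \<rat> \<inter> {0..} \<Longrightarrow> \<exists>l. (\<lambda>n. b (k n) x / D x) \<longlonglongrightarrow> l"
    by blast
  have conv': "Cauchy (\<lambda>n. b (k n) x)" if xD: "x \<in> \<rat> \<inter> {0..}" for x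
  proof -
    obtain l where "(\<lambda>n. b (k n) x / D x) \<longlonglongrightarrow> l" using conv[OF xD] by blast
    from tendsto_mult[OF this tendsto_const[of "D x"]] have "(\<lambda>n. b (k n) x / D x * D x) \<longlonglongrightarrow> l * D x" .
    then have "(\<lambda>n. b (k n) x) \<longlonglongrightarrow> l * D x" using D[of x] by simp
    then show ?thesis by (rule LIMSEQ_imp_Cauchy)
  qed
  define \<beta> where "\<beta> = (\<lambda>x. lim (\<lambda>n. b (k n) x))"
  have unif: "uniform_limit {0..T} (\<lambda>i. b (k i)) \<beta> sequentially" if T: "T \<ge> 0" for T
  proof -
    have "uniformly_Cauchy_on {0..T} (\<lambda>i. b (k i))"
      unfolding uniformly_Cauchy_on_def
    proof (intro allI impI)
      fix e :: real assume e: "e > 0"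
      then have "e / 4 > 0" by simp
      then obtain m1 where m1: "1 / real (Suc m1) < e / 4" using nat_approx_posE by blast
      define m where "m = max m1 (nat \<lceil>T\<rceil>)"
      have "1 / real (Suc m) \<le> 1 / real (Suc m1)" by (intro divide_left_mono) (auto simp: m_def)
      then have me: "1 / real (Suc m) < e / 4" using m1 by simp
      have mT: "T \<le> real m" using real_nat_ceiling_ge[of T] by (auto simp: m_def)
      define N where "N = Suc (ns m)"
      define K where "K = nat \<lfloor>T * real N\<rfloor>"
      let ?p = "\<lambda>i::nat. real i / real N"
      have Npos: "real N > 0" by (simp add: N_def)
      have rat: "?p i \<in> \<rat> \<inter> {0..}" for i by simp
      have "\<forall>i\<in>{..K}. \<exists>M0. \<forall>n\<ge>M0. \<forall>n'\<ge>M0. \<bar>b (k n) (?p i) - b (k n') (?p i)\<bar> < e / 4"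
        using conv'[OF rat] \<open>e / 4 > 0\<close> unfolding Cauchy_def dist_real_def by blast
      then obtain M0 where M0: "\<And>i n n'. i \<in> {..K} \<Longrightarrow> n \<ge> M0 i \<Longrightarrow> n' \<ge> M0 i \<Longrightarrow>
          \<bar>b (k n) (?p i) - b (k n') (?p i)\<bar> < e / 4"
        by metis
      define M1 where "M1 = Max (M0 ` {..K})"
      have M1: "M0 i \<le> M1" if "i \<in> {..K}" for i unfolding M1_def using that by (intro Max_ge) auto
      show "\<exists>M. \<forall>x\<in>{0..T}. \<forall>n\<ge>M. \<forall>n'\<ge>M. dist (b (k n) x) (b (k n') x) < e"
      proof (intro exI[of _ M1] ballI allI impI)
        fix x n n' assume x: "x \<in> {0..T}" and n: "M1 \<le> n" "M1 \<le> n'"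
        define i where "i = nat \<lfloor>x * real N\<rfloor>"
        have xN: "0 \<le> x * real N" using x by simp
        have i: "real i \<le> x * real N" "x * real N < real i + 1"
          unfolding i_def using xN by linarith+
        have "x * real N \<le> T * real N" using x Npos by (intro mult_right_mono) auto
        then have "i \<in> {..K}" unfolding i_def K_def by (auto intro!: nat_mono floor_mono)
        have px: "?p i \<le> x" using i(1) Npos by (simp add: divide_le_eq)
        have "x < (real i + 1) / real N" using i(2) Npos by (simp add: less_divide_eq)
        then have "x - ?p i < 1 / real N" by (simp add: add_divide_distrib)
        then have d: "\<bar>x - ?p i\<bar> < 1 / real (Suc (ns m))" using px by (simp add: N_def)
        have xm: "x \<in> {0..real m}" "?p i \<in> {0..real m}" using x mT px by auto
        have osc: "\<bar>b j x - b j (?p i)\<bar> \<le> 1 / real (Suc m)" for j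
          using ok[of m j] xm d unfolding modulus_ok_def by blast
        have "\<bar>b (k n) (?p i) - b (k n') (?p i)\<bar> < e / 4"
          using M0[OF \<open>i \<in> {..K}\<close>] M1[OF \<open>i \<in> {..K}\<close>] n by (meson order_trans)
        then show "dist (b (k n) x) (b (k n') x) < e"
          using osc[of "k n"] osc[of "k n'"] me unfolding dist_real_def by linarith
      qed
    qed
    from Cauchy_uniformly_convergent[OF this] show ?thesis
      unfolding uniformly_convergent_uniform_limit_iff \<beta>_def .
  qed
  have "continuous_on {0..} \<beta>"
  proof (rule continuous_on_halfline_glue)
    fix T :: real assume T: "T \<ge> 0"
    have "continuous_on {0..T} (b (k i))" for i using c[of "k i"] by (rule continuous_on_subset) auto
    then show "continuous_on {0..T} \<beta>"
      by (intro uniform_limit_theorem[OF _ unif[OF T]] always_eventually allI) auto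
  qed
  then show thesis using that[OF k _ unif] by blast
qed

text \<open>
  A functional that is continuous at every path is uniformly continuous near a compact set of
  paths. If this failed, a sequence of counterexamples would have a convergent subsequence, at
  whose limit the functional would be discontinuous.
\<close>
lemma path_functional_uniform:
  fixes ns :: "nat \<Rightarrow> nat"
  assumes f: "continuous_map path_topology euclideanreal f" and \<eta>: "\<eta> > 0"
  obtains T \<delta> where "\<delta> > 0" "T \<ge> 0"
    "\<And>a b y. \<bar>a\<bar> \<le> A \<Longrightarrow> continuous_on {0..} b \<Longrightarrow>
      (\<And>m. modulus_ok (real m) (1 / real (Suc m)) (ns m) b) \<Longrightarrow> cadlag y \<Longrightarrow>
      (\<And>t. 0 \<le> t \<Longrightarrow> t \<le> T \<Longrightarrow> \<bar>y t - srbm_path a \<theta> \<sigma> b t\<bar> < \<delta>) \<Longrightarrow>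
      \<bar>f y - f (srbm_path a \<theta> \<sigma> b)\<bar> < \<eta>"
proof (rule ccontr)
  assume neg: "\<not> thesis"
  define Bad where "Bad = (\<lambda>n a b y. \<bar>a\<bar> \<le> A \<and> continuous_on {0..} b \<and>
      (\<forall>m. modulus_ok (real m) (1 / real (Suc m)) (ns m) b) \<and> cadlag y \<and>
      (\<forall>t. 0 \<le> t \<longrightarrow> t \<le> real n \<longrightarrow> \<bar>y t - srbm_path a \<theta> \<sigma> b t\<bar> < 1 / real (Suc n)) \<and>
      \<not> \<bar>f y - f (srbm_path a \<theta> \<sigma> b)\<bar> < \<eta>)"
  have "\<exists>a b y. Bad n a b y" for n
  proof (rule ccontr)
    assume no: "\<nexists>a b y. Bad n a b y"
    have thesis
    proof (rule that[of "1 / real (Suc n)" "real n"])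
      fix a b y
      assume "\<bar>a\<bar> \<le> A" "continuous_on {0..} b" "\<And>m. modulus_ok (real m) (1 / real (Suc m)) (ns m) b" "cadlag y"
        "\<And>t. 0 \<le> t \<Longrightarrow> t \<le> real n \<Longrightarrow> \<bar>y t - srbm_path a \<theta> \<sigma> b t\<bar> < 1 / real (Suc n)"
      moreover have "\<not> Bad n a b y" using no by blast
      ultimately show "\<bar>f y - f (srbm_path a \<theta> \<sigma> b)\<bar> < \<eta>" unfolding Bad_def by blast
    qed auto
    then show False using neg by contradiction
  qed
  then obtain a b y where bad: "\<And>n. Bad n (a n) (b n) (y n)" by metis
  have a: "\<bar>a n\<bar> \<le> A" and b: "continuous_on {0..} (b n)"
    and ok: "modulus_ok (real m) (1 / real (Suc m)) (ns m) (b n)" and y: "cadlag (y n)"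
    and far: "\<not> \<bar>f (y n) - f (srbm_path (a n) \<theta> \<sigma> (b n))\<bar> < \<eta>" for n m
    using bad[of n] unfolding Bad_def by blast+
  have close: "\<bar>y n t - srbm_path (a n) \<theta> \<sigma> (b n) t\<bar> < 1 / real (Suc n)" if "0 \<le> t" "t \<le> real n" for n t
    using bad[of n] that unfolding Bad_def by blast
  obtain k \<beta> where k: "strict_mono (k :: nat \<Rightarrow> nat)" and \<beta>: "continuous_on {0..} \<beta>"
    and unif: "\<And>T. T \<ge> 0 \<Longrightarrow> uniform_limit {0..T} (\<lambda>i. b (k i)) \<beta> sequentially"
    by (rule modulus_compact[OF b ok]) (rule that)
  have "a (k i) \<in> {-A..A}" for i using a[of "k i"] by auto
  then have "\<forall>i. (a \<circ> k) i \<in> {-A..A}" by simp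
  moreover have "seq_compact {-A..A}" by (rule compact_imp_seq_compact) simp
  ultimately obtain \<alpha> k' where k': "strict_mono (k' :: nat \<Rightarrow> nat)" and \<alpha>: "((a \<circ> k) \<circ> k') \<longlonglongrightarrow> \<alpha>"
    unfolding seq_compact_def by blast
  define r where "r = (\<lambda>i. k (k' i))"
  have r: "strict_mono r" using strict_mono_o[OF k k'] by (simp add: r_def o_def)
  have ri: "r i \<ge> i" for i using strict_mono_imp_increasing[OF r] .
  have unif': "uniform_limit {0..T} (\<lambda>i. b (r i)) \<beta> sequentially" if "T \<ge> 0" for T
    unfolding r_def by (rule filterlim_compose[OF unif[OF that] filterlim_subseq[OF k']])
  have \<alpha>': "(\<lambda>i. a (r i)) \<longlonglongrightarrow> \<alpha>" using \<alpha> by (simp add: r_def o_def)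
  let ?p = "srbm_path \<alpha> \<theta> \<sigma> \<beta>"
  have plim: "uniform_limit {0..T} (\<lambda>i. srbm_path (a (r i)) \<theta> \<sigma> (b (r i))) ?p sequentially" if "T \<ge> 0" for T
    by (rule srbm_path_limit[OF b \<beta> \<alpha>' unif' that])
  have ylim: "uniform_limit {0..T} (\<lambda>i. y (r i)) ?p sequentially" if T: "T \<ge> 0" for T
    unfolding uniform_limit_iff
  proof (intro allI impI)
    fix e :: real assume "e > 0"
    then have e: "e / 2 > 0" by simp
    obtain n1 where n1: "1 / real (Suc n1) < e / 2" using e nat_approx_posE by blast
    have "\<forall>\<^sub>F i in sequentially. i \<ge> max n1 (nat \<lceil>T\<rceil>)" by (rule eventually_ge_at_top)
    moreover have "\<forall>\<^sub>F i in sequentially. \<forall>t\<in>{0..T}. dist (srbm_path (a (r i)) \<theta> \<sigma> (b (r i)) t) (?p t) < e / 2"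
      using plim[OF T] e unfolding uniform_limit_iff by blast
    ultimately show "\<forall>\<^sub>F i in sequentially. \<forall>t\<in>{0..T}. dist (y (r i) t) (?p t) < e"
    proof eventually_elim
      case (elim i)
      show ?case
      proof
        fix t assume t: "t \<in> {0..T}"
        have "real (nat \<lceil>T\<rceil>) \<le> real (r i)" using elim(1) ri[of i] by simp
        moreover have "t \<le> T" "T \<le> real (nat \<lceil>T\<rceil>)" using t real_nat_ceiling_ge[of T] by auto
        ultimately have "t \<le> real (r i)" by linarith
        then have "\<bar>y (r i) t - srbm_path (a (r i)) \<theta> \<sigma> (b (r i)) t\<bar> < 1 / real (Suc (r i))" using close t by simp
        moreover have "1 / real (Suc (r i)) \<le> 1 / real (Suc n1)"
          using elim(1) ri[of i] by (intro divide_left_mono) auto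
        moreover have "dist (srbm_path (a (r i)) \<theta> \<sigma> (b (r i)) t) (?p t) < e / 2" using elim(2) t by blast
        ultimately show "dist (y (r i) t) (?p t) < e" using n1 unfolding dist_real_def by linarith
      qed
    qed
  qed
  have l1: "(\<lambda>i. f (y (r i))) \<longlonglongrightarrow> f ?p"
    by (rule path_continuous_tendsto[OF f srbm_path_cadlag[OF \<beta>] y ylim])
  have l2: "(\<lambda>i. f (srbm_path (a (r i)) \<theta> \<sigma> (b (r i)))) \<longlonglongrightarrow> f ?p"
    by (rule path_continuous_tendsto[OF f srbm_path_cadlag[OF \<beta>] srbm_path_cadlag[OF b] plim])
  have "(\<lambda>i. \<bar>f (y (r i)) - f (srbm_path (a (r i)) \<theta> \<sigma> (b (r i)))\<bar>) \<longlonglongrightarrow> \<bar>f ?p - f ?p\<bar>"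
    by (intro tendsto_rabs tendsto_diff l1 l2)
  then have "\<forall>\<^sub>F i in sequentially. \<bar>f (y (r i)) - f (srbm_path (a (r i)) \<theta> \<sigma> (b (r i)))\<bar> < \<eta>"
    by (rule order_tendstoD) (use \<eta> in simp)
  then show False using far unfolding eventually_sequentially by blast
qed

section \<open>Pathwise separation of time scales\<close>

lemma reflected_scale:
  assumes r: "reflected d R x z y" and g: "g > 0"
  shows "reflected d R (\<lambda>j t. g * x j (t / g\<^sup>2)) (\<lambda>j t. g * z j (t / g\<^sup>2)) (\<lambda>j t. g * y j (t / g\<^sup>2))"
  unfolding reflected_def
proof (intro allI impI conjI)
  fix j assume j: "j < d"
  note rj = reflectedD[OF r j]
  have nn: "t / g\<^sup>2 \<ge> 0" if "t \<ge> 0" for t using that by simp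
  show "0 \<le> g * z j (t / g\<^sup>2)" if "0 \<le> t" for t using rj(1)[OF nn[OF that]] g by simp
  show "g * z j (t / g\<^sup>2) = g * x j (t / g\<^sup>2) + (\<Sum>k<d. R j k * (g * y k (t / g\<^sup>2)))" if "0 \<le> t" for t
    unfolding rj(2)[OF nn[OF that]] by (simp add: distrib_left sum_distrib_left mult.left_commute)
  show "mono_on {0..} (\<lambda>t. g * y j (t / g\<^sup>2))"
  proof (rule mono_onI)
    fix s t :: real assume "s \<in> {0..}" "t \<in> {0..}" "s \<le> t"
    then have "y j (s / g\<^sup>2) \<le> y j (t / g\<^sup>2)" by (intro rj(3) nn divide_right_mono) auto
    then show "g * y j (s / g\<^sup>2) \<le> g * y j (t / g\<^sup>2)" using g by simp
  qed
  show "g * y j (0 / g\<^sup>2) = 0" using rj(4) by simp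
  fix t e :: real assume t: "0 \<le> t" and e: "0 < e"
  have "e / g > 0" using e g by simp
  from rj(6)[OF nn[OF t] this] obtain s where s: "s \<in> {0..t / g\<^sup>2}" "s = 0 \<or> z j s < e / g" "y j (t / g\<^sup>2) < y j s + e / g"
    by blast
  have eq: "(s * g\<^sup>2) / g\<^sup>2 = s" using g by simp
  have "s * g\<^sup>2 \<le> t" using s(1) g by (simp add: pos_le_divide_eq)
  then have "s * g\<^sup>2 \<in> {0..t}" using s(1) by simp
  moreover have "s * g\<^sup>2 = 0 \<or> g * z j (s * g\<^sup>2 / g\<^sup>2) < e"
    unfolding eq using s(2) g by (auto simp: pos_less_divide_eq mult.commute)
  moreover have "g * y j (t / g\<^sup>2) < g * y j (s * g\<^sup>2 / g\<^sup>2) + e"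
  proof -
    have "g * y j (t / g\<^sup>2) < g * (y j s + e / g)" using s(3) g by simp
    then show ?thesis unfolding eq using g by (simp add: distrib_left)
  qed
  ultimately show "\<exists>s\<in>{0..t}. (s = 0 \<or> g * z j (s / g\<^sup>2) < e) \<and> g * y j (t / g\<^sup>2) < g * y j (s / g\<^sup>2) + e"
    by blast
qed

lemma reflected_cong:
  assumes "reflected d R x z y" "\<And>j t. j < d \<Longrightarrow> t \<ge> 0 \<Longrightarrow> x j t = x' j t"
  shows "reflected d R x' z y"
  unfolding reflected_def
proof (intro allI impI conjI)
  fix j assume j: "j < d"
  note r = reflectedD[OF assms(1) j]
  show "0 \<le> z j t" if "0 \<le> t" for t using r(1)[OF that] .
  show "z j t = x' j t + (\<Sum>k<d. R j k * y k t)" if "0 \<le> t" for t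
    using r(2)[OF that] assms(2)[OF j that] by simp
  show "mono_on {0..} (y j)" by (rule mono_onI) (simp add: r(3))
  show "y j 0 = 0" by (rule r(4))
  show "\<exists>s\<in>{0..t}. (s = 0 \<or> z j s < e) \<and> y j t < y j s + e" if "0 \<le> t" "0 < e" for t e
    using r(6)[OF that] .
qed

context
  fixes d :: nat and R :: "real mat" and z0 c :: "nat \<Rightarrow> real" and b z y :: "nat \<Rightarrow> real \<Rightarrow> real" and T :: real
  assumes M: "nonsingular_M d (\<lambda>i j. R $$ (i, j))" and R: "R \<in> carrier_mat d d"
    and refl: "reflected d (\<lambda>i j. R $$ (i, j)) (\<lambda>j t. z0 j + b j t - (\<Sum>i<d. R $$ (j, i) * c i) * t) z y"
    and c: "\<And>i. i < d \<Longrightarrow> c i \<ge> 0" and z0: "\<And>i. i < d \<Longrightarrow> z0 i \<ge> 0"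
    and b0: "\<And>i. i < d \<Longrightarrow> b i 0 = 0"
begin

text \<open>
  Minimality with the competitor \<open>y'\<^sub>i t = c\<^sub>i t + \<beta> a\<^sub>i\<close> for
  \<open>i \<le> k\<close> and \<open>y'\<^sub>i = 0\<close> for \<open>i > k\<close>. For
  \<open>i \<le> k\<close> the choice \<open>R a = 1\<close> compensates the noise; for \<open>i >
  k\<close> the large initial state pays for the noise, for the push from the coordinates up to
  \<open>k\<close> and for the own drift.
\<close>
lemma slow_coordinates_free:
  assumes k: "k < d" and a: "\<And>i. a i \<ge> 0" "\<And>i. i < Suc k \<Longrightarrow> (\<Sum>j<Suc k. R $$ (i, j) * a j) = 1"
    and \<beta>: "\<beta> \<ge> 0" "\<And>i t. i < d \<Longrightarrow> 0 \<le> t \<Longrightarrow> t \<le> T \<Longrightarrow> \<bar>b i t\<bar> \<le> \<beta>"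
    and large: "\<And>j. k < j \<Longrightarrow> j < d \<Longrightarrow> z0 j \<ge> \<beta> + \<beta> * (\<Sum>i<Suc k. \<bar>R $$ (j, i)\<bar> * a i) + \<bar>R $$ (j, j)\<bar> * c j * T"
    and j: "k < j" "j < d" and t: "0 \<le> t" "t \<le> T"
  shows "y j t = 0"
proof -
  define y' where "y' = (\<lambda>i t. if i < Suc k then c i * t + \<beta> * a i else 0)"
  have off: "R $$ (i, j) \<le> 0" if "i < d" "j < d" "i \<noteq> j" for i j
    using M that unfolding nonsingular_M_def by auto
  have "y j t \<le> y' j t"
  proof (rule reflected_minimal[OF M refl _ _ _ j(2) t])
    show "y' i s \<le> y' i t" if "i < d" "0 \<le> s" "s \<le> t" for i s t
      using that c[of i] by (auto simp: y'_def mult_left_mono)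
    show "y' i 0 \<ge> 0" for i using a(1)[of i] \<beta>(1) by (simp add: y'_def)
    fix i t assume i: "i < d" and t: "0 \<le> t" "t \<le> T"
    have split: "(\<Sum>m<d. h m) = (\<Sum>m<Suc k. h m) + (\<Sum>m=Suc k..<d. h m)" for h :: "nat \<Rightarrow> real"
      using k by (simp only: lessThan_atLeast0 sum.atLeastLessThan_concat)
    have s1: "(\<Sum>m<d. R $$ (i, m) * y' m t) = (\<Sum>m<Suc k. R $$ (i, m) * c m) * t + \<beta> * (\<Sum>m<Suc k. R $$ (i, m) * a m)"
    proof -
      have "(\<Sum>m=Suc k..<d. R $$ (i, m) * y' m t) = 0" by (rule sum.neutral) (simp add: y'_def)
      moreover have "(\<Sum>m<Suc k. R $$ (i, m) * y' m t) = (\<Sum>m<Suc k. R $$ (i, m) * c m * t + \<beta> * (R $$ (i, m) * a m))"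
        by (rule sum.cong) (auto simp: y'_def algebra_simps)
      ultimately show ?thesis unfolding split[of "\<lambda>m. R $$ (i, m) * y' m t"]
        by (simp only: sum.distrib sum_distrib_left sum_distrib_right add_0_right)
    qed
    define S where "S = (\<Sum>m=Suc k..<d. R $$ (i, m) * c m)"
    have eq: "z0 i + b i t - (\<Sum>m<d. R $$ (i, m) * c m) * t + (\<Sum>m<d. R $$ (i, m) * y' m t)
        = z0 i + b i t + \<beta> * (\<Sum>m<Suc k. R $$ (i, m) * a m) - S * t"
      unfolding s1 split[of "\<lambda>m. R $$ (i, m) * c m"] S_def[symmetric] by (simp only: algebra_simps)
    have bi: "b i t \<ge> - \<beta>" using \<beta>(2)[OF i t] by linarith
    have "0 \<le> z0 i + b i t + \<beta> * (\<Sum>m<Suc k. R $$ (i, m) * a m) - S * t"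
    proof (cases "i < Suc k")
      case True
      have "S \<le> 0" unfolding S_def using True i c off by (intro sum_nonpos mult_nonpos_nonneg) auto
      then have "S * t \<le> 0" using t by (simp add: mult_nonpos_nonneg)
      then show ?thesis using a(2)[OF True] z0[OF i] bi by simp
    next
      case False
      then have ki: "k < i" by simp
      have "S = R $$ (i, i) * c i + (\<Sum>m\<in>{Suc k..<d} - {i}. R $$ (i, m) * c m)"
        unfolding S_def using ki i by (intro sum.remove) auto
      moreover have "(\<Sum>m\<in>{Suc k..<d} - {i}. R $$ (i, m) * c m) \<le> 0"
        using i c off by (intro sum_nonpos mult_nonpos_nonneg) auto
      moreover have "R $$ (i, i) * c i \<le> \<bar>R $$ (i, i)\<bar> * c i" using c[OF i] by (intro mult_right_mono) auto
      ultimately have "S \<le> \<bar>R $$ (i, i)\<bar> * c i" by linarith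
      then have "S * t \<le> \<bar>R $$ (i, i)\<bar> * c i * t" using t by (intro mult_right_mono)
      also have "\<dots> \<le> \<bar>R $$ (i, i)\<bar> * c i * T" using t c[OF i] by (intro mult_left_mono mult_nonneg_nonneg) auto
      finally have St: "S * t \<le> \<bar>R $$ (i, i)\<bar> * c i * T" .
      have "(\<Sum>m<Suc k. - (\<bar>R $$ (i, m)\<bar> * a m)) \<le> (\<Sum>m<Suc k. R $$ (i, m) * a m)"
      proof (rule sum_mono)
        fix m
        have "- \<bar>R $$ (i, m)\<bar> * a m \<le> R $$ (i, m) * a m" using a(1)[of m] by (intro mult_right_mono) auto
        then show "- (\<bar>R $$ (i, m)\<bar> * a m) \<le> R $$ (i, m) * a m" by simp
      qed
      then have "- (\<Sum>m<Suc k. \<bar>R $$ (i, m)\<bar> * a m) \<le> (\<Sum>m<Suc k. R $$ (i, m) * a m)"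
        unfolding sum_negf .
      then have "\<beta> * - (\<Sum>m<Suc k. \<bar>R $$ (i, m)\<bar> * a m) \<le> \<beta> * (\<Sum>m<Suc k. R $$ (i, m) * a m)"
        using \<beta>(1) by (rule mult_left_mono)
      then have "- (\<beta> * (\<Sum>m<Suc k. \<bar>R $$ (i, m)\<bar> * a m)) \<le> \<beta> * (\<Sum>m<Suc k. R $$ (i, m) * a m)"
        unfolding mult_minus_right .
      then show ?thesis using large[OF ki i] St bi by linarith
    qed
    then show "0 \<le> z0 i + b i t - (\<Sum>m<d. R $$ (i, m) * c m) * t + (\<Sum>m<d. R $$ (i, m) * y' m t)"
      unfolding eq .
  qed
  also have "y' j t = 0" using j by (simp add: y'_def)
  finally show ?thesis using reflectedD(5)[OF refl j(2) t(1)] by linarith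
qed

context
  fixes i :: nat assumes i: "i < d"
begin

private abbreviation (input) "u \<equiv> \<lambda>l. u_vec d R i $ l"
private abbreviation (input) "p \<equiv> \<lambda>m. \<Sum>l<d. u_vec d R i $ l * R $$ (l, m)"
private abbreviation (input) "\<rho> \<equiv> - limit_drift R i"

text \<open>
  The network multiplied by \<open>u\<^sup>(\<^sup>i\<^sup>)\<close>: the regulators of the faster
  coordinates have disappeared.
\<close>
lemma eliminated_equation:
  assumes t: "t \<ge> 0"
  shows "(\<Sum>l<d. u l * z l t) = (\<Sum>l<d. u l * z0 l) + (\<Sum>l<d. u l * b l t) + \<rho> * (y i t - c i * t)
    + (\<Sum>m=Suc i..<d. p m * (y m t - c m * t))"
proof -
  note up = u_vec_props[OF M R i]
  have z: "z l t = z0 l + b l t + (\<Sum>m<d. R $$ (l, m) * (y m t - c m * t))" if "l < d" for l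
    using reflectedD(2)[OF refl that t]
    by (simp add: right_diff_distrib sum_subtractf sum_distrib_right mult.assoc)
  have "(\<Sum>l<d. u l * z l t) = (\<Sum>l<d. u l * z0 l + u l * b l t + (\<Sum>m<d. u l * R $$ (l, m) * (y m t - c m * t)))"
    by (rule sum.cong) (auto simp: z distrib_left sum_distrib_left mult.assoc)
  also have "\<dots> = (\<Sum>l<d. u l * z0 l) + (\<Sum>l<d. u l * b l t) + (\<Sum>l<d. \<Sum>m<d. u l * R $$ (l, m) * (y m t - c m * t))"
    by (simp only: sum.distrib)
  also have "(\<Sum>l<d. \<Sum>m<d. u l * R $$ (l, m) * (y m t - c m * t)) = (\<Sum>m<d. p m * (y m t - c m * t))"
    by (subst sum.swap) (simp only: sum_distrib_right)
  also have "(\<Sum>m<d. p m * (y m t - c m * t))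
      = (\<Sum>m<i. p m * (y m t - c m * t)) + p i * (y i t - c i * t) + (\<Sum>m=Suc i..<d. p m * (y m t - c m * t))"
  proof -
    have "(\<Sum>m<d. h m) = (\<Sum>m<Suc i. h m) + (\<Sum>m=Suc i..<d. h m)" for h :: "nat \<Rightarrow> real"
      using i by (simp only: lessThan_atLeast0 sum.atLeastLessThan_concat)
    then show ?thesis by (simp only: sum.lessThan_Suc)
  qed
  also have "(\<Sum>m<i. p m * (y m t - c m * t)) = 0" by (rule sum.neutral) (simp add: up(5))
  finally show ?thesis unfolding up(6) by simp
qed

text \<open>
  Compare time \<open>t\<close> with a time \<open>s\<close> since which \<open>y\<^sub>i\<close>
  has been at rest and at which \<open>z\<^sub>i\<close> was small. In between, the eliminated
  equation has drift at most \<open>- \<kappa>\<close>, because the slower regulators can only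
  help. If \<open>t - s < \<delta>\<close> the noise moves by at most \<open>\<epsilon>\<close>,
  and otherwise the drift outweighs twice the bound on the noise.
\<close>
lemma fast_coordinate_small:
  assumes \<epsilon>: "\<epsilon> \<ge> 0" and \<delta>: "\<delta> > 0"
    and small: "\<And>l s. l < i \<Longrightarrow> 0 \<le> s \<Longrightarrow> s \<le> T \<Longrightarrow> z l s \<le> \<epsilon>" and z0i: "z0 i \<le> \<epsilon>"
    and \<beta>: "\<And>l t. l < d \<Longrightarrow> 0 \<le> t \<Longrightarrow> t \<le> T \<Longrightarrow> \<bar>b l t\<bar> \<le> \<beta>"
    and osc: "\<And>l s t. l < d \<Longrightarrow> 0 \<le> s \<Longrightarrow> s \<le> t \<Longrightarrow> t \<le> T \<Longrightarrow> t - s < \<delta> \<Longrightarrow> \<bar>b l t - b l s\<bar> \<le> \<epsilon>"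
    and \<kappa>: "\<rho> * c i - (\<Sum>m=Suc i..<d. \<bar>p m\<bar> * c m) \<ge> 2 * (\<Sum>l<d. u l) * \<beta> / \<delta>"
    and t: "0 \<le> t" "t \<le> T"
  shows "z i t \<le> (1 + 2 * (\<Sum>l<d. u l)) * \<epsilon>"
proof (rule field_le_epsilon)
  fix e :: real assume e: "e > 0"
  note up = u_vec_props[OF M R i]
  have u0: "u l \<ge> 0" if "l < d" for l using up(2)[OF that] .
  have \<rho>: "\<rho> > 0" using up(8) by simp
  define U where "U = (\<Sum>l<d. u l)"
  \<comment> \<open>the net downward drift of the eliminated equation\<close>
  define K where "K = \<rho> * c i - (\<Sum>m=Suc i..<d. \<bar>p m\<bar> * c m)"
  have U0: "U \<ge> 0" unfolding U_def using u0 by (intro sum_nonneg) auto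
  have \<beta>0: "\<beta> \<ge> 0" using \<beta>[OF i, of 0] t b0[OF i] by simp
  have K\<delta>: "2 * U * \<beta> \<le> K * \<delta>" using \<kappa> \<delta> by (simp add: K_def U_def pos_divide_le_eq)
  have K0: "K \<ge> 0"
  proof -
    have "2 * U * \<beta> / \<delta> \<ge> 0" using U0 \<beta>0 \<delta> by simp
    then show ?thesis using \<kappa> unfolding K_def U_def by linarith
  qed
  define e' where "e' = e / (1 + \<rho>)"
  have "e / (1 + q) > 0 \<and> e / (1 + q) + q * (e / (1 + q)) = e" if "q > 0" for q :: real
  proof (rule conjI)
    show "e / (1 + q) > 0" using e that by simp
    have "x + q * x = (1 + q) * x" for x :: real by (simp only: distrib_right mult_1_left)
    then have "e / (1 + q) + q * (e / (1 + q)) = (1 + q) * (e / (1 + q))" .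
    also have "\<dots> = e" using that by (intro nonzero_mult_div_cancel_left[of "1 + q" e, unfolded times_divide_eq_right[symmetric]]) simp
    finally show "e / (1 + q) + q * (e / (1 + q)) = e" .
  qed
  from this[OF \<rho>] have e': "e' > 0" "e' + \<rho> * e' = e" unfolding e'_def by blast+
  obtain s where s: "s \<in> {0..t}" "s = 0 \<or> z i s < e'" "y i t < y i s + e'"
    using reflectedD(6)[OF refl i t(1) e'(1)] by blast
  have s0: "0 \<le> s" "s \<le> t" using s(1) by auto
  have zis: "z i s \<le> \<epsilon> + e'"
  proof (cases "s = 0")
    case True
    have "z i 0 = z0 i" using reflectedD(2)[OF refl i order_refl] reflectedD(4)[OF refl] b0[OF i] by simp
    then show ?thesis using True z0i e'(1) by simp
  next
    case False then show ?thesis using s(2) \<epsilon> by simp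
  qed
  have "z i t = u i * z i t" using up(3) by simp
  also have "\<dots> \<le> (\<Sum>l<d. u l * z l t)"
    by (rule member_le_sum) (use i u0 reflectedD(1)[OF refl _ t(1)] in auto)
  finally have low: "z i t \<le> (\<Sum>l<d. u l * z l t)" .
  have high: "(\<Sum>l<d. u l * z l s) \<le> z i s + U * \<epsilon>"
  proof -
    have "(\<Sum>l<d. u l * z l s) \<le> (\<Sum>l<d. (if l = i then z i s else 0) + u l * \<epsilon>)"
    proof (rule sum_mono)
      fix l assume l: "l \<in> {..<d}"
      consider "l < i" | "l = i" | "i < l" by linarith
      then show "u l * z l s \<le> (if l = i then z i s else 0) + u l * \<epsilon>"
      proof cases
        case 1 then show ?thesis using small[OF 1 s0(1)] s0 t u0 l by (auto intro!: mult_left_mono)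
      next
        case 2 then show ?thesis using up(3) \<epsilon> by simp
      next
        case 3 then show ?thesis using up(4) l by simp
      qed
    qed
    then show ?thesis using i by (simp add: sum.distrib U_def sum_distrib_right)
  qed
  have db: "(\<Sum>l<d. u l * (b l t - b l s)) - K * (t - s) \<le> U * \<epsilon>"
  proof (cases "t - s < \<delta>")
    case True
    have "(\<Sum>l<d. u l * (b l t - b l s)) \<le> (\<Sum>l<d. u l * \<epsilon>)"
    proof (intro sum_mono mult_left_mono)
      fix l assume "l \<in> {..<d}"
      then have "\<bar>b l t - b l s\<bar> \<le> \<epsilon>" using osc[OF _ s0 t(2) True] by simp
      then show "b l t - b l s \<le> \<epsilon>" by linarith
    qed (use u0 in simp)
    then have "(\<Sum>l<d. u l * (b l t - b l s)) \<le> U * \<epsilon>" by (simp only: U_def sum_distrib_right)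
    moreover have "K * (t - s) \<ge> 0" using K0 s0 by simp
    ultimately show ?thesis by linarith
  next
    case False
    have "(\<Sum>l<d. u l * (b l t - b l s)) \<le> (\<Sum>l<d. u l * (2 * \<beta>))"
    proof (intro sum_mono mult_left_mono)
      fix l assume "l \<in> {..<d}"
      then have "\<bar>b l t\<bar> \<le> \<beta>" "\<bar>b l s\<bar> \<le> \<beta>" using \<beta>[of l t] \<beta>[of l s] s0 t by auto
      then show "b l t - b l s \<le> 2 * \<beta>" by linarith
    qed (use u0 in simp)
    also have "\<dots> = 2 * U * \<beta>" unfolding U_def sum_distrib_right[symmetric] by simp
    also have "\<dots> \<le> K * \<delta>" by (rule K\<delta>)
    also have "\<dots> \<le> K * (t - s)" using False K0 by (intro mult_left_mono) auto
    finally show ?thesis using U0 \<epsilon> by (simp add: add_nonneg_nonneg order_trans[of _ 0])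
  qed
  have tail: "(\<Sum>m=Suc i..<d. p m * (y m t - c m * t)) - (\<Sum>m=Suc i..<d. p m * (y m s - c m * s))
      \<le> (\<Sum>m=Suc i..<d. \<bar>p m\<bar> * c m) * (t - s)"
  proof -
    have "(\<Sum>m=Suc i..<d. p m * (y m t - c m * t)) - (\<Sum>m=Suc i..<d. p m * (y m s - c m * s))
        = (\<Sum>m=Suc i..<d. p m * (y m t - c m * t) - p m * (y m s - c m * s))"
      by (rule sum_subtractf[symmetric])
    also have "\<dots> \<le> (\<Sum>m=Suc i..<d. \<bar>p m\<bar> * c m * (t - s))"
    proof (rule sum_mono)
      fix m assume m: "m \<in> {Suc i..<d}"
      have pm: "p m \<le> 0" using up(7) m by auto
      have "p m * (y m t - c m * t) - p m * (y m s - c m * s) = p m * (y m t - y m s) + (- p m) * c m * (t - s)"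
        by (simp only: algebra_simps)
      also have "p m * (y m t - y m s) \<le> 0"
        using reflectedD(3)[OF refl _ s0, of m] m pm by (intro mult_nonpos_nonneg) auto
      finally show "p m * (y m t - c m * t) - p m * (y m s - c m * s) \<le> \<bar>p m\<bar> * c m * (t - s)"
        using pm by simp
    qed
    also have "\<dots> = (\<Sum>m=Suc i..<d. \<bar>p m\<bar> * c m) * (t - s)" by (rule sum_distrib_right[symmetric])
    finally show ?thesis .
  qed
  have yi: "\<rho> * (y i t - y i s) \<le> \<rho> * e'" using s(3) \<rho> by (intro mult_left_mono) auto
  have ub: "(\<Sum>l<d. u l * b l t) - (\<Sum>l<d. u l * b l s) = (\<Sum>l<d. u l * (b l t - b l s))"
    by (simp only: right_diff_distrib sum_subtractf)
  have yc: "\<rho> * (y i t - c i * t) - \<rho> * (y i s - c i * s) = \<rho> * (y i t - y i s) - \<rho> * c i * (t - s)"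
    by (simp only: algebra_simps)
  have Kt: "K * (t - s) = \<rho> * c i * (t - s) - (\<Sum>m=Suc i..<d. \<bar>p m\<bar> * c m) * (t - s)"
    unfolding K_def by (rule left_diff_distrib)
  have "z i t \<le> (\<Sum>l<d. u l * z l s) + ((\<Sum>l<d. u l * (b l t - b l s)) - K * (t - s)) + \<rho> * e'"
    using low eliminated_equation[OF t(1)] eliminated_equation[OF s0(1)] tail yi ub yc Kt by linarith
  also have "\<dots> \<le> (\<epsilon> + e' + U * \<epsilon>) + U * \<epsilon> + \<rho> * e'" using high zis db by linarith
  also have "\<dots> = (1 + 2 * U) * \<epsilon> + e" using e'(2) by (simp add: algebra_simps)
  finally show "z i t \<le> (1 + 2 * (\<Sum>l<d. u l)) * \<epsilon> + e" unfolding U_def .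
qed

text \<open>
  The eliminated equation for the active coordinate says that \<open>z\<^sub>i\<close> is the
  one-dimensional reflection of the target input plus an error made of fast coordinates and slow
  regulators; one-dimensional reflection is Lipschitz.
\<close>
lemma active_coordinate_close:
  assumes ci: "c i = 1" and cont: "continuous_on {0..} (z i)" "continuous_on {0..} (y i)"
    and bc: "\<And>l. l < d \<Longrightarrow> continuous_on {0..} (b l)" and \<epsilon>: "\<epsilon> \<ge> 0"
    and small: "\<And>l s. l < i \<Longrightarrow> 0 \<le> s \<Longrightarrow> s \<le> T \<Longrightarrow> z l s \<le> \<epsilon>" "\<And>l. l < i \<Longrightarrow> z0 l \<le> \<epsilon>"
    and free: "\<And>m s. i < m \<Longrightarrow> m < d \<Longrightarrow> 0 \<le> s \<Longrightarrow> s \<le> T \<Longrightarrow> y m s = 0"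
    and slow: "\<And>m. i < m \<Longrightarrow> m < d \<Longrightarrow> c m * T \<le> \<epsilon>"
    and t: "0 \<le> t" "t \<le> T"
  shows "\<bar>z i t - Phi1 (\<lambda>t. z0 i + limit_drift R i * t + (\<Sum>l<d. u l * b l t)) t\<bar>
    \<le> 2 * (((\<Sum>l<d. u l) + (\<Sum>m=Suc i..<d. \<bar>p m\<bar>)) * \<epsilon>)"
proof -
  note up = u_vec_props[OF M R i]
  have u0: "u l \<ge> 0" if "l < d" for l using up(2)[OF that] .
  have \<rho>: "\<rho> > 0" using up(8) by simp
  let ?g = "\<lambda>t. z0 i + limit_drift R i * t + (\<Sum>l<d. u l * b l t)"
  let ?h = "\<lambda>t. z i t - \<rho> * y i t"
  have hc: "continuous_on {0..} ?h"
    by (intro continuous_on_diff continuous_on_mult continuous_on_const cont)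
  have gc: "continuous_on {0..} ?g"
    by (intro continuous_on_add continuous_on_sum continuous_on_mult continuous_on_const continuous_on_id bc) auto
  have h0: "?h 0 \<ge> 0" using reflectedD(1)[OF refl i order_refl] reflectedD(4)[OF refl i] by simp
  have g0: "?g 0 \<ge> 0" using z0[OF i] b0 by simp
  have refl1: "reflected 1 (\<lambda>i j. 1) (\<lambda>_. ?h) (\<lambda>_. z i) (\<lambda>_ t. \<rho> * y i t)"
    unfolding reflected_def
  proof (intro allI impI conjI)
    note r = reflectedD[OF refl i]
    show "0 \<le> z i t" if "0 \<le> t" for t using r(1)[OF that] .
    show "z i t = ?h t + (\<Sum>k<1::nat. 1 * (\<rho> * y i t))" for t by simp
    show "mono_on {0..} (\<lambda>t. \<rho> * y i t)" by (rule mono_onI) (use r(3) \<rho> in \<open>auto intro!: mult_left_mono_neg\<close>)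
    show "\<rho> * y i 0 = 0" using r(4) by simp
    fix t e :: real assume t: "0 \<le> t" and e: "0 < e"
    have "min e (e / \<rho>) > 0"
      unfolding min_less_iff_conj using e divide_pos_pos[OF e \<rho>] by (rule conjI)
    from r(6)[OF t this] obtain s where s: "s \<in> {0..t}" "s = 0 \<or> z i s < min e (e / \<rho>)" "y i t < y i s + min e (e / \<rho>)"
      by blast
    have "y i t < y i s + e / \<rho>" using s(3) by linarith
    then have "\<rho> * y i t < \<rho> * (y i s + e / \<rho>)" using \<rho> by (rule mult_strict_left_mono)
    also have "\<dots> = \<rho> * y i s + e"
    proof -
      have "q * (v + e / q) = q * v + e" if "q > 0" for q v :: real using that by (simp add: distrib_left)
      from this[OF \<rho>] show ?thesis .
    qed
    finally show "\<exists>s\<in>{0..t}. (s = 0 \<or> z i s < e) \<and> \<rho> * y i t < \<rho> * y i s + e"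
      using s(1,2) by (intro bexI[of _ s] conjI) auto
  qed
  have "z i t = Phi1 ?h t"
    using reflected_one_dim[OF hc h0 refl1 t(1)] Phi1_eq[OF hc h0 t(1)] by simp
  moreover have "\<bar>Phi1 ?h t - Phi1 ?g t\<bar> \<le> 2 * (((\<Sum>l<d. u l) + (\<Sum>m=Suc i..<d. \<bar>p m\<bar>)) * \<epsilon>)"
  proof (rule Phi1_lipschitz[OF hc h0 gc g0 t(1)])
    fix s assume s: "0 \<le> s" "s \<le> t"
    have sT: "s \<le> T" using s t by simp
    define A where "A = (\<Sum>l<d. if l = i then 0 else u l * (z0 l - z l s))"
    define B where "B = (\<Sum>m=Suc i..<d. p m * (y m s - c m * s))"
    have "(\<Sum>l<d. u l * z0 l) - (\<Sum>l<d. u l * z l s) = (\<Sum>l<d. u l * (z0 l - z l s))"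
      by (simp only: right_diff_distrib sum_subtractf)
    also have "\<dots> = (\<Sum>l<d. (if l = i then z0 i - z i s else 0) + (if l = i then 0 else u l * (z0 l - z l s)))"
      by (rule sum.cong) (auto simp: up(3))
    also have "\<dots> = z0 i - z i s + A" using i by (simp add: sum.distrib A_def)
    finally have "?h s - ?g s = A + B"
      using eliminated_equation[OF s(1)] ci unfolding B_def by (simp add: algebra_simps)
    moreover have "\<bar>A\<bar> \<le> (\<Sum>l<d. u l) * \<epsilon>"
    proof -
      have "\<bar>A\<bar> \<le> (\<Sum>l<d. \<bar>if l = i then 0 else u l * (z0 l - z l s)\<bar>)" unfolding A_def by (rule sum_abs)
      also have "\<dots> \<le> (\<Sum>l<d. u l * \<epsilon>)"
      proof (rule sum_mono)
        fix l assume l: "l \<in> {..<d}"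
        consider "l < i" | "l = i" | "i < l" by linarith
        then show "\<bar>if l = i then 0 else u l * (z0 l - z l s)\<bar> \<le> u l * \<epsilon>"
        proof cases
          case 1
          have "\<bar>z0 l - z l s\<bar> \<le> \<epsilon>"
            using small(1)[OF 1 s(1) sT] small(2)[OF 1] z0[of l] reflectedD(1)[OF refl _ s(1), of l] l
            by (simp add: abs_le_iff)
          then show ?thesis using 1 u0[of l] l by (simp add: abs_mult mult_left_mono)
        next
          case 2 then show ?thesis using u0 l \<epsilon> by simp
        next
          case 3 then show ?thesis using up(4) l by simp
        qed
      qed
      finally show ?thesis by (simp only: sum_distrib_right)
    qed
    moreover have "\<bar>B\<bar> \<le> (\<Sum>m=Suc i..<d. \<bar>p m\<bar>) * \<epsilon>"
    proof -
      have "\<bar>B\<bar> \<le> (\<Sum>m=Suc i..<d. \<bar>p m * (y m s - c m * s)\<bar>)" unfolding B_def by (rule sum_abs)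
      also have "\<dots> \<le> (\<Sum>m=Suc i..<d. \<bar>p m\<bar> * \<epsilon>)"
      proof (rule sum_mono)
        fix m assume m: "m \<in> {Suc i..<d}"
        have "c m * s \<le> c m * T" using c[of m] m sT by (intro mult_left_mono) auto
        then have "\<bar>y m s - c m * s\<bar> \<le> \<epsilon>"
          using free[of m s] slow[of m] m s(1) sT c[of m] by (simp add: abs_mult)
        then show "\<bar>p m * (y m s - c m * s)\<bar> \<le> \<bar>p m\<bar> * \<epsilon>"
          unfolding abs_mult by (rule mult_left_mono) simp
      qed
      finally show ?thesis by (simp only: sum_distrib_right)
    qed
    ultimately show "\<bar>?h s - ?g s\<bar> \<le> ((\<Sum>l<d. u l) + (\<Sum>m=Suc i..<d. \<bar>p m\<bar>)) * \<epsilon>"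
      by (simp only: distrib_right)
  qed
  ultimately show ?thesis by simp
qed

end

end

section \<open>High probability and convergence in law\<close>

text \<open>
  Asymptotically with probability 1, in a form that does not ask whether \<open>P r\<close> is an
  event.
\<close>
definition whp :: "'i filter \<Rightarrow> 'm measure \<Rightarrow> ('i \<Rightarrow> 'm \<Rightarrow> bool) \<Rightarrow> bool" where
  "whp F M P \<longleftrightarrow> (\<forall>\<eta>>0. \<forall>\<^sub>F r in F. \<exists>E\<in>sets M. measure M E \<ge> 1 - \<eta> \<and> (\<forall>\<omega>\<in>E. P r \<omega>))"

lemma whpI: "(\<And>\<eta>. \<eta> > 0 \<Longrightarrow> \<forall>\<^sub>F r in F. \<exists>E\<in>sets M. measure M E \<ge> 1 - \<eta> \<and> (\<forall>\<omega>\<in>E. P r \<omega>)) \<Longrightarrow> whp F M P"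
  unfolding whp_def by blast

lemma whpD: "whp F M P \<Longrightarrow> \<eta> > 0 \<Longrightarrow> \<forall>\<^sub>F r in F. \<exists>E\<in>sets M. measure M E \<ge> 1 - \<eta> \<and> (\<forall>\<omega>\<in>E. P r \<omega>)"
  unfolding whp_def by blast

lemma whp_mono:
  assumes P: "whp F M P" and imp: "\<forall>\<^sub>F r in F. \<forall>\<omega>\<in>space M. P r \<omega> \<longrightarrow> Q r \<omega>"
  shows "whp F M Q"
proof (rule whpI)
  fix \<eta> :: real assume "\<eta> > 0"
  from whpD[OF P this] imp show "\<forall>\<^sub>F r in F. \<exists>E\<in>sets M. measure M E \<ge> 1 - \<eta> \<and> (\<forall>\<omega>\<in>E. Q r \<omega>)"
  proof eventually_elim
    case (elim r)
    then obtain E where E: "E \<in> sets M" "measure M E \<ge> 1 - \<eta>" "\<forall>\<omega>\<in>E. P r \<omega>" by blast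
    then have "\<forall>\<omega>\<in>E. Q r \<omega>" using elim(2) sets.sets_into_space[OF E(1)] by blast
    then show ?case using E by blast
  qed
qed

context prob_space
begin

lemma prob_Int_ge:
  assumes "A \<in> events" "B \<in> events" "prob A \<ge> 1 - a" "prob B \<ge> 1 - b"
  shows "prob (A \<inter> B) \<ge> 1 - (a + b)"
proof -
  have "prob (space M - A \<inter> B) \<le> prob (space M - A) + prob (space M - B)"
    unfolding Diff_Int using assms(1,2) by (intro measure_Un_le sets.compl_sets)
  then show ?thesis using assms by (simp add: prob_compl)
qed

lemma whp_conj:
  assumes P: "whp F M P" and Q: "whp F M Q"
  shows "whp F M (\<lambda>r \<omega>. P r \<omega> \<and> Q r \<omega>)"
proof (rule whpI)
  fix \<eta> :: real assume "\<eta> > 0"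
  then have \<eta>: "\<eta> / 2 > 0" by simp
  from whpD[OF P \<eta>] whpD[OF Q \<eta>]
  show "\<forall>\<^sub>F r in F. \<exists>E\<in>sets M. prob E \<ge> 1 - \<eta> \<and> (\<forall>\<omega>\<in>E. P r \<omega> \<and> Q r \<omega>)"
  proof eventually_elim
    case (elim r)
    then obtain A B where A: "A \<in> sets M" "prob A \<ge> 1 - \<eta> / 2" "\<forall>\<omega>\<in>A. P r \<omega>"
      and B: "B \<in> sets M" "prob B \<ge> 1 - \<eta> / 2" "\<forall>\<omega>\<in>B. Q r \<omega>" by blast
    have "prob (A \<inter> B) \<ge> 1 - (\<eta> / 2 + \<eta> / 2)" by (rule prob_Int_ge) (fact A B)+
    then have "prob (A \<inter> B) \<ge> 1 - \<eta>" by simp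
    then show ?case using A B by (intro bexI[of _ "A \<inter> B"]) auto
  qed
qed

lemma whp_True: "whp F M (\<lambda>r \<omega>. True)"
  by (rule whpI) (auto intro!: always_eventually bexI[of _ "space M"] simp: prob_space)

lemma whp_ball:
  assumes "finite I" "\<And>i. i \<in> I \<Longrightarrow> whp F M (P i)"
  shows "whp F M (\<lambda>r \<omega>. \<forall>i\<in>I. P i r \<omega>)"
  using assms
proof (induction I rule: finite_induct)
  case empty
  show ?case using whp_True by simp
next
  case (insert i I)
  have "whp F M (\<lambda>r \<omega>. P i r \<omega> \<and> (\<forall>i\<in>I. P i r \<omega>))"
    using insert by (intro whp_conj) auto
  then show ?case by simp
qed

text \<open>
  For conditions \<open>Q p\<close> that can be made as likely as desired, uniformly in
  \<open>r\<close>, by choice of the parameter \<open>p\<close>: they may be assumed with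
  \<open>p\<close> fixed, so that \<open>r\<close> can be taken small depending on
  \<open>p\<close>.
\<close>
lemma whp_tight:
  assumes Q: "\<And>\<eta>. \<eta> > 0 \<Longrightarrow> \<exists>p. \<forall>\<^sub>F r in F. \<exists>E\<in>sets M. prob E \<ge> 1 - \<eta> \<and> (\<forall>\<omega>\<in>E. Q p r \<omega>)"
    and P: "\<And>p. whp F M (\<lambda>r \<omega>. Q p r \<omega> \<longrightarrow> P r \<omega>)"
  shows "whp F M P"
proof (rule whpI)
  fix \<eta> :: real assume "\<eta> > 0"
  then have \<eta>: "\<eta> / 2 > 0" by simp
  obtain p where p: "\<forall>\<^sub>F r in F. \<exists>E\<in>sets M. prob E \<ge> 1 - \<eta> / 2 \<and> (\<forall>\<omega>\<in>E. Q p r \<omega>)"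
    using Q[OF \<eta>] by blast
  from p whpD[OF P[of p] \<eta>]
  show "\<forall>\<^sub>F r in F. \<exists>E\<in>sets M. prob E \<ge> 1 - \<eta> \<and> (\<forall>\<omega>\<in>E. P r \<omega>)"
  proof eventually_elim
    case (elim r)
    then obtain A B where A: "A \<in> sets M" "prob A \<ge> 1 - \<eta> / 2" "\<forall>\<omega>\<in>A. Q p r \<omega>"
      and B: "B \<in> sets M" "prob B \<ge> 1 - \<eta> / 2" "\<forall>\<omega>\<in>B. Q p r \<omega> \<longrightarrow> P r \<omega>" by blast
    have "prob (A \<inter> B) \<ge> 1 - (\<eta> / 2 + \<eta> / 2)" by (rule prob_Int_ge) (fact A B)+
    then have "prob (A \<inter> B) \<ge> 1 - \<eta>" by simp
    then show ?case using A B by (intro bexI[of _ "A \<inter> B"]) auto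
  qed
qed

lemma prob_finite_INT_ge:
  assumes "\<And>m. m < n \<Longrightarrow> E m \<in> events" "\<And>m. m < n \<Longrightarrow> prob (E m) \<ge> 1 - a"
  shows "\<exists>A\<in>events. prob A \<ge> 1 - real n * a \<and> (\<forall>\<omega>\<in>A. \<forall>m<n. \<omega> \<in> E m)"
  using assms
proof (induction n)
  case 0
  show ?case by (rule bexI[of _ "space M"]) (auto simp: prob_space)
next
  case (Suc n)
  obtain A where A: "A \<in> events" "prob A \<ge> 1 - real n * a" "\<forall>\<omega>\<in>A. \<forall>m<n. \<omega> \<in> E m"
    using Suc.IH[OF Suc.prems(1) Suc.prems(2)] by auto
  have "prob (A \<inter> E n) \<ge> 1 - (real n * a + a)"
    by (rule prob_Int_ge[OF A(1) _ A(2)]) (use Suc.prems in auto)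
  then show ?case using A Suc.prems(1)[of n]
    by (intro bexI[of _ "A \<inter> E n"]) (auto simp: less_Suc_eq algebra_simps)
qed

lemma prob_countable_INT_ge:
  assumes E: "\<And>m::nat. E m \<in> events" "\<And>m. prob (E m) \<ge> 1 - \<eta> * (1 / 2) ^ Suc m"
  shows "(\<Inter>m. E m) \<in> events" and "prob (\<Inter>m. E m) \<ge> 1 - \<eta>"
proof -
  show ev: "(\<Inter>m. E m) \<in> events" using E(1) by (intro sets.countable_INT) auto
  have sums: "(\<lambda>m. \<eta> * (1 / 2) ^ Suc m) sums (\<eta> * 1)" by (intro sums_mult power_half_series)
  have le: "prob (space M - E m) \<le> \<eta> * (1 / 2) ^ Suc m" for m
    using E(2)[of m] prob_compl[OF E(1)[of m]] by simp
  have summ: "summable (\<lambda>m. prob (space M - E m))"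
    by (rule summable_comparison_test'[OF sums_summable[OF sums], of 0]) (use le in auto)
  have "prob (\<Union>m. space M - E m) \<le> (\<Sum>m. prob (space M - E m))"
    by (rule finite_measure_subadditive_countably[OF _ summ]) (use E(1) in auto)
  also have "\<dots> \<le> (\<Sum>m. \<eta> * (1 / 2) ^ Suc m)" by (rule suminf_le[OF le summ sums_summable[OF sums]])
  also have "\<dots> = \<eta>" using sums_unique[OF sums] by simp
  also have "(\<Union>m. space M - E m) = space M - (\<Inter>m. E m)" by auto
  finally show "prob (\<Inter>m. E m) \<ge> 1 - \<eta>" using prob_compl[OF ev] by simp
qed

lemma whp_integral:
  fixes h :: "'i \<Rightarrow> 'a \<Rightarrow> real" and C :: real
  assumes h: "\<And>e. e > 0 \<Longrightarrow> whp F M (\<lambda>r \<omega>. \<bar>h r \<omega>\<bar> \<le> e)"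
    and m: "\<forall>\<^sub>F r in F. h r \<in> borel_measurable M \<and> (\<forall>\<omega>\<in>space M. \<bar>h r \<omega>\<bar> \<le> C)"
  shows "((\<lambda>r. \<integral>\<omega>. h r \<omega> \<partial>M) \<longlongrightarrow> 0) F"
proof (rule tendstoI)
  fix \<epsilon> :: real assume \<epsilon>: "\<epsilon> > 0"
  define C' where "C' = max C 1"
  have C': "C' > 0" "C \<le> C'" by (auto simp: C'_def)
  define \<eta> where "\<eta> = \<epsilon> / (4 * C')"
  have \<eta>: "\<eta> > 0" "C' * \<eta> = \<epsilon> / 4" using \<epsilon> C' by (auto simp: \<eta>_def)
  have "\<epsilon> / 4 > 0" using \<epsilon> by simp
  from whpD[OF h[OF this] \<eta>(1)] m show "\<forall>\<^sub>F r in F. dist (\<integral>\<omega>. h r \<omega> \<partial>M) 0 < \<epsilon>"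
  proof eventually_elim
    case (elim r)
    then obtain E where E: "E \<in> events" "prob E \<ge> 1 - \<eta>" "\<forall>\<omega>\<in>E. \<bar>h r \<omega>\<bar> \<le> \<epsilon> / 4" by blast
    have ind: "integrable M (\<lambda>\<omega>. \<epsilon> / 4 + C' * indicator (space M - E) \<omega>)"
      by (rule integrable_const_bound[where B = "\<epsilon> / 4 + C'"])
        (use E(1) C' \<epsilon> in \<open>auto simp: indicator_def\<close>)
    have "norm (\<integral>\<omega>. h r \<omega> \<partial>M) \<le> (\<integral>\<omega>. norm (h r \<omega>) \<partial>M)" by (rule integral_norm_bound)
    also have "\<dots> \<le> (\<integral>\<omega>. \<epsilon> / 4 + C' * indicator (space M - E) \<omega> \<partial>M)"
    proof (rule integral_mono[OF _ ind])
      show "integrable M (\<lambda>\<omega>. norm (h r \<omega>))"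
        using elim(2) by (intro integrable_norm integrable_const_bound[where B = C]) auto
      fix \<omega> assume \<omega>: "\<omega> \<in> space M"
      show "norm (h r \<omega>) \<le> \<epsilon> / 4 + C' * indicator (space M - E) \<omega>"
      proof (cases "\<omega> \<in> E")
        case True then show ?thesis using E(3) by simp
      next
        case False
        from elim(2) \<omega> have "\<bar>h r \<omega>\<bar> \<le> C" by blast
        then have "\<bar>h r \<omega>\<bar> \<le> C'" using C'(2) by linarith
        then show ?thesis using False \<omega> \<epsilon> by simp
      qed
    qed
    also have "\<dots> = \<epsilon> / 4 + C' * prob (space M - E)"
      using E(1) by (subst Bochner_Integration.integral_add)
        (auto simp: prob_space emeasure_eq_measure intro!: integrable_real_indicator)
    also have "\<dots> \<le> \<epsilon> / 4 + C' * \<eta>"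
      using C'(1) E(2) prob_compl[OF E(1)] by (intro add_left_mono mult_left_mono) auto
    also have "\<dots> < \<epsilon>" using \<eta>(2) \<epsilon> by simp
    finally show ?case by simp
  qed
qed

end

lemma path_functional_bound:
  fixes f :: "(real \<Rightarrow> real) \<Rightarrow> real"
  assumes "bounded (f ` topspace path_topology)"
  obtains C :: real where "\<And>x. cadlag x \<Longrightarrow> \<bar>f x\<bar> \<le> C"
proof -
  obtain C where "\<forall>v\<in>f ` topspace path_topology. norm v \<le> C" using assms unfolding bounded_iff by blast
  then show thesis by (intro that[of C]) (auto simp: topspace_path_topology)
qed

lemma converges_in_law_zero:
  assumes M: "prob_space M"
    and cont: "\<forall>\<^sub>F r in F. (\<forall>\<omega>\<in>space M. continuous_on {0..} (X r \<omega>)) \<and> (\<forall>t\<ge>0. (\<lambda>\<omega>. X r \<omega> t) \<in> borel_measurable M)"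
    and small: "\<And>T e. T \<ge> 0 \<Longrightarrow> e > 0 \<Longrightarrow> whp F M (\<lambda>r \<omega>. \<forall>t\<in>{0..T}. \<bar>X r \<omega> t\<bar> \<le> e)"
  shows "converges_in_law path_topology F M X M (\<lambda>\<omega> t. 0)"
  unfolding converges_in_law_def
proof (intro conjI allI impI)
  interpret prob_space M by fact
  have Xm: "\<forall>\<^sub>F r in F. X r \<in> measurable M (borel_of_topology path_topology)"
    using cont by (rule eventually_mono) (auto intro!: path_measurable)
  show "\<forall>\<^sub>F r in F. X r \<in> measurable M (borel_of_topology path_topology)" by fact
  show "(\<lambda>\<omega> t. 0) \<in> measurable M (borel_of_topology path_topology)"
    by (rule path_measurable) auto
  fix f :: "(real \<Rightarrow> real) \<Rightarrow> real"
  assume f: "continuous_map path_topology euclideanreal f \<and> bounded (f ` topspace path_topology)"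
  obtain C where C: "\<And>x. cadlag x \<Longrightarrow> \<bar>f x\<bar> \<le> C" using path_functional_bound[OF conjunct2[OF f]] by metis
  let ?zero = "\<lambda>t::real. 0::real"
  have cad0: "cadlag ?zero" by (rule continuous_on_imp_cadlag) simp
  have "((\<lambda>r. \<integral>\<omega>. f (X r \<omega>) - f ?zero \<partial>M) \<longlongrightarrow> 0) F"
  proof (rule whp_integral)
    fix e :: real assume e: "e > 0"
    obtain T \<delta> where \<delta>: "\<delta> > 0"
      "\<And>y. cadlag y \<Longrightarrow> (\<And>t. 0 \<le> t \<Longrightarrow> t \<le> T \<Longrightarrow> \<bar>y t - 0\<bar> < \<delta>) \<Longrightarrow> \<bar>f y - f ?zero\<bar> < e"
      using path_continuousD[OF conjunct1[OF f] cad0 e] by metis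
    have "whp F M (\<lambda>r \<omega>. \<forall>t\<in>{0..max 0 T}. \<bar>X r \<omega> t\<bar> \<le> \<delta> / 2)" using \<delta>(1) by (intro small) auto
    then show "whp F M (\<lambda>r \<omega>. \<bar>f (X r \<omega>) - f ?zero\<bar> \<le> e)"
    proof (rule whp_mono)
      show "\<forall>\<^sub>F r in F. \<forall>\<omega>\<in>space M. (\<forall>t\<in>{0..max 0 T}. \<bar>X r \<omega> t\<bar> \<le> \<delta> / 2) \<longrightarrow> \<bar>f (X r \<omega>) - f ?zero\<bar> \<le> e"
        using cont
      proof eventually_elim
        case (elim r)
        show ?case
        proof (intro ballI impI)
          fix \<omega> assume \<omega>: "\<omega> \<in> space M" and s: "\<forall>t\<in>{0..max 0 T}. \<bar>X r \<omega> t\<bar> \<le> \<delta> / 2"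
          have "cadlag (X r \<omega>)" using elim \<omega> by (intro continuous_on_imp_cadlag) blast
          then have "\<bar>f (X r \<omega>) - f ?zero\<bar> < e"
          proof (rule \<delta>(2))
            fix t assume "0 \<le> t" "t \<le> T"
            then have "\<bar>X r \<omega> t\<bar> \<le> \<delta> / 2" using s by simp
            then show "\<bar>X r \<omega> t - 0\<bar> < \<delta>" using \<delta>(1) by simp
          qed
          then show "\<bar>f (X r \<omega>) - f ?zero\<bar> \<le> e" by simp
        qed
      qed
    qed
  next
    show "\<forall>\<^sub>F r in F. (\<lambda>\<omega>. f (X r \<omega>) - f ?zero) \<in> borel_measurable M \<and> (\<forall>\<omega>\<in>space M. \<bar>f (X r \<omega>) - f ?zero\<bar> \<le> 2 * C)"
      using cont Xm
    proof eventually_elim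
      case (elim r)
      have "(\<lambda>\<omega>. f (X r \<omega>)) \<in> borel_measurable M"
        by (rule measurable_compose[OF elim(2) path_functional_measurable[OF conjunct1[OF f]]])
      moreover have "\<bar>f (X r \<omega>) - f ?zero\<bar> \<le> 2 * C" if "\<omega> \<in> space M" for \<omega>
      proof -
        have "cadlag (X r \<omega>)" using elim(1) that by (intro continuous_on_imp_cadlag) blast
        from C[OF this] C[OF cad0] show ?thesis by linarith
      qed
      ultimately show ?case by (auto intro: borel_measurable_diff)
    qed
  qed
  moreover have "\<forall>\<^sub>F r in F. (\<integral>\<omega>. f (X r \<omega>) - f ?zero \<partial>M) = (\<integral>\<omega>. f (X r \<omega>) \<partial>M) - (\<integral>\<omega>. f ?zero \<partial>M)"
    using cont Xm
  proof eventually_elim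
    case (elim r)
    have "(\<lambda>\<omega>. f (X r \<omega>)) \<in> borel_measurable M"
      by (rule measurable_compose[OF elim(2) path_functional_measurable[OF conjunct1[OF f]]])
    moreover have "\<bar>f (X r \<omega>)\<bar> \<le> C" if "\<omega> \<in> space M" for \<omega>
      by (rule C[OF continuous_on_imp_cadlag]) (use elim(1) that in blast)
    ultimately have "integrable M (\<lambda>\<omega>. f (X r \<omega>))" by (intro integrable_const_bound[where B = C]) auto
    then show ?case by (intro Bochner_Integration.integral_diff) auto
  qed
  ultimately have "((\<lambda>r. (\<integral>\<omega>. f (X r \<omega>) \<partial>M) - (\<integral>\<omega>. f ?zero \<partial>M)) \<longlongrightarrow> 0) F"
    by (rule Lim_transform_eventually)
  then show "((\<lambda>r. \<integral>\<omega>. f (X r \<omega>) \<partial>M) \<longlongrightarrow> (\<integral>\<omega>. f ?zero \<partial>M)) F" by (rule LIM_zero_cancel)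
qed

section \<open>The network on one time scale\<close>

locale srbm_family =
  fixes J :: nat
    and \<gamma> :: "nat \<Rightarrow> real \<Rightarrow> real"
    and \<Gamma> L R :: "real mat"
    and \<theta> :: "real \<Rightarrow> real Matrix.vec"
    and M :: "'a measure"
    and W :: "nat \<Rightarrow> real \<Rightarrow> 'a \<Rightarrow> real"
    and Z0 :: "real \<Rightarrow> nat \<Rightarrow> 'a \<Rightarrow> real"
    and Z Y :: "real \<Rightarrow> 'a \<Rightarrow> nat \<Rightarrow> real \<Rightarrow> real"
    and N :: "'b measure"
    and \<xi> :: "nat \<Rightarrow> 'b \<Rightarrow> real"
  assumes J: "J \<ge> 1"
    and gamma_pos: "\<And>j r. j < J \<Longrightarrow> r \<in> {0<..<1} \<Longrightarrow> \<gamma> j r > 0"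
    and gamma_sep: "\<And>i j. i < j \<Longrightarrow> j < J \<Longrightarrow> ((\<lambda>r. \<gamma> j r / \<gamma> i r) \<longlongrightarrow> 0) (at_right 0)"
    and Gamma: "pos_def_mat J \<Gamma>"
    and L: "cholesky J \<Gamma> L"
    and R: "M_matrix J R"
    and W: "std_brownian_motion M J W"
    and Z0_meas: "\<And>r j. r \<in> {0<..<1} \<Longrightarrow> j < J \<Longrightarrow> Z0 r j \<in> borel_measurable M"
    and Z0_nonneg: "\<And>r j \<omega>. r \<in> {0<..<1} \<Longrightarrow> j < J \<Longrightarrow> \<omega> \<in> space M \<Longrightarrow> Z0 r j \<omega> \<ge> 0"
    and Z0_indep: "\<And>r. r \<in> {0<..<1} \<Longrightarrow>
      indep_elements M (Pi\<^sub>M {..<J} (\<lambda>_. borel)) (\<lambda>\<omega>. \<lambda>j\<in>{..<J}. Z0 r j \<omega>)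
        (process_space J) (process_element J W)"
    and Z: "\<And>r \<omega>. r \<in> {0<..<1} \<Longrightarrow> \<omega> \<in> space M \<Longrightarrow>
      Z r \<omega> = Phi J R (srbm_input J L (\<theta> r) (Z0 r) W \<omega>)"
    and Y: "\<And>r \<omega>. r \<in> {0<..<1} \<Longrightarrow> \<omega> \<in> space M \<Longrightarrow>
      Y r \<omega> = Psi J R (srbm_input J L (\<theta> r) (Z0 r) W \<omega>)"
    and drift: "\<And>r. r \<in> {0<..<1} \<Longrightarrow> \<theta> r = - (R *\<^sub>v Matrix.vec J (\<lambda>j. \<gamma> j r))"
    and N: "prob_space N"
    and xi_meas: "\<And>j. j < J \<Longrightarrow> \<xi> j \<in> borel_measurable N"
    and initial_conv:
      "converges_in_law (product_topology (\<lambda>_. euclideanreal) {..<J}) (at_right 0)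
         M (\<lambda>r \<omega>. \<lambda>j\<in>{..<J}. \<gamma> j r * Z0 r j \<omega>) N (\<lambda>\<omega>. \<lambda>j\<in>{..<J}. \<xi> j \<omega>)"
    and initial_sep: "\<And>j. 1 \<le> j \<Longrightarrow> j < J \<Longrightarrow>
      tends_to_infinity_in_probability (at_right 0) M (\<lambda>r \<omega>. \<gamma> (j - 1) r * Z0 r j \<omega>)"
begin

sublocale prob_space M by (rule std_bmD(1)[OF W])

lemma R_nonsingular: "nonsingular_M J (\<lambda>i j. R $$ (i, j))" and R_carrier: "R \<in> carrier_mat J J"
  using nonsingular_M_of_M_matrix[OF R J] by auto

lemma eventually_unit: "\<forall>\<^sub>F r in at_right 0. r \<in> {0<..<(1::real)}"
  by (rule eventually_at_right_real) simp

lemma theta_index: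
  assumes r: "r \<in> {0<..<1}" and j: "j < J"
  shows "\<theta> r $ j = - (\<Sum>i<J. R $$ (j, i) * \<gamma> i r)"
  using R_carrier j unfolding drift[OF r]
  by (simp add: scalar_prod_def lessThan_atLeast0)

lemma input_continuous:
  assumes \<omega>: "\<omega> \<in> space M"
  shows "continuous_on {0..} (srbm_input J L (\<theta> r) (Z0 r) W \<omega> j)"
  unfolding srbm_input_def[abs_def]
  by (intro continuous_on_add continuous_on_mult continuous_on_const continuous_on_id continuous_on_sum
      std_bmD(4)[OF W _ \<omega>]) auto

lemma input_zero:
  assumes \<omega>: "\<omega> \<in> space M"
  shows "srbm_input J L (\<theta> r) (Z0 r) W \<omega> j 0 = Z0 r j \<omega>"
  using std_bmD(3)[OF W _ \<omega>] by (simp add: srbm_input_def)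

lemma input_measurable:
  assumes r: "r \<in> {0<..<1}" and j: "j < J" and t: "t \<ge> 0"
  shows "(\<lambda>\<omega>. srbm_input J L (\<theta> r) (Z0 r) W \<omega> j t) \<in> borel_measurable M"
  unfolding srbm_input_def
  by (intro borel_measurable_add borel_measurable_sum borel_measurable_times borel_measurable_const
      Z0_meas[OF r j] std_bmD(2)[OF W] t) auto

lemma ZY_path:
  assumes r: "r \<in> {0<..<1}" and \<omega>: "\<omega> \<in> space M"
  shows "reflected J (\<lambda>i j. R $$ (i, j)) (srbm_input J L (\<theta> r) (Z0 r) W \<omega>) (Z r \<omega>) (Y r \<omega>)"
    and "\<And>j. j < J \<Longrightarrow> continuous_on {0..} (Z r \<omega> j)"
    and "\<And>j. j < J \<Longrightarrow> continuous_on {0..} (Y r \<omega> j)"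
proof -
  have x0: "srbm_input J L (\<theta> r) (Z0 r) W \<omega> j 0 \<ge> 0" if "j < J" for j
    unfolding input_zero[OF \<omega>] by (rule Z0_nonneg[OF r that \<omega>])
  note pp = Phi_Psi_reflected[where x = "srbm_input J L (\<theta> r) (Z0 r) W \<omega>",
      OF R_nonsingular R_carrier input_continuous[OF \<omega>] x0]
  show "reflected J (\<lambda>i j. R $$ (i, j)) (srbm_input J L (\<theta> r) (Z0 r) W \<omega>) (Z r \<omega>) (Y r \<omega>)"
    unfolding Z[OF r \<omega>] Y[OF r \<omega>] by (rule pp(1))
  show "continuous_on {0..} (Z r \<omega> j)" if "j < J" for j unfolding Z[OF r \<omega>] by (rule pp(2)[OF _ that])
  show "continuous_on {0..} (Y r \<omega> j)" if "j < J" for j unfolding Y[OF r \<omega>] by (rule pp(3)[OF _ that])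
qed

lemma ZY_measurable:
  assumes r: "r \<in> {0<..<1}" and j: "j < J" and t: "t \<ge> 0"
  shows "(\<lambda>\<omega>. Z r \<omega> j t) \<in> borel_measurable M" and "(\<lambda>\<omega>. Y r \<omega> j t) \<in> borel_measurable M"
proof -
  have x0: "srbm_input J L (\<theta> r) (Z0 r) W \<omega> j 0 \<ge> 0" if "j < J" "\<omega> \<in> space M" for j \<omega>
    unfolding input_zero[OF that(2)] by (rule Z0_nonneg[OF r that])
  note pm = Phi_Psi_measurable[where x = "srbm_input J L (\<theta> r) (Z0 r) W" and P = M,
      OF R_nonsingular R_carrier input_continuous x0 input_measurable[OF r] j t]
  have "(\<lambda>\<omega>. Phi J R (srbm_input J L (\<theta> r) (Z0 r) W \<omega>) j t) \<in> borel_measurable M"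
    by (rule pm(2))
  then show "(\<lambda>\<omega>. Z r \<omega> j t) \<in> borel_measurable M"
    by (rule measurable_cong[THEN iffD1, rotated]) (simp add: Z[OF r])
  have "(\<lambda>\<omega>. Psi J R (srbm_input J L (\<theta> r) (Z0 r) W \<omega>) j t) \<in> borel_measurable M"
    by (rule pm(1))
  then show "(\<lambda>\<omega>. Y r \<omega> j t) \<in> borel_measurable M"
    by (rule measurable_cong[THEN iffD1, rotated]) (simp add: Y[OF r])
qed

text \<open>
  The marginal form in which weak convergence of the initial states is used.
\<close>
lemma initial_functional:
  fixes h :: "real \<Rightarrow> real"
  assumes h: "continuous_on UNIV h" and C: "\<And>v. \<bar>h v\<bar> \<le> C" and i: "i < J"
  shows "((\<lambda>r. \<integral>\<omega>. h (\<gamma> i r * Z0 r i \<omega>) \<partial>M) \<longlongrightarrow> (\<integral>\<omega>. h (\<xi> i \<omega>) \<partial>N)) (at_right 0)"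
proof -
  let ?T = "product_topology (\<lambda>_. euclideanreal) {..<J}"
  have "continuous_map ?T euclideanreal (h \<circ> (\<lambda>v. v i))"
  proof (rule continuous_map_compose)
    show "continuous_map ?T euclideanreal (\<lambda>v. v i)"
      using continuous_map_product_projection[of i "{..<J}" "\<lambda>_. euclideanreal"] i by simp
    show "continuous_map euclideanreal euclideanreal h" using h by (simp add: continuous_map_iff_continuous2)
  qed
  moreover have "bounded ((h \<circ> (\<lambda>v. v i)) ` topspace ?T)"
    unfolding bounded_iff using C by auto
  ultimately have "((\<lambda>r. \<integral>\<omega>. (h \<circ> (\<lambda>v. v i)) (\<lambda>j\<in>{..<J}. \<gamma> j r * Z0 r j \<omega>) \<partial>M) \<longlongrightarrow>
      (\<integral>\<omega>. (h \<circ> (\<lambda>v. v i)) (\<lambda>j\<in>{..<J}. \<xi> j \<omega>) \<partial>N)) (at_right 0)"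
    using initial_conv unfolding converges_in_law_def by blast
  then show ?thesis using i by (simp add: o_def)
qed

text \<open>
  Tightness of one coordinate, from the test functions \<open>h A\<close> that increase from 0 to
  1 on \<open>[A, A + 1]\<close>.
\<close>
lemma initial_tight:
  assumes i: "i < J" and \<eta>: "\<eta> > 0"
  shows "\<exists>A. \<forall>\<^sub>F r in at_right 0. \<exists>E\<in>sets M. prob E \<ge> 1 - \<eta> \<and> (\<forall>\<omega>\<in>E. \<gamma> i r * Z0 r i \<omega> \<le> A)"
proof -
  interpret N: prob_space N by (rule N)
  define h where "h = (\<lambda>A v::real. max 0 (min 1 (v - A)))"
  have hc: "continuous_on UNIV (h A)" for A
    unfolding h_def by (intro continuous_on_max continuous_on_min continuous_on_const continuous_on_diff continuous_on_id)
  have hb: "\<bar>h A v\<bar> \<le> 1" and h0: "h A v \<ge> 0" for A v by (auto simp: h_def)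
  have hm: "h A \<in> borel_measurable borel" for A by (rule borel_measurable_continuous_onI[OF hc])
  have "(\<lambda>n::nat. \<integral>\<omega>. h (real n) (\<xi> i \<omega>) \<partial>N) \<longlonglongrightarrow> (\<integral>\<omega>. 0 \<partial>N)"
  proof (rule integral_dominated_convergence[where w = "\<lambda>_. 1"])
    show "AE \<omega> in N. (\<lambda>n. h (real n) (\<xi> i \<omega>)) \<longlonglongrightarrow> 0"
    proof (rule AE_I2)
      fix \<omega>
      obtain n0 where "\<xi> i \<omega> \<le> real n0" using real_arch_simple by blast
      then have "h (real n) (\<xi> i \<omega>) = 0" if "n \<ge> n0" for n using that by (simp add: h_def)
      then have "\<forall>\<^sub>F n in sequentially. 0 = h (real n) (\<xi> i \<omega>)" unfolding eventually_sequentially by metis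
      with tendsto_const show "(\<lambda>n. h (real n) (\<xi> i \<omega>)) \<longlonglongrightarrow> 0" by (rule Lim_transform_eventually)
    qed
    show "(\<lambda>\<omega>. h (real n) (\<xi> i \<omega>)) \<in> borel_measurable N" for n by (rule measurable_compose[OF xi_meas[OF i] hm])
  qed (use hb in auto)
  then have "\<forall>\<^sub>F n in sequentially. (\<integral>\<omega>. h (real n) (\<xi> i \<omega>) \<partial>N) < \<eta>"
    by (rule order_tendstoD) (use \<eta> in simp)
  then obtain n where n: "(\<integral>\<omega>. h (real n) (\<xi> i \<omega>) \<partial>N) < \<eta>" unfolding eventually_sequentially by blast
  have "\<forall>\<^sub>F r in at_right 0. (\<integral>\<omega>. h (real n) (\<gamma> i r * Z0 r i \<omega>) \<partial>M) < \<eta>"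
    by (rule order_tendstoD(2)[OF initial_functional[OF hc hb i] n])
  with eventually_unit have "\<forall>\<^sub>F r in at_right 0. \<exists>E\<in>sets M. prob E \<ge> 1 - \<eta> \<and> (\<forall>\<omega>\<in>E. \<gamma> i r * Z0 r i \<omega> \<le> real n + 1)"
  proof eventually_elim
    case (elim r)
    let ?z = "\<lambda>\<omega>. \<gamma> i r * Z0 r i \<omega>"
    have zm: "?z \<in> borel_measurable M"
      by (rule borel_measurable_times[OF borel_measurable_const Z0_meas[OF elim(1) i]])
    define E where "E = {\<omega> \<in> space M. ?z \<omega> \<le> real n + 1}"
    have E: "E \<in> sets M" using zm unfolding E_def borel_measurable_iff_le by blast
    have "prob (space M - E) = (\<integral>\<omega>. indicator (space M - E) \<omega> \<partial>M)" using E by simp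
    also have "\<dots> \<le> (\<integral>\<omega>. h (real n) (?z \<omega>) \<partial>M)"
    proof (rule integral_mono)
      show "integrable M (\<lambda>\<omega>. h (real n) (?z \<omega>))"
        by (rule integrable_const_bound[where B = 1]) (use hb measurable_compose[OF zm hm] in auto)
      show "integrable M (indicat_real (space M - E))"
        using E by (intro integrable_real_indicator) (auto simp: emeasure_eq_measure)
      fix \<omega> assume "\<omega> \<in> space M"
      show "indicat_real (space M - E) \<omega> \<le> h (real n) (?z \<omega>)"
      proof (cases "\<omega> \<in> space M - E")
        case True
        then have "?z \<omega> > real n + 1" by (auto simp: E_def)
        then show ?thesis using True by (simp add: h_def)
      next
        case False then show ?thesis using h0 by simp
      qed
    qed
    finally have "prob E \<ge> 1 - \<eta>" using elim(2) prob_compl[OF E] by simp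
    then show ?case using E by (intro bexI[of _ E]) (auto simp: E_def)
  qed
  then show ?thesis by blast
qed

text \<open>
  The variance of \<open>u' L W\<close>, from \<open>\<Gamma> = L L'\<close>.
\<close>
lemma limit_variance_eq:
  assumes k: "k < J"
  defines "v \<equiv> \<lambda>m. \<Sum>l<J. u_vec J R k $ l * L $$ (l, m)"
  shows "limit_variance J \<Gamma> R k = (\<Sum>m<J. (v m)\<^sup>2)" and "limit_variance J \<Gamma> R k > 0"
proof -
  let ?u = "u_vec J R k"
  note up = u_vec_props[OF R_nonsingular R_carrier k]
  have Lc: "L \<in> carrier_mat J J" and GL: "\<Gamma> = L * transpose_mat L"
    using L unfolding cholesky_def by auto
  have Gc: "\<Gamma> \<in> carrier_mat J J" using Gamma unfolding pos_def_mat_def by simp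
  have G: "\<Gamma> $$ (i, j) = (\<Sum>m<J. L $$ (i, m) * L $$ (j, m))" if "i < J" "j < J" for i j
    using Lc that unfolding GL by (simp add: scalar_prod_def lessThan_atLeast0)
  have "limit_variance J \<Gamma> R k = (\<Sum>i<J. ?u $ i * (\<Sum>j<J. \<Gamma> $$ (i, j) * ?u $ j))"
    unfolding limit_variance_def using up(1) Gc by (simp add: scalar_prod_def lessThan_atLeast0)
  also have "\<dots> = (\<Sum>i<J. \<Sum>j<J. \<Sum>m<J. (?u $ i * L $$ (i, m)) * (?u $ j * L $$ (j, m)))"
    unfolding sum_distrib_left
    by (intro sum.cong refl) (simp add: G sum_distrib_left sum_distrib_right mult_ac)
  also have "\<dots> = (\<Sum>i<J. \<Sum>m<J. \<Sum>j<J. (?u $ i * L $$ (i, m)) * (?u $ j * L $$ (j, m)))"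
    by (intro sum.cong refl sum.swap)
  also have "\<dots> = (\<Sum>m<J. \<Sum>i<J. \<Sum>j<J. (?u $ i * L $$ (i, m)) * (?u $ j * L $$ (j, m)))"
    by (rule sum.swap)
  also have "\<dots> = (\<Sum>m<J. (v m)\<^sup>2)"
    unfolding v_def power2_eq_square sum_product ..
  finally show "limit_variance J \<Gamma> R k = (\<Sum>m<J. (v m)\<^sup>2)" .
  have "?u \<noteq> 0\<^sub>v J" using up(3) k by auto
  then show "limit_variance J \<Gamma> R k > 0"
    using Gamma up(1) unfolding limit_variance_def pos_def_mat_def by blast
qed

context
  fixes k assumes k: "k < J"
begin

text \<open>
  The network on the scale \<open>k\<close>: space scale \<open>g\<close>, drift ratios \<open>cc\<close>, initial state \<open>zz\<close>, noise \<open>BB\<close>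
  before and \<open>bb\<close> after multiplication by \<open>L\<close>, state \<open>zh\<close> and regulator \<open>yh\<close>.
\<close>
abbreviation "g r \<equiv> \<gamma> k r"
abbreviation "cc r i \<equiv> \<gamma> i r / \<gamma> k r"
abbreviation "zz r \<omega> i \<equiv> \<gamma> k r * Z0 r i \<omega>"
abbreviation "BB r m t \<omega> \<equiv> \<gamma> k r * W m (t / (\<gamma> k r)\<^sup>2) \<omega>"
abbreviation "bb r \<omega> l t \<equiv> \<Sum>m<J. L $$ (l, m) * (\<gamma> k r * W m (t / (\<gamma> k r)\<^sup>2) \<omega>)"
abbreviation "zh r \<omega> j t \<equiv> \<gamma> k r * Z r \<omega> j (t / (\<gamma> k r)\<^sup>2)"
abbreviation "yh r \<omega> j t \<equiv> \<gamma> k r * Y r \<omega> j (t / (\<gamma> k r)\<^sup>2)"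

lemma scaled_continuous:
  assumes r: "r \<in> {0<..<1}" and c: "continuous_on {0..} f"
  shows "continuous_on {0..} (\<lambda>t. \<gamma> k r * f (t / (\<gamma> k r)\<^sup>2))"
proof (intro continuous_on_mult continuous_on_const)
  show "continuous_on {0..} (\<lambda>t. f (t / (\<gamma> k r)\<^sup>2))"
    by (rule continuous_on_compose2[OF c]) (use gamma_pos[OF k r] in \<open>auto intro!: continuous_intros\<close>)
qed

text \<open>
  The scaled network as in the introduction, but with the drift \<open>- R c t\<close> still
  inside the input.
\<close>
lemma hat_reflected:
  assumes r: "r \<in> {0<..<1}" and \<omega>: "\<omega> \<in> space M"
  shows "reflected J (\<lambda>i j. R $$ (i, j))
    (\<lambda>j t. zz r \<omega> j + bb r \<omega> j t - (\<Sum>i<J. R $$ (j, i) * cc r i) * t) (zh r \<omega>) (yh r \<omega>)"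
proof -
  have g: "g r > 0" by (rule gamma_pos[OF k r])
  have sc: "reflected J (\<lambda>i j. R $$ (i, j))
      (\<lambda>j t. g r * srbm_input J L (\<theta> r) (Z0 r) W \<omega> j (t / (g r)\<^sup>2)) (zh r \<omega>) (yh r \<omega>)"
    by (rule reflected_scale[OF ZY_path(1)[OF r \<omega>] g])
  have eq: "g r * srbm_input J L (\<theta> r) (Z0 r) W \<omega> j (t / (g r)\<^sup>2)
      = zz r \<omega> j + bb r \<omega> j t - (\<Sum>i<J. R $$ (j, i) * cc r i) * t" if j: "j < J" for j t
  proof -
    have "(\<Sum>i<J. R $$ (j, i) * cc r i) = (\<Sum>i<J. R $$ (j, i) * \<gamma> i r) / g r"
      by (simp add: sum_divide_distrib)
    then have "(\<Sum>i<J. R $$ (j, i) * cc r i) * t = - (g r * (\<theta> r $ j * (t / (g r)\<^sup>2)))"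
      unfolding theta_index[OF r j] using g by (simp add: power2_eq_square)
    then show ?thesis
      by (simp add: srbm_input_def distrib_left sum_distrib_left mult.left_commute)
  qed
  show ?thesis by (rule reflected_cong[OF sc eq])
qed

lemma hat_measurable:
  assumes r: "r \<in> {0<..<1}" and j: "j < J" and t: "t \<ge> 0"
  shows "(\<lambda>\<omega>. zh r \<omega> j t) \<in> borel_measurable M" and "(\<lambda>\<omega>. yh r \<omega> j t) \<in> borel_measurable M"
  using ZY_measurable[OF r j, of "t / (g r)\<^sup>2"] t by (auto intro: borel_measurable_times)

lemma hat_continuous:
  assumes r: "r \<in> {0<..<1}" and \<omega>: "\<omega> \<in> space M" and j: "j < J"
  shows "continuous_on {0..} (zh r \<omega> j)" and "continuous_on {0..} (yh r \<omega> j)" and "continuous_on {0..} (bb r \<omega> j)"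
    and "bb r \<omega> j 0 = 0"
proof -
  show "continuous_on {0..} (zh r \<omega> j)" by (rule scaled_continuous[OF r ZY_path(2)[OF r \<omega> j]])
  show "continuous_on {0..} (yh r \<omega> j)" by (rule scaled_continuous[OF r ZY_path(3)[OF r \<omega> j]])
  show "continuous_on {0..} (bb r \<omega> j)"
  proof (rule continuous_on_sum, rule continuous_on_mult[OF continuous_on_const])
    fix m assume "m \<in> {..<J}"
    then have "continuous_on {0..} (\<lambda>t. W m t \<omega>)" using std_bmD(4)[OF W _ \<omega>] by simp
    from scaled_continuous[OF r this] show "continuous_on {0..} (\<lambda>t. g r * W m (t / (g r)\<^sup>2) \<omega>)" .
  qed
  show "bb r \<omega> j 0 = 0" using std_bmD(3)[OF W _ \<omega>] by simp
qed

lemma cc_nonneg: "r \<in> {0<..<1} \<Longrightarrow> i < J \<Longrightarrow> cc r i \<ge> 0"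
  using gamma_pos k by (simp add: less_imp_le)

lemma zz_nonneg: "r \<in> {0<..<1} \<Longrightarrow> \<omega> \<in> space M \<Longrightarrow> i < J \<Longrightarrow> zz r \<omega> i \<ge> 0"
  using gamma_pos[OF k] Z0_nonneg by (simp add: less_imp_le)

lemma cc_slow:
  assumes m: "k < m" "m < J" and e: "e > 0"
  shows "\<forall>\<^sub>F r in at_right 0. cc r m * T \<le> e"
proof -
  have "((\<lambda>r. cc r m * T) \<longlongrightarrow> 0 * T) (at_right 0)"
    by (rule tendsto_mult[OF gamma_sep[OF m] tendsto_const])
  then have "\<forall>\<^sub>F r in at_right 0. cc r m * T < e" by (rule order_tendstoD) (use e in simp)
  then show ?thesis by (rule eventually_mono) simp
qed

text \<open>
  Dividing by \<open>c\<^sub>i\<close>, the left side tends to \<open>\<rho>\<close> by separation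
  of the scales, and \<open>c\<^sub>i\<close> itself tends to infinity.
\<close>
lemma drift_dominates:
  assumes i: "i < k" and \<rho>: "\<rho> > 0"
  shows "\<forall>\<^sub>F r in at_right 0. \<rho> * cc r i - (\<Sum>m=Suc i..<J. P m * cc r m) \<ge> K"
proof -
  have iJ: "i < J" using i k by simp
  have "((\<lambda>r. \<rho> - (\<Sum>m=Suc i..<J. P m * (\<gamma> m r / \<gamma> i r))) \<longlongrightarrow> \<rho> - (\<Sum>m=Suc i..<J. P m * 0)) (at_right 0)"
    by (intro tendsto_diff tendsto_const tendsto_sum tendsto_mult gamma_sep) auto
  then have lim: "((\<lambda>r. \<rho> - (\<Sum>m=Suc i..<J. P m * (\<gamma> m r / \<gamma> i r))) \<longlongrightarrow> \<rho>) (at_right 0)" by simp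
  have "filterlim (\<lambda>r. inverse (\<gamma> k r / \<gamma> i r)) at_top (at_right 0)"
  proof (rule filterlim_inverse_at_top[OF gamma_sep[OF i k]])
    show "\<forall>\<^sub>F r in at_right 0. 0 < \<gamma> k r / \<gamma> i r"
      using eventually_unit by (rule eventually_mono) (use gamma_pos k iJ in simp)
  qed
  from filterlim_tendsto_pos_mult_at_top[OF lim \<rho> this]
  have "\<forall>\<^sub>F r in at_right 0. K \<le> (\<rho> - (\<Sum>m=Suc i..<J. P m * (\<gamma> m r / \<gamma> i r))) * inverse (\<gamma> k r / \<gamma> i r)"
    unfolding filterlim_at_top by blast
  with eventually_unit show ?thesis
  proof eventually_elim
    case (elim r)
    have pos: "\<gamma> i r > 0" "\<gamma> k r > 0" using gamma_pos[OF iJ elim(1)] gamma_pos[OF k elim(1)] by auto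
    have inv: "inverse (\<gamma> k r / \<gamma> i r) = cc r i" by simp
    have "(\<Sum>m=Suc i..<J. P m * (\<gamma> m r / \<gamma> i r)) * cc r i = (\<Sum>m=Suc i..<J. P m * cc r m)"
      unfolding sum_distrib_right using pos by (intro sum.cong) auto
    then show ?case using elim(2) unfolding inv left_diff_distrib by simp
  qed
qed

text \<open>
  On the scale \<open>\<gamma>\<^sub>i\<close> the initial state is tight, and the scale
  \<open>\<gamma>\<^sub>k\<close> is of smaller order.
\<close>
lemma initial_small:
  assumes i: "i < k" and e: "e > 0"
  shows "whp (at_right 0) M (\<lambda>r \<omega>. zz r \<omega> i \<le> e)"
proof (rule whp_tight[where Q = "\<lambda>A r \<omega>. \<gamma> i r * Z0 r i \<omega> \<le> A"])
  have iJ: "i < J" using i k by simp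
  show "\<exists>A. \<forall>\<^sub>F r in at_right 0. \<exists>E\<in>events. prob E \<ge> 1 - \<eta> \<and> (\<forall>\<omega>\<in>E. \<gamma> i r * Z0 r i \<omega> \<le> A)" if "\<eta> > 0" for \<eta>
    by (rule initial_tight[OF iJ that])
  fix A :: real
  have "((\<lambda>r. \<gamma> k r / \<gamma> i r * max A 1) \<longlongrightarrow> 0 * max A 1) (at_right 0)"
    by (rule tendsto_mult[OF gamma_sep[OF i k] tendsto_const])
  then have "\<forall>\<^sub>F r in at_right 0. \<gamma> k r / \<gamma> i r * max A 1 < e" by (rule order_tendstoD) (use e in simp)
  with eventually_unit have ev: "\<forall>\<^sub>F r in at_right 0. \<forall>\<omega>\<in>space M. True \<longrightarrow> (\<gamma> i r * Z0 r i \<omega> \<le> A \<longrightarrow> zz r \<omega> i \<le> e)"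
  proof eventually_elim
    case (elim r)
    have pos: "\<gamma> i r > 0" "\<gamma> k r > 0" using gamma_pos[OF iJ elim(1)] gamma_pos[OF k elim(1)] by auto
    show ?case
    proof (intro ballI impI)
      fix \<omega> assume A: "\<gamma> i r * Z0 r i \<omega> \<le> A"
      have "zz r \<omega> i = \<gamma> k r / \<gamma> i r * (\<gamma> i r * Z0 r i \<omega>)" using pos by simp
      also have "\<dots> \<le> \<gamma> k r / \<gamma> i r * max A 1" using A pos by (intro mult_left_mono) auto
      finally show "zz r \<omega> i \<le> e" using elim(2) by linarith
    qed
  qed
  show "whp (at_right 0) M (\<lambda>r \<omega>. \<gamma> i r * Z0 r i \<omega> \<le> A \<longrightarrow> zz r \<omega> i \<le> e)"
    by (rule whp_mono[OF whp_True ev])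
qed

lemma initial_large:
  assumes j: "k < j" "j < J"
  shows "whp (at_right 0) M (\<lambda>r \<omega>. zz r \<omega> j \<ge> K)"
proof (rule whpI)
  fix \<eta> :: real assume \<eta>: "\<eta> > 0"
  have j1: "j - 1 < J" "k \<le> j - 1" "1 \<le> j" using j by auto
  have "((\<lambda>r. prob {\<omega> \<in> space M. \<gamma> (j - 1) r * Z0 r j \<omega> > K}) \<longlongrightarrow> 1) (at_right 0)"
    using initial_sep[OF j1(3) j(2)] unfolding tends_to_infinity_in_probability_def by blast
  then have "\<forall>\<^sub>F r in at_right 0. prob {\<omega> \<in> space M. \<gamma> (j - 1) r * Z0 r j \<omega> > K} > 1 - \<eta>"
    by (rule order_tendstoD) (use \<eta> in simp)
  moreover have "\<forall>\<^sub>F r in at_right 0. \<gamma> (j - 1) r \<le> \<gamma> k r"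
  proof (cases "k = j - 1")
    case True then show ?thesis by simp
  next
    case False
    then have "k < j - 1" using j1(2) by simp
    from gamma_sep[OF this j1(1)] have "\<forall>\<^sub>F r in at_right 0. \<gamma> (j - 1) r / \<gamma> k r < 1"
      by (rule order_tendstoD) simp
    with eventually_unit show ?thesis
    proof eventually_elim
      case (elim r)
      then show ?case using gamma_pos[OF k elim(1)] by (simp add: pos_divide_less_eq)
    qed
  qed
  ultimately show "\<forall>\<^sub>F r in at_right 0. \<exists>E\<in>events. prob E \<ge> 1 - \<eta> \<and> (\<forall>\<omega>\<in>E. zz r \<omega> j \<ge> K)"
    using eventually_unit
  proof eventually_elim
    case (elim r)
    let ?E = "{\<omega> \<in> space M. \<gamma> (j - 1) r * Z0 r j \<omega> > K}"
    have "(\<lambda>\<omega>. \<gamma> (j - 1) r * Z0 r j \<omega>) \<in> borel_measurable M"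
      by (rule borel_measurable_times[OF borel_measurable_const Z0_meas[OF elim(3) j(2)]])
    then have "?E \<in> events" unfolding borel_measurable_iff_greater by blast
    moreover have "zz r \<omega> j \<ge> K" if "\<omega> \<in> ?E" for \<omega>
    proof -
      have "\<gamma> (j - 1) r * Z0 r j \<omega> \<le> \<gamma> k r * Z0 r j \<omega>"
        using elim(2) Z0_nonneg[OF elim(3) j(2)] that by (intro mult_right_mono) auto
      then show ?thesis using that by simp
    qed
    ultimately show ?case using elim(1) by (intro bexI[of _ ?E]) auto
  qed
qed

lemma scaled_bm:
  assumes r: "r \<in> {0<..<1}" and c: "(\<Sum>m<J. (c m)\<^sup>2) = 1"
  shows "std_brownian_motion M 1 (\<lambda>_ t \<omega>. \<Sum>m<J. c m * BB r m t \<omega>)"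
  by (rule bm_combination[OF W c gamma_pos[OF k r]])

lemma scaled_bm_coordinate:
  assumes r: "r \<in> {0<..<1}" and m: "m < J"
  shows "std_brownian_motion M 1 (\<lambda>_ t \<omega>. BB r m t \<omega>)"
proof -
  have "(\<Sum>l<J. (if l = m then 1 else 0 :: real)\<^sup>2) = (\<Sum>l<J. if l = m then 1 else 0)"
    by (rule sum.cong) auto
  also have "\<dots> = 1" using m by simp
  finally have "(\<Sum>l<J. (if l = m then 1 else 0 :: real)\<^sup>2) = 1" .
  from scaled_bm[OF r this] have "std_brownian_motion M 1 (\<lambda>_ t \<omega>. \<Sum>l<J. (if l = m then 1 else 0) * BB r l t \<omega>)" .
  moreover have "(\<Sum>l<J. (if l = m then 1 else 0) * BB r l t \<omega>) = BB r m t \<omega>" for t \<omega>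
    using m by (simp add: if_distrib[of "\<lambda>x. x * _"] cong: if_cong)
  ultimately show ?thesis by simp
qed

definition total_L :: real where "total_L = 1 + (\<Sum>l<J. \<Sum>m<J. \<bar>L $$ (l, m)\<bar>)"

lemma total_L: "total_L > 0" "l < J \<Longrightarrow> (\<Sum>m<J. \<bar>L $$ (l, m)\<bar>) \<le> total_L"
proof -
  have nn: "(\<Sum>m<J. \<bar>L $$ (l, m)\<bar>) \<ge> 0" for l by (intro sum_nonneg) simp
  then show "total_L > 0" unfolding total_L_def by (intro add_pos_nonneg sum_nonneg) auto
  assume "l < J"
  then have "(\<Sum>m<J. \<bar>L $$ (l, m)\<bar>) \<le> (\<Sum>l<J. \<Sum>m<J. \<bar>L $$ (l, m)\<bar>)"
    using nn by (intro member_le_sum[of l "{..<J}" "\<lambda>l. \<Sum>m<J. \<bar>L $$ (l, m)\<bar>"]) auto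
  then show "(\<Sum>m<J. \<bar>L $$ (l, m)\<bar>) \<le> total_L" unfolding total_L_def by simp
qed

text \<open>
  The coordinates of the scaled noise have the law of one and the same Brownian motion for all
  \<open>r\<close>; the scale \<open>r = 1 / 2\<close> serves as the reference.
\<close>
lemma noise_tight:
  assumes \<eta>: "\<eta> > 0" and e: "e > 0"
  shows "\<exists>n. \<forall>\<^sub>F r in at_right 0. \<exists>E\<in>events. prob E \<ge> 1 - \<eta> \<and>
    (\<forall>\<omega>\<in>E. \<forall>m<J. modulus_ok T e n (\<lambda>t. BB r m t \<omega>))"
proof -
  have half: "(1/2 :: real) \<in> {0<..<1}" by simp
  have J0: "0 < J" using J by simp
  note ref = scaled_bm_coordinate[OF half J0]
  have \<eta>J: "\<eta> / real J > 0" using \<eta> J0 by simp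
  obtain n where n: "prob {\<omega> \<in> space M. modulus_ok T e n (\<lambda>t. BB (1/2) 0 t \<omega>)} \<ge> 1 - \<eta> / real J"
    using bm_tight[OF ref \<eta>J e, of T] by blast
  have "\<forall>\<^sub>F r in at_right 0. \<exists>E\<in>events. prob E \<ge> 1 - \<eta> \<and> (\<forall>\<omega>\<in>E. \<forall>m<J. modulus_ok T e n (\<lambda>t. BB r m t \<omega>))"
    using eventually_unit
  proof eventually_elim
    case (elim r)
    let ?E = "\<lambda>m. {\<omega> \<in> space M. modulus_ok T e n (\<lambda>t. BB r m t \<omega>)}"
    have "\<exists>A\<in>events. prob A \<ge> 1 - real J * (\<eta> / real J) \<and> (\<forall>\<omega>\<in>A. \<forall>m<J. \<omega> \<in> ?E m)"
    proof (rule prob_finite_INT_ge)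
      fix m assume m: "m < J"
      note bm = scaled_bm_coordinate[OF elim m]
      show "?E m \<in> events" by (rule modulus_ok_event(3)[OF bm])
      show "prob (?E m) \<ge> 1 - \<eta> / real J" using n modulus_ok_prob_eq[OF bm ref, of T e n] by simp
    qed
    then show ?case using J0 by auto
  qed
  then show ?thesis by blast
qed

lemma noise_bounds:
  assumes ok: "\<And>m. m < J \<Longrightarrow> modulus_ok T e n (\<lambda>t. BB r m t \<omega>)" and l: "l < J" and e: "e \<ge> 0"
  shows "0 \<le> t \<Longrightarrow> t \<le> T \<Longrightarrow> \<bar>bb r \<omega> l t\<bar> \<le> total_L * real n"
    and "0 \<le> s \<Longrightarrow> s \<le> t \<Longrightarrow> t \<le> T \<Longrightarrow> t - s < 1 / real (Suc n) \<Longrightarrow> \<bar>bb r \<omega> l t - bb r \<omega> l s\<bar> \<le> total_L * e"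
proof -
  have gen: "\<bar>\<Sum>m<J. L $$ (l, m) * h m\<bar> \<le> total_L * c" if h: "\<And>m. m < J \<Longrightarrow> \<bar>h m\<bar> \<le> c" and c: "c \<ge> 0" for h c
  proof -
    have "\<bar>\<Sum>m<J. L $$ (l, m) * h m\<bar> \<le> (\<Sum>m<J. \<bar>L $$ (l, m) * h m\<bar>)" by (rule sum_abs)
    also have "\<dots> \<le> (\<Sum>m<J. \<bar>L $$ (l, m)\<bar> * c)"
      unfolding abs_mult using h by (intro sum_mono mult_left_mono) auto
    also have "\<dots> = (\<Sum>m<J. \<bar>L $$ (l, m)\<bar>) * c" by (rule sum_distrib_right[symmetric])
    also have "\<dots> \<le> total_L * c" using total_L(2)[OF l] c by (rule mult_right_mono)
    finally show ?thesis .
  qed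
  show "\<bar>bb r \<omega> l t\<bar> \<le> total_L * real n" if t: "0 \<le> t" "t \<le> T"
  proof (rule gen)
    fix m assume "m < J"
    then show "\<bar>BB r m t \<omega>\<bar> \<le> real n" using ok[of m] t unfolding modulus_ok_def by simp
  qed simp
  show "\<bar>bb r \<omega> l t - bb r \<omega> l s\<bar> \<le> total_L * e" if st: "0 \<le> s" "s \<le> t" "t \<le> T" "t - s < 1 / real (Suc n)"
  proof -
    have "\<bar>\<Sum>m<J. L $$ (l, m) * (BB r m t \<omega> - BB r m s \<omega>)\<bar> \<le> total_L * e"
    proof (rule gen[OF _ e])
      fix m assume "m < J"
      have "\<bar>t - s\<bar> < 1 / real (Suc n)" "t \<in> {0..T}" "s \<in> {0..T}" using st by auto
      then show "\<bar>BB r m t \<omega> - BB r m s \<omega>\<bar> \<le> e" using ok[OF \<open>m < J\<close>] unfolding modulus_ok_def by blast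
    qed
    moreover have "(\<Sum>m<J. L $$ (l, m) * (BB r m t \<omega> - BB r m s \<omega>)) = bb r \<omega> l t - bb r \<omega> l s"
      by (simp only: right_diff_distrib sum_subtractf)
    ultimately show ?thesis by simp
  qed
qed

lemma slow_free:
  assumes T: "T \<ge> 0"
  shows "whp (at_right 0) M (\<lambda>r \<omega>. \<forall>j\<in>{Suc k..<J}. \<forall>t\<in>{0..T}. yh r \<omega> j t = 0)"
proof (rule whp_tight[where Q = "\<lambda>n r \<omega>. \<forall>m<J. modulus_ok T 1 n (\<lambda>t. BB r m t \<omega>)"])
  show "\<exists>n. \<forall>\<^sub>F r in at_right 0. \<exists>E\<in>events. prob E \<ge> 1 - \<eta> \<and>
    (\<forall>\<omega>\<in>E. \<forall>m<J. modulus_ok T 1 n (\<lambda>t. BB r m t \<omega>))" if "\<eta> > 0" for \<eta>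
    by (rule noise_tight[OF that]) simp
  fix n :: nat
  have kJ: "Suc k \<le> J" using k by simp
  obtain a where a: "\<And>i. a i \<ge> 0" "\<And>i. i < Suc k \<Longrightarrow> (\<Sum>j<Suc k. R $$ (i, j) * a j) = 1"
    using unit_potential[OF R_nonsingular R_carrier kJ] by metis
  define \<beta> where "\<beta> = total_L * real n"
  have \<beta>0: "\<beta> \<ge> 0" using total_L(1) by (simp add: \<beta>_def)
  define K where "K = (\<lambda>j. \<beta> + \<beta> * (\<Sum>i<Suc k. \<bar>R $$ (j, i)\<bar> * a i) + \<bar>R $$ (j, j)\<bar> * 1)"
  have large: "whp (at_right 0) M (\<lambda>r \<omega>. \<forall>j\<in>{Suc k..<J}. zz r \<omega> j \<ge> K j)"
    by (intro whp_ball initial_large) auto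
  have slow: "\<forall>\<^sub>F r in at_right 0. \<forall>j\<in>{Suc k..<J}. cc r j * T \<le> 1"
    by (intro eventually_ball_finite ballI cc_slow) auto
  show "whp (at_right 0) M (\<lambda>r \<omega>. (\<forall>m<J. modulus_ok T 1 n (\<lambda>t. BB r m t \<omega>)) \<longrightarrow>
      (\<forall>j\<in>{Suc k..<J}. \<forall>t\<in>{0..T}. yh r \<omega> j t = 0))"
  proof (rule whp_mono[OF large])
    show "\<forall>\<^sub>F r in at_right 0. \<forall>\<omega>\<in>space M. (\<forall>j\<in>{Suc k..<J}. zz r \<omega> j \<ge> K j) \<longrightarrow>
        (\<forall>m<J. modulus_ok T 1 n (\<lambda>t. BB r m t \<omega>)) \<longrightarrow> (\<forall>j\<in>{Suc k..<J}. \<forall>t\<in>{0..T}. yh r \<omega> j t = 0)"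
      using eventually_unit slow
    proof eventually_elim
      case (elim r)
      show ?case
      proof (intro ballI impI)
        fix \<omega> j t assume \<omega>: "\<omega> \<in> space M" and zK: "\<forall>j\<in>{Suc k..<J}. zz r \<omega> j \<ge> K j"
          and ok: "\<forall>m<J. modulus_ok T 1 n (\<lambda>t. BB r m t \<omega>)" and j: "j \<in> {Suc k..<J}" and t: "t \<in> {0..T}"
        show "yh r \<omega> j t = 0"
        proof (rule slow_coordinates_free[OF R_nonsingular R_carrier hat_reflected[OF elim(1) \<omega>]
              cc_nonneg[OF elim(1)] zz_nonneg[OF elim(1) \<omega>] hat_continuous(4)[OF elim(1) \<omega>] k a \<beta>0])
          show "\<bar>bb r \<omega> i t\<bar> \<le> \<beta>" if "i < J" "0 \<le> t" "t \<le> T" for i t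
            unfolding \<beta>_def by (rule noise_bounds(1)[OF _ that(1) zero_le_one that(2,3)]) (use ok in blast)
          show "\<beta> + \<beta> * (\<Sum>i<Suc k. \<bar>R $$ (j, i)\<bar> * a i) + \<bar>R $$ (j, j)\<bar> * cc r j * T \<le> zz r \<omega> j"
            if j: "k < j" "j < J" for j
          proof -
            have "\<bar>R $$ (j, j)\<bar> * (cc r j * T) \<le> \<bar>R $$ (j, j)\<bar> * 1"
              using elim(2) j by (intro mult_left_mono) auto
            moreover have "K j \<le> zz r \<omega> j" using zK j by simp
            ultimately show ?thesis unfolding K_def by (simp only: mult.assoc)
          qed
          show "k < j" "j < J" "0 \<le> t" "t \<le> T" using j t by auto
        qed
      qed
    qed
  qed
qed

text \<open>
  Induction over the coordinates, fastest first. The accuracy demanded of the faster coordinates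
  and of the modulus of the noise is such that the total error is \<open>e\<close>.
\<close>
lemma fast_collapse:
  assumes i: "i < k" and e: "e > 0" and T: "T \<ge> 0"
  shows "whp (at_right 0) M (\<lambda>r \<omega>. \<forall>t\<in>{0..T}. zh r \<omega> i t \<le> e)"
  using i e
proof (induction i arbitrary: e rule: less_induct)
  case (less i)
  have iJ: "i < J" using less.prems(1) k by simp
  note up = u_vec_props[OF R_nonsingular R_carrier iJ]
  define U where "U = (\<Sum>l<J. u_vec J R i $ l)"
  have U0: "U \<ge> 0" unfolding U_def using up(2) by (intro sum_nonneg) auto
  define \<epsilon> where "\<epsilon> = e / (1 + 2 * U)"
  have \<epsilon>: "\<epsilon> > 0" using less.prems(2) U0 by (simp add: \<epsilon>_def add_pos_nonneg)
  have \<epsilon>e: "(1 + 2 * U) * \<epsilon> = e"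
  proof -
    have "1 + 2 * U \<noteq> 0" using U0 by linarith
    then show ?thesis unfolding \<epsilon>_def by simp
  qed
  define e0 where "e0 = \<epsilon> / total_L"
  have e0: "e0 > 0" "total_L * e0 = \<epsilon>" using \<epsilon> total_L(1) by (auto simp: e0_def)
  have lower: "whp (at_right 0) M (\<lambda>r \<omega>. \<forall>l\<in>{..<i}. \<forall>t\<in>{0..T}. zh r \<omega> l t \<le> \<epsilon>)"
    by (intro whp_ball less.IH) (use less.prems \<epsilon> in auto)
  note base = whp_conj[OF lower initial_small[OF less.prems(1) \<epsilon>]]
  show ?case
  proof (rule whp_tight[where Q = "\<lambda>n r \<omega>. \<forall>m<J. modulus_ok T e0 n (\<lambda>t. BB r m t \<omega>)"])
    show "\<exists>n. \<forall>\<^sub>F r in at_right 0. \<exists>E\<in>events. prob E \<ge> 1 - \<eta> \<and>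
        (\<forall>\<omega>\<in>E. \<forall>m<J. modulus_ok T e0 n (\<lambda>t. BB r m t \<omega>))" if "\<eta> > 0" for \<eta>
      by (rule noise_tight[OF that e0(1)])
    fix n :: nat
    define \<beta> where "\<beta> = total_L * real n"
    define \<delta> where "\<delta> = 1 / real (Suc n)"
    have \<delta>: "\<delta> > 0" by (simp add: \<delta>_def)
    have \<rho>: "- limit_drift R i > 0" using up(8) by simp
    note dom = drift_dominates[OF less.prems(1) \<rho>, where P = "\<lambda>m. \<bar>\<Sum>l<J. u_vec J R i $ l * R $$ (l, m)\<bar>"
        and K = "2 * (\<Sum>l<J. u_vec J R i $ l) * \<beta> / \<delta>"]
    show "whp (at_right 0) M (\<lambda>r \<omega>. (\<forall>m<J. modulus_ok T e0 n (\<lambda>t. BB r m t \<omega>)) \<longrightarrow>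
        (\<forall>t\<in>{0..T}. zh r \<omega> i t \<le> e))"
    proof (rule whp_mono[OF base])
      show "\<forall>\<^sub>F r in at_right 0. \<forall>\<omega>\<in>space M.
          (\<forall>l\<in>{..<i}. \<forall>t\<in>{0..T}. zh r \<omega> l t \<le> \<epsilon>) \<and> zz r \<omega> i \<le> \<epsilon> \<longrightarrow>
          (\<forall>m<J. modulus_ok T e0 n (\<lambda>t. BB r m t \<omega>)) \<longrightarrow> (\<forall>t\<in>{0..T}. zh r \<omega> i t \<le> e)"
        using eventually_unit dom
      proof eventually_elim
        case (elim r)
        show ?case
        proof (intro ballI impI)
          fix \<omega> t assume \<omega>: "\<omega> \<in> space M"
            and small: "(\<forall>l\<in>{..<i}. \<forall>t\<in>{0..T}. zh r \<omega> l t \<le> \<epsilon>) \<and> zz r \<omega> i \<le> \<epsilon>"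
            and ok: "\<forall>m<J. modulus_ok T e0 n (\<lambda>t. BB r m t \<omega>)" and t: "t \<in> {0..T}"
          have "zh r \<omega> i t \<le> (1 + 2 * (\<Sum>l<J. u_vec J R i $ l)) * \<epsilon>"
          proof (rule fast_coordinate_small[OF R_nonsingular R_carrier hat_reflected[OF elim(1) \<omega>]
                cc_nonneg[OF elim(1)] zz_nonneg[OF elim(1) \<omega>] hat_continuous(4)[OF elim(1) \<omega>] iJ _ \<delta>])
            show "0 \<le> \<epsilon>" using \<epsilon> by simp
            show "zh r \<omega> l s \<le> \<epsilon>" if "l < i" "0 \<le> s" "s \<le> T" for l s
              using conjunct1[OF small] that by simp
            show "zz r \<omega> i \<le> \<epsilon>" by (rule conjunct2[OF small])
            show "\<bar>bb r \<omega> l t\<bar> \<le> \<beta>" if "l < J" "0 \<le> t" "t \<le> T" for l t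
              unfolding \<beta>_def by (rule noise_bounds(1)[OF _ that(1) less_imp_le[OF e0(1)] that(2,3)]) (use ok in blast)
            show "\<bar>bb r \<omega> l t - bb r \<omega> l s\<bar> \<le> \<epsilon>" if "l < J" "0 \<le> s" "s \<le> t" "t \<le> T" "t - s < \<delta>" for l s t
              unfolding e0(2)[symmetric]
              by (rule noise_bounds(2)[OF _ that(1) less_imp_le[OF e0(1)] that(2-4) that(5)[unfolded \<delta>_def]]) (use ok in blast)
            show "0 \<le> t" "t \<le> T" using t by auto
          qed (assumption | rule elim(2))+
          then show "zh r \<omega> i t \<le> e" using \<epsilon>e by (simp add: U_def)
        qed
      qed
    qed
  qed
qed

text \<open>
  The noise \<open>u' L W\<close> of the active coordinate is the Brownian motion \<open>bm\<close> times its standard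
  deviation \<open>sd\<close>.
\<close>
abbreviation "vv m \<equiv> \<Sum>l<J. u_vec J R k $ l * L $$ (l, m)"
abbreviation "sd \<equiv> sqrt (limit_variance J \<Gamma> R k)"
abbreviation "bm r \<equiv> \<lambda>(_::nat) t \<omega>. \<Sum>m<J. vv m / sd * BB r m t \<omega>"

lemma sd_pos: "sd > 0"
  using limit_variance_eq(2)[OF k] by simp

lemma bm_std:
  assumes r: "r \<in> {0<..<1}"
  shows "std_brownian_motion M 1 (bm r)"
proof (rule scaled_bm[OF r])
  have "(\<Sum>m<J. (vv m / sd)\<^sup>2) = (\<Sum>m<J. (vv m)\<^sup>2 / sd\<^sup>2)"
    by (rule sum.cong[OF refl]) (rule power_divide)
  also have "\<dots> = (\<Sum>m<J. (vv m)\<^sup>2) / sd\<^sup>2" by (rule sum_divide_distrib[symmetric])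
  also have "\<dots> = 1" using limit_variance_eq[OF k] by simp
  finally show "(\<Sum>m<J. (vv m / sd)\<^sup>2) = 1" .
qed

text \<open>
  The initial state and the noise on the scale \<open>k\<close> are measurable functions of the
  initial state and of the Brownian motion of the network.
\<close>
lemma bm_indep:
  assumes r: "r \<in> {0<..<1}"
  shows "indep_elements M borel (\<lambda>\<omega>. zz r \<omega> k) (process_space 1) (process_element 1 (bm r))"
proof (rule indep_elements_map[OF Z0_indep[OF r] prob_space_axioms])
  show "(\<lambda>v. g r * v k) \<in> borel_measurable (Pi\<^sub>M {..<J} (\<lambda>_. borel))"
  proof (intro borel_measurable_times borel_measurable_const)
    show "(\<lambda>v. v k) \<in> borel_measurable (Pi\<^sub>M {..<J} (\<lambda>_. borel))"
      by (rule measurable_component_singleton) (use k in simp)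
  qed
  show "(\<lambda>w. \<lambda>p\<in>{..<1} \<times> {0..}. \<Sum>m<J. vv m / sd * (g r * w (m, snd p / (g r)\<^sup>2))) \<in> measurable (process_space J) (process_space 1)"
  proof (rule measurable_restrict, intro borel_measurable_sum borel_measurable_times borel_measurable_const)
    fix p :: "nat \<times> real" and m assume p: "p \<in> {..<1} \<times> {0..}" and m: "m \<in> {..<J}"
    have "snd p / (g r)\<^sup>2 \<ge> 0" using p by auto
    then show "(\<lambda>w. w (m, snd p / (g r)\<^sup>2)) \<in> borel_measurable (process_space J)"
      using m by (intro measurable_component_singleton) auto
  qed
  show "zz r \<omega> k = g r * (\<lambda>j\<in>{..<J}. Z0 r j \<omega>) k" for \<omega> using k by simp
  show "process_element 1 (bm r) \<omega> = (\<lambda>p\<in>{..<1} \<times> {0..}. \<Sum>m<J. vv m / sd * (g r * process_element J W \<omega> (m, snd p / (g r)\<^sup>2)))" for \<omega>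
    by (auto simp: process_element_def fun_eq_iff restrict_def)
qed

lemma bm_path_eq:
  assumes r: "r \<in> {0<..<1}" and \<omega>: "\<omega> \<in> space M"
  shows "(\<lambda>t. zz r \<omega> k + limit_drift R k * t + (\<Sum>l<J. u_vec J R k $ l * bb r \<omega> l t))
    = (\<lambda>t. max 0 (zz r \<omega> k) + limit_drift R k * t + sd * (bm r 0 t \<omega> - bm r 0 0 \<omega>))"
proof
  fix t
  have "(\<Sum>l<J. u_vec J R k $ l * bb r \<omega> l t) = (\<Sum>l<J. \<Sum>m<J. u_vec J R k $ l * L $$ (l, m) * BB r m t \<omega>)"
    by (simp only: sum_distrib_left mult.assoc)
  also have "\<dots> = (\<Sum>m<J. vv m * BB r m t \<omega>)"
    by (subst sum.swap) (simp only: sum_distrib_right)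
  also have "\<dots> = sd * bm r 0 t \<omega>"
    unfolding sum_distrib_left using sd_pos by (intro sum.cong) auto
  finally have "(\<Sum>l<J. u_vec J R k $ l * bb r \<omega> l t) = sd * (bm r 0 t \<omega> - bm r 0 0 \<omega>)"
    using bm_zero[OF bm_std[OF r] \<omega>] by simp
  then show "zz r \<omega> k + limit_drift R k * t + (\<Sum>l<J. u_vec J R k $ l * bb r \<omega> l t)
    = max 0 (zz r \<omega> k) + limit_drift R k * t + sd * (bm r 0 t \<omega> - bm r 0 0 \<omega>)"
    using zz_nonneg[OF r \<omega> k] by (simp only: max.absorb2)
qed

lemma active_close:
  assumes T: "T \<ge> 0" and e: "e > 0"
  shows "whp (at_right 0) M (\<lambda>r \<omega>. \<forall>t\<in>{0..T}.
    \<bar>zh r \<omega> k t - srbm_path (zz r \<omega> k) (limit_drift R k) sd (\<lambda>t. bm r 0 t \<omega>) t\<bar> \<le> e)"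
proof -
  define D where "D = (\<Sum>l<J. u_vec J R k $ l) + (\<Sum>m=Suc k..<J. \<bar>\<Sum>l<J. u_vec J R k $ l * R $$ (l, m)\<bar>)"
  have D0: "D \<ge> 0" unfolding D_def using u_vec_props(2)[OF R_nonsingular R_carrier k]
    by (intro add_nonneg_nonneg sum_nonneg) auto
  define \<epsilon> where "\<epsilon> = e / (2 * D + 1)"
  have \<epsilon>: "\<epsilon> > 0" using e D0 by (simp add: \<epsilon>_def add_nonneg_pos)
  have "2 * D + 1 \<noteq> 0" using D0 by linarith
  then have "(2 * D + 1) * \<epsilon> = e" unfolding \<epsilon>_def by simp
  then have \<epsilon>e: "2 * (D * \<epsilon>) \<le> e" using \<epsilon> by (simp add: algebra_simps)
  have fast: "whp (at_right 0) M (\<lambda>r \<omega>. \<forall>l\<in>{..<k}. \<forall>t\<in>{0..T}. zh r \<omega> l t \<le> \<epsilon>)"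
    by (intro whp_ball fast_collapse \<epsilon> T) auto
  have init: "whp (at_right 0) M (\<lambda>r \<omega>. \<forall>l\<in>{..<k}. zz r \<omega> l \<le> \<epsilon>)"
    by (intro whp_ball initial_small \<epsilon>) auto
  have slow: "\<forall>\<^sub>F r in at_right 0. \<forall>j\<in>{Suc k..<J}. cc r j * T \<le> \<epsilon>"
    by (intro eventually_ball_finite ballI cc_slow \<epsilon>) auto
  show ?thesis
  proof (rule whp_mono[OF whp_conj[OF whp_conj[OF fast init] slow_free[OF T]]])
    show "\<forall>\<^sub>F r in at_right 0. \<forall>\<omega>\<in>space M.
        ((\<forall>l\<in>{..<k}. \<forall>t\<in>{0..T}. zh r \<omega> l t \<le> \<epsilon>) \<and> (\<forall>l\<in>{..<k}. zz r \<omega> l \<le> \<epsilon>)) \<and>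
        (\<forall>j\<in>{Suc k..<J}. \<forall>t\<in>{0..T}. yh r \<omega> j t = 0) \<longrightarrow>
        (\<forall>t\<in>{0..T}. \<bar>zh r \<omega> k t - srbm_path (zz r \<omega> k) (limit_drift R k) sd (\<lambda>t. bm r 0 t \<omega>) t\<bar> \<le> e)"
      using eventually_unit slow
    proof eventually_elim
      case (elim r)
      show ?case
      proof (intro ballI impI)
        fix \<omega> t assume \<omega>: "\<omega> \<in> space M" and t: "t \<in> {0..T}"
          and hyp: "((\<forall>l\<in>{..<k}. \<forall>t\<in>{0..T}. zh r \<omega> l t \<le> \<epsilon>) \<and> (\<forall>l\<in>{..<k}. zz r \<omega> l \<le> \<epsilon>)) \<and>
            (\<forall>j\<in>{Suc k..<J}. \<forall>t\<in>{0..T}. yh r \<omega> j t = 0)"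
        have "\<bar>zh r \<omega> k t - Phi1 (\<lambda>t. zz r \<omega> k + limit_drift R k * t + (\<Sum>l<J. u_vec J R k $ l * bb r \<omega> l t)) t\<bar>
            \<le> 2 * (((\<Sum>l<J. u_vec J R k $ l) + (\<Sum>m=Suc k..<J. \<bar>\<Sum>l<J. u_vec J R k $ l * R $$ (l, m)\<bar>)) * \<epsilon>)"
        proof (rule active_coordinate_close[OF R_nonsingular R_carrier hat_reflected[OF elim(1) \<omega>]
              cc_nonneg[OF elim(1)] zz_nonneg[OF elim(1) \<omega>] hat_continuous(4)[OF elim(1) \<omega>] k])
          show "cc r k = 1" using gamma_pos[OF k elim(1)] by simp
          show "continuous_on {0..} (zh r \<omega> k)" "continuous_on {0..} (yh r \<omega> k)"
            using hat_continuous(1,2)[OF elim(1) \<omega> k] by auto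
          show "continuous_on {0..} (bb r \<omega> l)" if "l < J" for l by (rule hat_continuous(3)[OF elim(1) \<omega> that])
          show "0 \<le> \<epsilon>" using \<epsilon> by simp
          show "zh r \<omega> l s \<le> \<epsilon>" if "l < k" "0 \<le> s" "s \<le> T" for l s
            using conjunct1[OF conjunct1[OF hyp]] that by simp
          show "zz r \<omega> l \<le> \<epsilon>" if "l < k" for l using conjunct2[OF conjunct1[OF hyp]] that by simp
          show "yh r \<omega> m s = 0" if "k < m" "m < J" "0 \<le> s" "s \<le> T" for m s
            using bspec[OF bspec[OF conjunct2[OF hyp], of m], of s] that by simp
          show "cc r m * T \<le> \<epsilon>" if "k < m" "m < J" for m using elim(2) that by simp
          show "0 \<le> t" "t \<le> T" using t by auto
        qed
        then show "\<bar>zh r \<omega> k t - srbm_path (zz r \<omega> k) (limit_drift R k) sd (\<lambda>t. bm r 0 t \<omega>) t\<bar> \<le> e"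
          unfolding srbm_path_def bm_path_eq[OF elim(1) \<omega>] D_def[symmetric] using \<epsilon>e by linarith
      qed
    qed
  qed
qed

text \<open>
  Compactness in probability of initial state and noise: the moduli for all horizons
  \<open>m\<close> and accuracies \<open>1 / (m + 1)\<close> hold together, with failure
  probabilities summing to at most \<open>\<eta> / 2\<close>.
\<close>
lemma input_tight:
  assumes \<eta>: "\<eta> > 0"
  shows "\<exists>p. \<forall>\<^sub>F r in at_right 0. \<exists>E\<in>events. prob E \<ge> 1 - \<eta> \<and>
    (\<forall>\<omega>\<in>E. zz r \<omega> k \<le> fst p \<and> (\<forall>m. modulus_ok (real m) (1 / real (Suc m)) (snd p m) (\<lambda>t. bm r 0 t \<omega>)))"
proof -
  have half: "(1/2 :: real) \<in> {0<..<1}" by simp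
  note ref = bm_std[OF half]
  have \<eta>2: "\<eta> / 2 > 0" using \<eta> by simp
  define q where "q = (\<lambda>m n. prob {\<omega> \<in> space M. modulus_ok (real m) (1 / real (Suc m)) n (\<lambda>t. bm (1/2) 0 t \<omega>)})"
  have "\<exists>n. q m n \<ge> 1 - \<eta> / 2 * (1 / 2) ^ Suc m" for m
  proof -
    have pos: "\<eta> / 2 * (1 / 2) ^ Suc m > 0" using \<eta>2 by simp
    have e: "1 / real (Suc m) > 0" by simp
    show ?thesis unfolding q_def by (rule bm_tight[OF ref pos e, of "real m"]) (rule exI)
  qed
  then obtain ns where ns': "\<And>m. q m (ns m) \<ge> 1 - \<eta> / 2 * (1 / 2) ^ Suc m" by metis
  note ns = ns'[unfolded q_def]
  obtain A where A: "\<forall>\<^sub>F r in at_right 0. \<exists>E\<in>events. prob E \<ge> 1 - \<eta> / 2 \<and> (\<forall>\<omega>\<in>E. zz r \<omega> k \<le> A)"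
    using initial_tight[OF k \<eta>2] by blast
  have "\<forall>\<^sub>F r in at_right 0. \<exists>E\<in>events. prob E \<ge> 1 - \<eta> \<and>
    (\<forall>\<omega>\<in>E. zz r \<omega> k \<le> A \<and> (\<forall>m. modulus_ok (real m) (1 / real (Suc m)) (ns m) (\<lambda>t. bm r 0 t \<omega>)))"
    using eventually_unit A
  proof eventually_elim
    case (elim r)
    obtain E where E: "E \<in> events" "prob E \<ge> 1 - \<eta> / 2" "\<forall>\<omega>\<in>E. zz r \<omega> k \<le> A" using elim(2) by blast
    let ?G = "\<lambda>m. {\<omega> \<in> space M. modulus_ok (real m) (1 / real (Suc m)) (ns m) (\<lambda>t. bm r 0 t \<omega>)}"
    note bm = bm_std[OF elim(1)]
    have G: "?G m \<in> events" "prob (?G m) \<ge> 1 - \<eta> / 2 * (1 / 2) ^ Suc m" for m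
    proof -
      show "?G m \<in> events" by (rule modulus_ok_event(3)[OF bm])
      show "prob (?G m) \<ge> 1 - \<eta> / 2 * (1 / 2) ^ Suc m"
        using ns[of m] unfolding modulus_ok_prob_eq[OF bm ref, of "real m" "1 / real (Suc m)" "ns m"] .
    qed
    note GI = prob_countable_INT_ge[of ?G "\<eta> / 2", OF G]
    have "prob (E \<inter> (\<Inter>m. ?G m)) \<ge> 1 - (\<eta> / 2 + \<eta> / 2)"
      by (rule prob_Int_ge[OF E(1) GI(1) E(2) GI(2)])
    then have "prob (E \<inter> (\<Inter>m. ?G m)) \<ge> 1 - \<eta>" by simp
    moreover have "E \<inter> (\<Inter>m. ?G m) \<in> events" using E(1) GI(1) by (rule sets.Int)
    moreover have "\<forall>\<omega>\<in>E \<inter> (\<Inter>m. ?G m). zz r \<omega> k \<le> A \<and>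
        (\<forall>m. modulus_ok (real m) (1 / real (Suc m)) (ns m) (\<lambda>t. bm r 0 t \<omega>))" using E(3) by blast
    ultimately show ?case by (intro bexI[of _ "E \<inter> (\<Inter>m. ?G m)"] conjI)
  qed
  then show ?thesis by (intro exI[of _ "(A, ns)"]) simp
qed

text \<open>
  Inputs in a compact set make \<open>f\<close> uniformly continuous along the reflected paths,
  and on this set the pathwise error is eventually below the threshold \<open>\<delta>\<close>.
\<close>
lemma functional_close:
  assumes f: "continuous_map path_topology euclideanreal f" and \<eta>: "\<eta> > 0"
  shows "whp (at_right 0) M (\<lambda>r \<omega>.
    \<bar>f (zh r \<omega> k) - f (srbm_path (zz r \<omega> k) (limit_drift R k) sd (\<lambda>t. bm r 0 t \<omega>))\<bar> \<le> \<eta>)"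
proof (rule whp_tight[OF input_tight])
  fix p :: "real \<times> (nat \<Rightarrow> nat)"
  obtain T \<delta> where \<delta>: "\<delta> > 0" "T \<ge> 0"
    and unif: "\<And>a b y. \<bar>a\<bar> \<le> fst p \<Longrightarrow> continuous_on {0..} b \<Longrightarrow>
      (\<And>m. modulus_ok (real m) (1 / real (Suc m)) (snd p m) b) \<Longrightarrow> cadlag y \<Longrightarrow>
      (\<And>t. 0 \<le> t \<Longrightarrow> t \<le> T \<Longrightarrow> \<bar>y t - srbm_path a (limit_drift R k) sd b t\<bar> < \<delta>) \<Longrightarrow>
      \<bar>f y - f (srbm_path a (limit_drift R k) sd b)\<bar> < \<eta>"
  proof (rule path_functional_uniform[OF f \<eta>, of "fst p" "snd p" "limit_drift R k" sd])
    fix T \<delta> :: real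
    assume a: "\<delta> > 0" "T \<ge> 0" and b: "\<And>a b y. \<bar>a\<bar> \<le> fst p \<Longrightarrow> continuous_on {0..} b \<Longrightarrow>
      (\<And>m. modulus_ok (real m) (1 / real (Suc m)) (snd p m) b) \<Longrightarrow> cadlag y \<Longrightarrow>
      (\<And>t. 0 \<le> t \<Longrightarrow> t \<le> T \<Longrightarrow> \<bar>y t - srbm_path a (limit_drift R k) sd b t\<bar> < \<delta>) \<Longrightarrow>
      \<bar>f y - f (srbm_path a (limit_drift R k) sd b)\<bar> < \<eta>"
    show thesis by (rule that[OF a b])
  qed
  have \<delta>2: "\<delta> / 2 > 0" using \<delta>(1) by simp
  show "whp (at_right 0) M (\<lambda>r \<omega>.
      zz r \<omega> k \<le> fst p \<and> (\<forall>m. modulus_ok (real m) (1 / real (Suc m)) (snd p m) (\<lambda>t. bm r 0 t \<omega>)) \<longrightarrow>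
      \<bar>f (zh r \<omega> k) - f (srbm_path (zz r \<omega> k) (limit_drift R k) sd (\<lambda>t. bm r 0 t \<omega>))\<bar> \<le> \<eta>)"
  proof (rule whp_mono[OF active_close[OF \<delta>(2) \<delta>2]])
    show "\<forall>\<^sub>F r in at_right 0. \<forall>\<omega>\<in>space M.
      (\<forall>t\<in>{0..T}. \<bar>zh r \<omega> k t - srbm_path (zz r \<omega> k) (limit_drift R k) sd (\<lambda>t. bm r 0 t \<omega>) t\<bar> \<le> \<delta> / 2) \<longrightarrow>
      zz r \<omega> k \<le> fst p \<and> (\<forall>m. modulus_ok (real m) (1 / real (Suc m)) (snd p m) (\<lambda>t. bm r 0 t \<omega>)) \<longrightarrow>
      \<bar>f (zh r \<omega> k) - f (srbm_path (zz r \<omega> k) (limit_drift R k) sd (\<lambda>t. bm r 0 t \<omega>))\<bar> \<le> \<eta>"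
      using eventually_unit
    proof eventually_elim
      case (elim r)
      show ?case
      proof (intro ballI impI)
        fix \<omega> assume \<omega>: "\<omega> \<in> space M"
          and close: "\<forall>t\<in>{0..T}. \<bar>zh r \<omega> k t - srbm_path (zz r \<omega> k) (limit_drift R k) sd (\<lambda>t. bm r 0 t \<omega>) t\<bar> \<le> \<delta> / 2"
          and ok: "zz r \<omega> k \<le> fst p \<and> (\<forall>m. modulus_ok (real m) (1 / real (Suc m)) (snd p m) (\<lambda>t. bm r 0 t \<omega>))"
        have "\<bar>f (zh r \<omega> k) - f (srbm_path (zz r \<omega> k) (limit_drift R k) sd (\<lambda>t. bm r 0 t \<omega>))\<bar> < \<eta>"
        proof (rule unif)
          show "\<bar>zz r \<omega> k\<bar> \<le> fst p" using ok zz_nonneg[OF elim \<omega> k] by simp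
          show "continuous_on {0..} (\<lambda>t. bm r 0 t \<omega>)" by (rule bm_continuous[OF bm_std[OF elim] \<omega>])
          show "modulus_ok (real m) (1 / real (Suc m)) (snd p m) (\<lambda>t. bm r 0 t \<omega>)" for m using ok by blast
          show "cadlag (zh r \<omega> k)" by (rule continuous_on_imp_cadlag[OF hat_continuous(1)[OF elim \<omega> k]])
          fix t assume "0 \<le> t" "t \<le> T"
          then have "\<bar>zh r \<omega> k t - srbm_path (zz r \<omega> k) (limit_drift R k) sd (\<lambda>t. bm r 0 t \<omega>) t\<bar> \<le> \<delta> / 2"
            by (intro bspec[OF close]) simp
          then show "\<bar>zh r \<omega> k t - srbm_path (zz r \<omega> k) (limit_drift R k) sd (\<lambda>t. bm r 0 t \<omega>) t\<bar> < \<delta>"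
            using \<delta>(1) by linarith
        qed
        then show "\<bar>f (zh r \<omega> k) - f (srbm_path (zz r \<omega> k) (limit_drift R k) sd (\<lambda>t. bm r 0 t \<omega>))\<bar> \<le> \<eta>" by simp
      qed
    qed
  qed
qed

text \<open>
  Replace \<open>Z\<^sub>k\<close> by the exact reflected Brownian motion, integrate out the
  noise, and let the law of the initial state converge. The limit process gives the same integral
  over its own initial law.
\<close>
theorem active_converges:
  fixes N' :: "'c measure"
  assumes S: "one_dim_srbm N' x (limit_drift R k) (limit_variance J \<Gamma> R k) Zs"
    and x_law: "distr N' borel x = distr N borel (\<xi> k)"
  shows "converges_in_law path_topology (at_right 0) M (\<lambda>r \<omega>. zh r \<omega> k) N' Zs"
proof -
  obtain V where V: "std_brownian_motion N' 1 V"
    and Vi: "indep_elements N' borel x (process_space 1) (process_element 1 V)"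
    and Zs: "\<And>\<omega>. \<omega> \<in> space N' \<Longrightarrow> Zs \<omega> = Phi1 (\<lambda>t. x \<omega> + limit_drift R k * t + sd * V 0 t \<omega>)"
    and xm: "x \<in> borel_measurable N'" and x0: "\<And>\<omega>. \<omega> \<in> space N' \<Longrightarrow> x \<omega> \<ge> 0"
    using S unfolding one_dim_srbm_def by blast
  let ?path = "\<lambda>r \<omega>. srbm_path (zz r \<omega> k) (limit_drift R k) sd (\<lambda>t. bm r 0 t \<omega>)"
  have Zs_path: "Zs \<omega> = srbm_path (x \<omega>) (limit_drift R k) sd (\<lambda>t. V 0 t \<omega>)" if \<omega>: "\<omega> \<in> space N'" for \<omega>
    unfolding Zs[OF \<omega>] srbm_path_def using x0[OF \<omega>] bm_zero[OF V \<omega>] by (simp add: max_def)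
  have Zsm: "Zs \<in> measurable N' (borel_of_topology path_topology)"
  proof (rule measurable_cong[THEN iffD2])
    show "(\<lambda>\<omega>. srbm_path (x \<omega>) (limit_drift R k) sd (\<lambda>t. V 0 t \<omega>)) \<in> measurable N' (borel_of_topology path_topology)"
      by (rule srbm_path_measurable[OF xm bm_continuous[OF V]]) (auto intro: std_bmD(2)[OF V])
  qed (rule Zs_path)
  have zhm: "(\<lambda>\<omega>. zh r \<omega> k) \<in> measurable M (borel_of_topology path_topology)" if r: "r \<in> {0<..<1}" for r
    by (rule path_measurable[OF hat_continuous(1)[OF r _ k] hat_measurable(1)[OF r k]])
  have zzm: "(\<lambda>\<omega>. zz r \<omega> k) \<in> borel_measurable M" if r: "r \<in> {0<..<1}" for r
    by (rule borel_measurable_times[OF borel_measurable_const Z0_meas[OF r k]])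
  have half: "(1/2 :: real) \<in> {0<..<1}" by simp
  note ref = bm_std[OF half]
  show ?thesis
    unfolding converges_in_law_def
  proof (intro conjI allI impI)
    show "\<forall>\<^sub>F r in at_right 0. (\<lambda>\<omega>. zh r \<omega> k) \<in> measurable M (borel_of_topology path_topology)"
      using eventually_unit by (rule eventually_mono) (rule zhm)
    show "Zs \<in> measurable N' (borel_of_topology path_topology)" by (rule Zsm)
    fix f :: "(real \<Rightarrow> real) \<Rightarrow> real"
    assume fb: "continuous_map path_topology euclideanreal f \<and> bounded (f ` topspace path_topology)"
    then have f: "continuous_map path_topology euclideanreal f" by simp
    obtain C where C: "\<And>x. cadlag x \<Longrightarrow> \<bar>f x\<bar> \<le> C"
      using path_functional_bound[OF conjunct2[OF fb]] by metis
    define h where "h = srbm_mean f (limit_drift R k) sd M (bm (1/2))"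
    have hc: "continuous_on UNIV h" unfolding h_def by (rule srbm_mean_continuous(1)[OF f C ref])
    have hb: "\<bar>h a\<bar> \<le> C" for a unfolding h_def by (rule srbm_mean_continuous(2)[OF f C ref])
    have hm: "h \<in> borel_measurable borel" by (rule borel_measurable_continuous_onI[OF hc])
    have fz: "(\<lambda>\<omega>. f (zh r \<omega> k)) \<in> borel_measurable M" if "r \<in> {0<..<1}" for r
      by (rule measurable_compose[OF zhm[OF that] path_functional_measurable[OF f]])
    have fp: "(\<lambda>\<omega>. f (?path r \<omega>)) \<in> borel_measurable M" if r: "r \<in> {0<..<1}" for r
      by (rule srbm_functional_measurable[OF f C zzm[OF r] bm_continuous[OF bm_std[OF r]] std_bmD(2)[OF bm_std[OF r]]]) auto
    have bz: "\<bar>f (zh r \<omega> k)\<bar> \<le> C" if "r \<in> {0<..<1}" "\<omega> \<in> space M" for r \<omega>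
      by (rule C[OF continuous_on_imp_cadlag[OF hat_continuous(1)[OF that k]]])
    have bp: "\<bar>f (?path r \<omega>)\<bar> \<le> C" if "r \<in> {0<..<1}" "\<omega> \<in> space M" for r \<omega>
      by (rule C[OF srbm_path_cadlag[OF bm_continuous[OF bm_std[OF that(1)] that(2)]]])
    have "((\<lambda>r. \<integral>\<omega>. f (zh r \<omega> k) - f (?path r \<omega>) \<partial>M) \<longlongrightarrow> 0) (at_right 0)"
    proof (rule whp_integral[OF functional_close[OF f]])
      show "\<forall>\<^sub>F r in at_right 0. (\<lambda>\<omega>. f (zh r \<omega> k) - f (?path r \<omega>)) \<in> borel_measurable M \<and>
          (\<forall>\<omega>\<in>space M. \<bar>f (zh r \<omega> k) - f (?path r \<omega>)\<bar> \<le> 2 * C)"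
        using eventually_unit
      proof (rule eventually_mono)
        fix r :: real assume r: "r \<in> {0<..<1}"
        have "\<bar>f (zh r \<omega> k) - f (?path r \<omega>)\<bar> \<le> 2 * C" if "\<omega> \<in> space M" for \<omega>
          using bz[OF r that] bp[OF r that] by linarith
        then show "(\<lambda>\<omega>. f (zh r \<omega> k) - f (?path r \<omega>)) \<in> borel_measurable M \<and>
          (\<forall>\<omega>\<in>space M. \<bar>f (zh r \<omega> k) - f (?path r \<omega>)\<bar> \<le> 2 * C)"
          using borel_measurable_diff[OF fz[OF r] fp[OF r]] by blast
      qed
    qed
    moreover have "((\<lambda>r. \<integral>\<omega>. h (zz r \<omega> k) \<partial>M) \<longlongrightarrow> (\<integral>\<omega>. h (\<xi> k \<omega>) \<partial>N)) (at_right 0)"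
      by (rule initial_functional[OF hc hb k])
    ultimately have sum: "((\<lambda>r. (\<integral>\<omega>. f (zh r \<omega> k) - f (?path r \<omega>) \<partial>M) + (\<integral>\<omega>. h (zz r \<omega> k) \<partial>M))
        \<longlongrightarrow> 0 + (\<integral>\<omega>. h (\<xi> k \<omega>) \<partial>N)) (at_right 0)"
      by (rule tendsto_add)
    have ev: "\<forall>\<^sub>F r in at_right 0. (\<integral>\<omega>. f (zh r \<omega> k) - f (?path r \<omega>) \<partial>M) + (\<integral>\<omega>. h (zz r \<omega> k) \<partial>M)
        = (\<integral>\<omega>. f (zh r \<omega> k) \<partial>M)"
      using eventually_unit
    proof (rule eventually_mono)
      fix r :: real assume r: "r \<in> {0<..<1}"
      have "(\<integral>\<omega>. f (?path r \<omega>) \<partial>M) = (\<integral>\<omega>. h (zz r \<omega> k) \<partial>M)"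
        unfolding h_def by (rule srbm_expectation[OF f C ref bm_std[OF r] bm_indep[OF r]])
      moreover have "(\<integral>\<omega>. f (zh r \<omega> k) - f (?path r \<omega>) \<partial>M) = (\<integral>\<omega>. f (zh r \<omega> k) \<partial>M) - (\<integral>\<omega>. f (?path r \<omega>) \<partial>M)"
      proof (rule Bochner_Integration.integral_diff)
        show "integrable M (\<lambda>\<omega>. f (zh r \<omega> k))"
          by (rule integrable_const_bound[where B = C, OF _ fz[OF r]]) (use bz[OF r] in auto)
        show "integrable M (\<lambda>\<omega>. f (?path r \<omega>))"
          by (rule integrable_const_bound[where B = C, OF _ fp[OF r]]) (use bp[OF r] in auto)
      qed
      ultimately show "(\<integral>\<omega>. f (zh r \<omega> k) - f (?path r \<omega>) \<partial>M) + (\<integral>\<omega>. h (zz r \<omega> k) \<partial>M) = (\<integral>\<omega>. f (zh r \<omega> k) \<partial>M)"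
        by simp
    qed
    have "(\<integral>\<omega>. f (Zs \<omega>) \<partial>N') = (\<integral>\<omega>. f (srbm_path (x \<omega>) (limit_drift R k) sd (\<lambda>t. V 0 t \<omega>)) \<partial>N')"
      by (rule Bochner_Integration.integral_cong[OF refl]) (simp add: Zs_path)
    also have "\<dots> = (\<integral>\<omega>. h (x \<omega>) \<partial>N')"
      unfolding h_def by (rule srbm_expectation[OF f C ref V Vi])
    also have "\<dots> = (\<integral>a. h a \<partial>distr N' borel x)" by (rule integral_distr[OF xm hm, symmetric])
    also have "\<dots> = (\<integral>\<omega>. h (\<xi> k \<omega>) \<partial>N)" unfolding x_law by (rule integral_distr[OF xi_meas[OF k] hm])
    finally have lim: "(\<integral>\<omega>. f (Zs \<omega>) \<partial>N') = 0 + (\<integral>\<omega>. h (\<xi> k \<omega>) \<partial>N)" by simp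
    show "((\<lambda>r. \<integral>\<omega>. f (zh r \<omega> k) \<partial>M) \<longlongrightarrow> (\<integral>\<omega>. f (Zs \<omega>) \<partial>N')) (at_right 0)"
      unfolding lim by (rule Lim_transform_eventually[OF sum ev])
  qed
qed

theorem fast_converges:
  assumes i: "i < k"
  shows "converges_in_law path_topology (at_right 0) M (\<lambda>r \<omega>. zh r \<omega> i) M (\<lambda>\<omega> t. 0)"
proof (rule converges_in_law_zero[OF prob_space_axioms])
  have iJ: "i < J" using i k by simp
  show "\<forall>\<^sub>F r in at_right 0. (\<forall>\<omega>\<in>space M. continuous_on {0..} (zh r \<omega> i)) \<and>
      (\<forall>t\<ge>0. (\<lambda>\<omega>. zh r \<omega> i t) \<in> borel_measurable M)"
    using eventually_unit
    by (rule eventually_mono) (intro conjI ballI allI impI hat_continuous(1) hat_measurable(1) iJ)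
  fix T e :: real assume T: "T \<ge> 0" and e: "e > 0"
  show "whp (at_right 0) M (\<lambda>r \<omega>. \<forall>t\<in>{0..T}. \<bar>zh r \<omega> i t\<bar> \<le> e)"
  proof (rule whp_mono[OF fast_collapse[OF i e T]])
    show "\<forall>\<^sub>F r in at_right 0. \<forall>\<omega>\<in>space M. (\<forall>t\<in>{0..T}. zh r \<omega> i t \<le> e) \<longrightarrow> (\<forall>t\<in>{0..T}. \<bar>zh r \<omega> i t\<bar> \<le> e)"
      using eventually_unit
    proof (rule eventually_mono, intro ballI impI)
      fix r \<omega> t assume r: "r \<in> {0<..<1}" and \<omega>: "\<omega> \<in> space M" and t: "t \<in> {0..T}"
        and le: "\<forall>t\<in>{0..T}. zh r \<omega> i t \<le> e"
      have "zh r \<omega> i t \<ge> 0" using reflectedD(1)[OF hat_reflected[OF r \<omega>] iJ, of t] t by simp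
      moreover have "zh r \<omega> i t \<le> e" using le t by blast
      ultimately show "\<bar>zh r \<omega> i t\<bar> \<le> e" by linarith
    qed
  qed
qed

theorem slow_converges:
  assumes j: "k < j" "j < J"
  shows "converges_in_law path_topology (at_right 0) M (\<lambda>r \<omega>. yh r \<omega> j) M (\<lambda>\<omega> t. 0)"
proof (rule converges_in_law_zero[OF prob_space_axioms])
  show "\<forall>\<^sub>F r in at_right 0. (\<forall>\<omega>\<in>space M. continuous_on {0..} (yh r \<omega> j)) \<and>
      (\<forall>t\<ge>0. (\<lambda>\<omega>. yh r \<omega> j t) \<in> borel_measurable M)"
    using eventually_unit
    by (rule eventually_mono) (intro conjI ballI allI impI hat_continuous(2) hat_measurable(2) j(2))
  fix T e :: real assume T: "T \<ge> 0" and e: "e > 0"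
  show "whp (at_right 0) M (\<lambda>r \<omega>. \<forall>t\<in>{0..T}. \<bar>yh r \<omega> j t\<bar> \<le> e)"
  proof (rule whp_mono[OF slow_free[OF T] always_eventually], intro allI ballI impI)
    fix r \<omega> t assume free: "\<forall>j\<in>{Suc k..<J}. \<forall>t\<in>{0..T}. yh r \<omega> j t = 0" and t: "t \<in> {0..T}"
    have "yh r \<omega> j t = 0" using bspec[OF bspec[OF free, of j], of t] j t by simp
    then show "\<bar>yh r \<omega> j t\<bar> \<le> e" using e by linarith
  qed
qed

end

end

section \<open>Convergence on every time scale\<close>

theorem proposition3:
  fixes J :: nat
    and \<epsilon> :: real
    and \<gamma> :: "nat \<Rightarrow> real \<Rightarrow> real"
    and \<Gamma> L R :: "real mat"
    and \<theta> :: "real \<Rightarrow> real Matrix.vec"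
    and M :: "'a measure"
    and W :: "nat \<Rightarrow> real \<Rightarrow> 'a \<Rightarrow> real"
    and Z0 :: "real \<Rightarrow> nat \<Rightarrow> 'a \<Rightarrow> real"
    and Z Y :: "real \<Rightarrow> 'a \<Rightarrow> nat \<Rightarrow> real \<Rightarrow> real"
    and N :: "'b measure"
    and \<xi> :: "nat \<Rightarrow> 'b \<Rightarrow> real"
  assumes J: "J \<ge> 1"
    and gamma_pos: "\<And>j r. j < J \<Longrightarrow> r \<in> {0<..<1} \<Longrightarrow> \<gamma> j r > 0"
    and gamma_mono: "\<And>j. j < J \<Longrightarrow> strict_mono_on {0<..<1} (\<gamma> j)"
    and gamma_lim: "\<And>j. j < J \<Longrightarrow> (\<gamma> j \<longlongrightarrow> 0) (at_right 0)"
    and gamma_sep: "\<And>i j. i < j \<Longrightarrow> j < J \<Longrightarrow> ((\<lambda>r. \<gamma> j r / \<gamma> i r) \<longlongrightarrow> 0) (at_right 0)"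
    and eps: "\<epsilon> \<in> {0<..<1}"
    and gamma_loglog:
      "((\<lambda>r. \<gamma> 0 r powr ((2 - \<epsilon>) / (2 + \<epsilon>)) * sqrt (ln (ln (1 / \<gamma> 0 r)))
             * ln (ln (1 / \<gamma> (J - 1) r))) \<longlongrightarrow> 0) (at_right 0)"
    and Gamma: "pos_def_mat J \<Gamma>"
    and L: "cholesky J \<Gamma> L"
    and R: "M_matrix J R"
    and W: "std_brownian_motion M J W"
    and Z0_meas: "\<And>r j. r \<in> {0<..<1} \<Longrightarrow> j < J \<Longrightarrow> Z0 r j \<in> borel_measurable M"
    and Z0_nonneg: "\<And>r j \<omega>. r \<in> {0<..<1} \<Longrightarrow> j < J \<Longrightarrow> \<omega> \<in> space M \<Longrightarrow> Z0 r j \<omega> \<ge> 0"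
    and Z0_indep: "\<And>r. r \<in> {0<..<1} \<Longrightarrow>
      indep_elements M (Pi\<^sub>M {..<J} (\<lambda>_. borel)) (\<lambda>\<omega>. \<lambda>j\<in>{..<J}. Z0 r j \<omega>)
        (process_space J) (process_element J W)"
    and Z: "\<And>r \<omega>. r \<in> {0<..<1} \<Longrightarrow> \<omega> \<in> space M \<Longrightarrow>
      Z r \<omega> = Phi J R (srbm_input J L (\<theta> r) (Z0 r) W \<omega>)"
    and Y: "\<And>r \<omega>. r \<in> {0<..<1} \<Longrightarrow> \<omega> \<in> space M \<Longrightarrow>
      Y r \<omega> = Psi J R (srbm_input J L (\<theta> r) (Z0 r) W \<omega>)"
    and drift: "\<And>r. r \<in> {0<..<1} \<Longrightarrow> \<theta> r = - (R *\<^sub>v Matrix.vec J (\<lambda>j. \<gamma> j r))"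
    and N: "prob_space N"
    and xi_nonneg: "\<And>j \<omega>. j < J \<Longrightarrow> \<omega> \<in> space N \<Longrightarrow> \<xi> j \<omega> \<ge> 0"
    and xi_indep: "prob_space.indep_vars N (\<lambda>_. borel) \<xi> {..<J}"
    and initial_conv:
      "converges_in_law (product_topology (\<lambda>_. euclideanreal) {..<J}) (at_right 0)
         M (\<lambda>r \<omega>. \<lambda>j\<in>{..<J}. \<gamma> j r * Z0 r j \<omega>) N (\<lambda>\<omega>. \<lambda>j\<in>{..<J}. \<xi> j \<omega>)"
    and initial_sep: "\<And>j. 1 \<le> j \<Longrightarrow> j < J \<Longrightarrow>
      tends_to_infinity_in_probability (at_right 0) M (\<lambda>r \<omega>. \<gamma> (j - 1) r * Z0 r j \<omega>)"
  shows
    "(\<forall>k<J. \<forall>(N' :: 'c measure) x Zs.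
        one_dim_srbm N' x (limit_drift R k) (limit_variance J \<Gamma> R k) Zs \<and>
        distr N' borel x = distr N borel (\<xi> k) \<longrightarrow>
        converges_in_law path_topology (at_right 0)
          M (\<lambda>r \<omega> t. \<gamma> k r * Z r \<omega> k (t / (\<gamma> k r)\<^sup>2)) N' Zs) \<and>
     (\<forall>k<J. \<forall>i<k.
        converges_in_law path_topology (at_right 0)
          M (\<lambda>r \<omega> t. \<gamma> k r * Z r \<omega> i (t / (\<gamma> k r)\<^sup>2)) M (\<lambda>\<omega> t. 0)) \<and>
     (\<forall>j<J. \<forall>k<j.
        converges_in_law path_topology (at_right 0)
          M (\<lambda>r \<omega> t. \<gamma> k r * Y r \<omega> j (t / (\<gamma> k r)\<^sup>2)) M (\<lambda>\<omega> t. 0))"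
proof -
  have xi_meas: "\<xi> j \<in> borel_measurable N" if "j < J" for j
    using xi_indep that unfolding prob_space.indep_vars_def[OF N] by simp
  interpret srbm_family J \<gamma> \<Gamma> L R \<theta> M W Z0 Z Y N \<xi>
    by (rule srbm_family.intro)
      (fact J gamma_pos gamma_sep Gamma L R W Z0_meas Z0_nonneg Z0_indep Z Y drift N xi_meas
        initial_conv initial_sep)+
  show ?thesis
  proof (intro conjI allI impI)
    fix k and N' :: "'c measure" and x Zs
    assume "k < J" and "one_dim_srbm N' x (limit_drift R k) (limit_variance J \<Gamma> R k) Zs \<and>
        distr N' borel x = distr N borel (\<xi> k)"
    then show "converges_in_law path_topology (at_right 0)
          M (\<lambda>r \<omega> t. \<gamma> k r * Z r \<omega> k (t / (\<gamma> k r)\<^sup>2)) N' Zs"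
      using active_converges[of k N' x Zs] by blast
  next
    fix k i assume "k < J" "i < k"
    then show "converges_in_law path_topology (at_right 0)
          M (\<lambda>r \<omega> t. \<gamma> k r * Z r \<omega> i (t / (\<gamma> k r)\<^sup>2)) M (\<lambda>\<omega> t. 0)"
      by (rule fast_converges)
  next
    fix j k assume "j < J" "k < j"
    then show "converges_in_law path_topology (at_right 0)
          M (\<lambda>r \<omega> t. \<gamma> k r * Y r \<omega> j (t / (\<gamma> k r)\<^sup>2)) M (\<lambda>\<omega> t. 0)"
      by (intro slow_converges) auto
  qed
qed

end
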